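(* Assume that $f:\mathbb{N}\to(0,\infty)$ is bounded from above and from below, i.e. there is a constant $c>0$ with $c\le f(n)\le 1/c$ for all $n\in\mathbb{N}$ (fix such a $c$), and that $S_n/n\to 0$ as $n\to\infty$. Then there exist a random variable $W_\infty(0)>0$ and a random set $\mathcal{Z}\subset(-\infty,1)\setminus\{0\}$, which is at most countable and whose elements are isolated, such that the following holds. (1) Almost surely, as $n\to\infty$, $$\mathbb{L}_n(k)=\frac{W_\infty(0)e^{\mathrm{h}_n}}{\sqrt{2\pi \mathrm{h}_n}}\exp\left(S_k-\frac12\left(\frac{k-\mathrm{h}_n}{\sqrt{\mathrm{h}_n}}\right)^2\right)+e^{S_k}\,o\left(\frac{e^{\mathrm{h}_n}}{\sqrt{\mathrm{h}_n}}\right),$$ where the small $o$ is uniform in $k\in\mathbb{N}$. (2) For every compact set $K\subset(-\infty,1)$, on the event that $K\cap\mathcal{Z}=\emptyset$, almost surely, for all $z\in K$, as $n\to\infty$, $$\mathbb{L}_n(\lfloor e^z\mathrm{h}_n\rfloor)=\exp\left(S_{\lfloor e^z\mathrm{h}_n\rfloor}+(1-z)e^z\mathrm{h}_n-\frac12\log \mathrm{h}_n+O(1)\right),$$ where the $O(1)$ is uniform in $z\in K$. (3) Almost surely, $\dfrac{\mathrm{h}_n}{\log n}\to 1$ and $\dfrac{d(\mathcal{T}_n)}{\log n}\to e$ as $n\to\infty$.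
   Context: $\mathbb{N}=\{0,1,2,\dots\}$. For a rooted tree, the depth $d(v)$ of a vertex $v$ is its graph distance to the root, and the depth $d(\mathcal{T})$ of a finite rooted tree $\mathcal{T}$ is the maximal depth of its vertices. Given a weight function $f:\mathbb{N}\to(0,\infty)$, the sequence of depth-weighted random recursive trees $(\mathcal{T}_n)_{n\ge0}$ is defined as follows: $\mathcal{T}_0$ consists of a single (root) vertex $v_0$; given $\mathcal{T}_n$, a vertex of $\mathcal{T}_n$ is chosen with probability proportional to its weight, i.e. $v\in\mathcal{T}_n$ is chosen with probability $f(d(v))/\sum_{u\in\mathcal{T}_n}f(d(u))$, and $\mathcal{T}_{n+1}$ is obtained by attaching a new vertex $v_{n+1}$ to the chosen vertex. $S_0=0$ and $S_n=\sum_{k=0}^{n-1}\log f(k)$. $\mathbb{L}_n(k)$ is the number of vertices of $\mathcal{T}_n$ at depth $k$. $Z_n=\sum_{v\in\mathcal{T}_n}f(d(v))$. With $c$ as fixed in the claim, $n_0=\lfloor e^2/c\rfloor+1$ and, for $n\ge n_0$, $\mathrm{h}_n=\sum_{k=n_0}^{n-1}\frac1{Z_k}$ (a random variable). A point $z$ of a set $\mathcal{Z}\subset\mathbb{R}$ is isolated if there exists $\varepsilon>0$ such that $(z-\varepsilon,z+\varepsilon)\cap\mathcal{Z}=\{z\}$. *)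

theory Defs
  imports "HOL-Probability.Probability"
begin

record 'v rooted_tree =
  verts :: "'v set"
  edges :: "'v set set"
  root_vertex :: 'v

definition adjacency :: "'v rooted_tree \<Rightarrow> ('v \<times> 'v) set" where
  "adjacency t = {(x, y). {x, y} \<in> edges t}"

text \<open>The graph distance to the root: \<open>(x, y) \<in> adjacency t ^^ m\<close> says that there is a walk
  of length \<open>m\<close> from \<open>x\<close> to \<open>y\<close>.\<close>

definition depth :: "'v rooted_tree \<Rightarrow> 'v \<Rightarrow> nat" where
  "depth t v = (LEAST m. (root_vertex t, v) \<in> adjacency t ^^ m)"

definition tree_depth :: "'v rooted_tree \<Rightarrow> nat" where
  "tree_depth t = Max (depth t ` verts t)"

definition single_vertex_tree :: "'v \<Rightarrow> 'v rooted_tree" where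
  "single_vertex_tree r = \<lparr>verts = {r}, edges = {}, root_vertex = r\<rparr>"

definition attach :: "'v rooted_tree \<Rightarrow> 'v \<Rightarrow> 'v \<Rightarrow> 'v rooted_tree" where
  "attach t u w = t\<lparr>verts := insert w (verts t), edges := insert {u, w} (edges t)\<rparr>"

definition total_weight :: "(nat \<Rightarrow> real) \<Rightarrow> 'v rooted_tree \<Rightarrow> real" where
  "total_weight f t = (\<Sum>v\<in>verts t. f (depth t v))"

definition level_size :: "'v rooted_tree \<Rightarrow> nat \<Rightarrow> nat" where
  "level_size t k = card {v \<in> verts t. depth t v = k}"

text \<open>The vertex \<open>v\<^sub>i\<close> is the natural number \<open>i\<close>, and \<open>X n\<close> is the vertex of \<open>T n\<close> to which
  \<open>Suc n\<close> is attached. Since the labels record the order of arrival, \<open>T n\<close> determines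
  \<open>T 0, \<dots>, T n\<close>, so conditioning on the value of \<open>T n\<close> is conditioning on the whole past of
  the process. It takes finitely many values, so elementary conditional probabilities suffice.\<close>

locale depth_weighted_rrt = prob_space M
  for M :: "'a measure" and f :: "nat \<Rightarrow> real"
    and T :: "nat \<Rightarrow> 'a \<Rightarrow> nat rooted_tree" and X :: "nat \<Rightarrow> 'a \<Rightarrow> nat" +
  assumes weight_pos: "\<And>k. 0 < f k"
    and choice_measurable: "\<And>n. X n \<in> measurable M (count_space UNIV)"
    and choice_in_verts: "\<And>n \<omega>. \<omega> \<in> space M \<Longrightarrow> X n \<omega> \<in> verts (T n \<omega>)"
    and tree_0: "\<And>\<omega>. \<omega> \<in> space M \<Longrightarrow> T 0 \<omega> = single_vertex_tree 0"
    and tree_Suc: "\<And>n \<omega>. \<omega> \<in> space M \<Longrightarrow> T (Suc n) \<omega> = attach (T n \<omega>) (X n \<omega>) (Suc n)"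
    and choice_law: "\<And>n t v. \<P>(\<omega> in M. T n \<omega> = t) > 0 \<Longrightarrow> v \<in> verts t \<Longrightarrow>
          \<P>(\<omega> in M. X n \<omega> = v \<bar> T n \<omega> = t) = f (depth t v) / total_weight f t"

definition log_weight_sum :: "(nat \<Rightarrow> real) \<Rightarrow> nat \<Rightarrow> real" where
  "log_weight_sum f n = (\<Sum>k<n. ln (f k))"

definition start_index :: "real \<Rightarrow> nat" where
  "start_index c = nat \<lfloor>exp 2 / c\<rfloor> + 1"

definition intrinsic_time :: "(nat \<Rightarrow> real) \<Rightarrow> real \<Rightarrow> (nat \<Rightarrow> 'v rooted_tree) \<Rightarrow> nat \<Rightarrow> real" where
  "intrinsic_time f c t n = (\<Sum>k = start_index c..<n. 1 / total_weight f (t k))"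

text \<open>Measurability of a random subset of the real line. Open sets are countable unions of compact
  sets, so the events that the random set hits a given open set are covered as well.\<close>

definition random_set :: "'a measure \<Rightarrow> ('a \<Rightarrow> real set) \<Rightarrow> bool" where
  "random_set M \<Z> \<longleftrightarrow> (\<forall>K. compact K \<longrightarrow> {\<omega> \<in> space M. K \<inter> \<Z> \<omega> = {}} \<in> sets M)"

definition isolated_point :: "real \<Rightarrow> real set \<Rightarrow> bool" where
  "isolated_point z A \<longleftrightarrow> (\<exists>\<epsilon>>0. {z - \<epsilon><..<z + \<epsilon>} \<inter> A = {z})"

end

theory Submission
  imports Defs "HOL-Complex_Analysis.Complex_Analysis" "HOL-Real_Asymp.Real_Asymp"
begin

text \<open>
  Write \<open>Z n\<close> for the total weight of the tree and \<open>h n\<close> for the sum of the \<open>1 / Z k\<close>. Give a vertex at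
  depth \<open>d\<close> the value \<open>exp (z d - S d)\<close> and let \<open>\<Phi> n z\<close> be the sum of these values. A new vertex
  multiplies \<open>\<Phi> n z\<close> in conditional mean by \<open>1 + exp z / Z n\<close>, so that \<open>\<Phi> n z\<close> divided by the product of
  these factors is a martingale, holomorphic in \<open>z\<close>, and the product is \<open>exp (h n exp z)\<close> up to a convergent
  factor. As \<open>S k = o(k)\<close>, for real \<open>x < 1\<close> the increments have summable moments of some order
  \<open>p > 1\<close>; integrating over circles and using Cauchy's formula turns this into locally uniform
  convergence near \<open>x\<close> and, for non-real \<open>z\<close>, into \<open>\<Phi> n z = O(exp (\<kappa> h n))\<close> with \<open>\<kappa> < exp (Re z)\<close>. The
  level sizes are Fourier coefficients of \<open>\<Phi> n\<close> along vertical lines, and Laplace's method gives the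
  profile. The exceptional set consists of the zeros of the limit on \<open>(-\<infinity>, 1)\<close>; they are isolated
  because the limit is holomorphic and does not vanish at 0.\<close>

section \<open>Moment inequalities\<close>

text \<open>The order \<open>p\<close> is dictated by the range of \<open>x\<close>. Second moments
  are controlled only if \<open>exp (2 * x) < 2 * exp x\<close>, that is \<open>x < ln 2\<close>; in
  general \<open>p * x < x + ln p\<close> is required, so \<open>p\<close> has to approach 1 as
  \<open>x\<close> does, and at 1 no order above 1 is left. The normaliser is random, since
  \<open>Z n\<close> depends on the tree, so the moments of future increments are not a series of
  constants. They are paid for by a second process, \<open>\<phi> n y / q n r powr p\<close>, whose
  mean tends to 0 because its denominator grows faster than its numerator. Martingale convergence
  does not exclude that the limit at 0 vanishes. Positivity there needs its own argument, on which
  the isolation of the zeros, the comparison of \<open>h n\<close> with \<open>ln n\<close> and the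
  lower bound for the depth all rest. Finally, each probabilistic estimate comes with a null set
  depending on \<open>z\<close>. As every estimate holds on a whole disc, countably many discs
  suffice, and the asymptotics are then deduced for each path separately.\<close>

lemma powr_one_plus_le:
  fixes s q :: real
  assumes "-1 \<le> s" "0 < q" "q \<le> 1"
  shows "(1 + s) powr q \<le> 1 + q * s"
proof -
  have "(1 + s) powr q * 1 powr (1 - q) \<le> q * (1 + s) + (1 - q) * 1"
    if "s \<noteq> -1" by (rule Youngs_inequality_0) (use assms that in auto)
  then show ?thesis using assms by (cases "s = -1") (auto simp: algebra_simps)
qed

text \<open>The concave inequality at exponent \<open>1 / p\<close>, applied to \<open>p * s\<close>
  and raised to the power \<open>p\<close>. If \<open>1 + p * s\<close> is not positive, there is
  nothing to show.\<close>

lemma powr_one_plus_ge: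
  fixes s p :: real
  assumes p: "1 < p" and "-1 \<le> s"
  shows "1 + p * s \<le> (1 + s) powr p"
proof (cases "1 + p * s \<le> 0")
  case True then show ?thesis by (smt (verit) powr_ge_zero)
next
  case False
  have "(1 + p * s) powr (1 / p) \<le> 1 + (1 / p) * (p * s)"
    by (rule powr_one_plus_le) (use p False in auto)
  then have "(1 + p * s) powr (1 / p) \<le> 1 + s" using p by simp
  then have "((1 + p * s) powr (1 / p)) powr p \<le> (1 + s) powr p"
    using p by (intro powr_mono2) auto
  then show ?thesis using p False by (simp add: powr_powr)
qed

text \<open>For small \<open>b\<close> the square \<open>1 + 2 * Re b + (norm b)\<^sup>2\<close> is
  raised to the concave power \<open>p / 2\<close>, and the leftover square is at most
  \<open>norm b powr p\<close>. For large \<open>b\<close> the left side is at most 4 times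
  \<open>norm b powr p\<close>, while the linear term may cost another 2; hence the 6.\<close>

lemma norm_one_plus_powr_le:
  fixes b :: complex and p :: real
  assumes p: "1 < p" "p \<le> 2"
  shows "norm (1 + b) powr p \<le> 1 + p * Re b + 6 * norm b powr p"
proof (cases "norm b \<le> 1")
  case True
  have sq: "(norm (1 + b))\<^sup>2 = 1 + (2 * Re b + (norm b)\<^sup>2)"
    by (simp add: cmod_power2) (simp add: power2_eq_square algebra_simps)
  have "norm (1 + b) powr p = ((norm (1 + b))\<^sup>2) powr (p / 2)"
    by (cases "1 + b = 0") (auto simp: powr_powr simp flip: powr_numeral)
  also have "\<dots> = (1 + (2 * Re b + (norm b)\<^sup>2)) powr (p / 2)" by (simp add: sq)
  also have "\<dots> \<le> 1 + (p / 2) * (2 * Re b + (norm b)\<^sup>2)"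
  proof (rule powr_one_plus_le)
    have "0 \<le> (norm (1 + b))\<^sup>2" by simp
    then show "- 1 \<le> 2 * Re b + (norm b)\<^sup>2" unfolding sq by linarith
  qed (use p in auto)
  also have "\<dots> = 1 + p * Re b + (p / 2) * (norm b)\<^sup>2" by (simp add: field_simps)
  also have "(p / 2) * (norm b)\<^sup>2 \<le> 1 * norm b powr p"
  proof (rule mult_mono)
    show "(norm b)\<^sup>2 \<le> norm b powr p"
    proof (cases "b = 0")
      case False
      have "(norm b)\<^sup>2 = norm b powr 2" by (simp add: False)
      also have "\<dots> \<le> norm b powr p" using True False p by (intro powr_mono') auto
      finally show ?thesis .
    qed simp
  qed (use p in auto)
  finally show ?thesis by (smt (verit) powr_ge_zero)
next
  case False
  then have b: "norm b > 1" by simp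
  have "norm (1 + b) \<le> 2 * norm b" using norm_triangle_ineq[of 1 b] b by simp
  then have "norm (1 + b) powr p \<le> (2 * norm b) powr p" using p by (intro powr_mono2) auto
  also have "\<dots> = 2 powr p * norm b powr p" by (simp add: powr_mult)
  also have "\<dots> \<le> 2 powr 2 * norm b powr p" using p by (intro mult_right_mono powr_mono) auto
  finally have 1: "norm (1 + b) powr p \<le> 4 * norm b powr p" by simp
  have "norm b powr 1 \<le> norm b powr p" using b p by (intro powr_mono) auto
  then have 2: "norm b \<le> norm b powr p" using b by simp
  have "\<bar>Re b\<bar> \<le> norm b powr p" using abs_Re_le_cmod[of b] 2 by linarith
  then have "p * \<bar>Re b\<bar> \<le> 2 * norm b powr p" using p by (intro mult_mono) auto
  moreover have "- (p * \<bar>Re b\<bar>) \<le> p * Re b" using p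
    by (smt (verit) mult_minus_right mult_left_mono abs_ge_minus_self)
  ultimately show ?thesis using 1 by linarith
qed

lemma norm_add_powr_le:
  fixes u b :: complex and p :: real
  assumes p: "1 < p" "p \<le> 2" and u: "u \<noteq> 0"
  shows "norm (u + b) powr p \<le> norm u powr p + p * norm u powr p * Re (b / u) + 6 * norm b powr p"
proof -
  have "norm (u + b) powr p = norm (u * (1 + b / u)) powr p" using u by (simp add: ring_distribs)
  also have "\<dots> = norm u powr p * norm (1 + b / u) powr p" by (simp only: norm_mult powr_mult)
  also have "\<dots> \<le> norm u powr p * (1 + p * Re (b / u) + 6 * norm (b / u) powr p)"
    by (intro mult_left_mono norm_one_plus_powr_le p) auto
  also have "norm (b / u) powr p = norm b powr p / norm u powr p"
    by (simp add: norm_divide powr_divide)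
  also have "norm u powr p * (1 + p * Re (b / u) + 6 * (norm b powr p / norm u powr p)) =
      norm u powr p + p * norm u powr p * Re (b / u) + 6 * norm b powr p"
    using u by (simp add: field_simps)
  finally show ?thesis .
qed

text \<open>A convex function lies above its tangent. In the moment inequality below, this turns the
  averaged linear terms back into a \<open>p\<close>-th power at the mean.\<close>

lemma norm_powr_tangent_le:
  fixes u m :: complex and p :: real
  assumes p: "1 < p" and u: "u \<noteq> 0"
  shows "norm u powr p + p * norm u powr p * Re (m / u) \<le> norm (u + m) powr p"
proof -
  have key: "1 + p * Re w \<le> norm (1 + w) powr p" for w :: complex
  proof (cases "-1 \<le> Re w")
    case True
    have "(1 + Re w) powr p \<le> norm (1 + w) powr p"
      using True p complex_Re_le_cmod[of "1 + w"] by (intro powr_mono2) auto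
    with powr_one_plus_ge[OF p True] show ?thesis by linarith
  next
    case False
    then have "p * Re w \<le> 1 * (-1)" using p
      by (smt (verit) mult_left_mono mult_minus_right mult_less_cancel_left2)
    then show ?thesis by (smt (verit) powr_ge_zero)
  qed
  have "norm u powr p + p * norm u powr p * Re (m / u) = norm u powr p * (1 + p * Re (m / u))"
    by (simp add: algebra_simps)
  also have "\<dots> \<le> norm u powr p * norm (1 + m / u) powr p"
    by (intro mult_left_mono key) auto
  also have "\<dots> = norm (u * (1 + m / u)) powr p" by (simp only: norm_mult powr_mult)
  also have "u * (1 + m / u) = u + m" using u by (simp add: field_simps)
  finally show ?thesis .
qed

text \<open>A one-step form of the von Bahr--Esseen inequality.\<close>

lemma weighted_sum_norm_powr_le:
  fixes w :: "'i \<Rightarrow> real" and b :: "'i \<Rightarrow> complex" and u :: complex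
  assumes p: "1 < p" "p \<le> 2" and "finite I" and w: "\<And>i. i \<in> I \<Longrightarrow> 0 \<le> w i" "sum w I = 1"
  shows "(\<Sum>i\<in>I. w i * norm (u + b i) powr p)
    \<le> norm (u + (\<Sum>i\<in>I. w i * b i)) powr p + 6 * (\<Sum>i\<in>I. w i * norm (b i) powr p)"
proof (cases "u = 0")
  case True
  have "(\<Sum>i\<in>I. w i * norm (b i) powr p) \<ge> 0" by (intro sum_nonneg mult_nonneg_nonneg w) auto
  then show ?thesis using True by (simp add: add_increasing)
next
  case False
  have "(\<Sum>i\<in>I. w i * norm (u + b i) powr p) \<le>
      (\<Sum>i\<in>I. w i * (norm u powr p + p * norm u powr p * Re (b i / u) + 6 * norm (b i) powr p))"
    by (intro sum_mono mult_left_mono norm_add_powr_le p w False)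
  also have "\<dots> = sum w I * norm u powr p + p * norm u powr p * (\<Sum>i\<in>I. w i * Re (b i / u))
      + 6 * (\<Sum>i\<in>I. w i * norm (b i) powr p)"
    by (simp add: algebra_simps sum.distrib sum_distrib_left sum_distrib_right)
  also have "(\<Sum>i\<in>I. w i * Re (b i / u)) = Re ((\<Sum>i\<in>I. w i * b i) / u)"
    by (simp add: sum_divide_distrib flip: Re_complex_of_real) (simp add: sum_divide_distrib flip: times_divide_eq_right)
  also have "sum w I * norm u powr p + p * norm u powr p * Re ((\<Sum>i\<in>I. w i * b i) / u)
      \<le> norm (u + (\<Sum>i\<in>I. w i * b i)) powr p"
    using norm_powr_tangent_le[OF p(1) False, of "\<Sum>i\<in>I. w i * b i"] w by simp
  finally show ?thesis by simp
qed

text \<open>Against the growth \<open>exp (p h exp x)\<close> of \<open>norm (\<Phi> n z) powr p\<close>, the \<open>p\<close>-th moments of its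
  increments grow like \<open>exp (h exp (p x + (p - 1) e))\<close>: this is where \<open>x < 1\<close> is needed.\<close>

lemma exists_moment_exponent:
  fixes x :: real
  assumes "x < 1"
  obtains p e where "1 < p" "p \<le> 2" "e > 0" "exp (p * x + (p - 1) * e) < p * exp x"
proof -
  define e where "e = (1 - x) / 2"
  \<comment> \<open>Both \<open>x + e\<close> and \<open>s\<close> are below 1. With
    \<open>p = 2 / (1 + s)\<close> one gets \<open>s * p < 1\<close>, which yields
    \<open>(p - 1) * s < 1 - 1 / p \<le> ln p\<close>; the truncation at 0 keeps \<open>p\<close> at
    most 2.\<close>
  define s where "s = max (x + e) 0"
  define p where "p = 2 / (1 + s)"
  have s: "0 \<le> s" "s < 1" using assms by (auto simp: s_def e_def field_simps)
  have p: "1 < p" "p \<le> 2" using s by (auto simp: p_def field_simps)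
  have "s < (1 + s) / 2" using s by simp
  then have "s * p < 1" using s by (simp add: p_def field_simps)
  have "(p - 1) * (x + e) \<le> (p - 1) * s" using p by (intro mult_left_mono) (auto simp: s_def)
  also have "\<dots> < (p - 1) * (1 / p)" using p \<open>s * p < 1\<close> by (intro mult_strict_left_mono) (auto simp: field_simps)
  also have "\<dots> = 1 - 1 / p" using p by (simp add: field_simps)
  also have "\<dots> \<le> ln p" using ln_le_minus_one[of "1 / p"] p by (simp add: ln_div)
  finally have "exp ((p - 1) * (x + e)) < p" using p by (metis exp_less_mono exp_ln less_trans zero_less_one)
  then have "exp ((p - 1) * (x + e)) * exp x < p * exp x" by simp
  also have "exp ((p - 1) * (x + e)) * exp x = exp (p * x + (p - 1) * e)"
    by (simp add: algebra_simps flip: exp_add)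
  finally show ?thesis using that[of p e] p assms by (simp add: e_def)
qed

text \<open>Cauchy's formula. On the concentric disc of half the radius the kernel has a denominator
  of at least \<open>R / 2\<close>, which gives the factor 2.\<close>

lemma norm_le_circle_integral:
  fixes g :: "complex \<Rightarrow> complex"
  assumes cont: "continuous_on (cball z0 R) g" and hol: "g holomorphic_on ball z0 R" and R: "R > 0"
    and w: "w \<in> cball z0 (R / 2)"
  shows "norm (g w) \<le> 2 * integral {0..1} (\<lambda>t::real. norm (g (z0 + R * exp (2 * pi * \<i> * t))))"
proof -
  have wb: "norm (w - z0) \<le> R / 2" using w by (simp add: dist_norm norm_minus_commute)
  have "norm (w - z0) < R" using wb R by linarith
  from Cauchy_integral_circlepath[OF cont hol this]
  have "((\<lambda>u. g u / (u - w)) has_contour_integral 2 * pi * \<i> * g w) (circlepath z0 R)" by simp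
  then have I: "((\<lambda>t. g (circlepath z0 R t) / (circlepath z0 R t - w) *
      vector_derivative (circlepath z0 R) (at t)) has_integral 2 * pi * \<i> * g w) {0..1}"
    by (simp only: has_contour_integral)
  define \<zeta> where "\<zeta> = (\<lambda>t::real. z0 + R * exp (2 * pi * \<i> * t))"
  have contc: "continuous_on {0..1} (\<lambda>t. norm (g (\<zeta> t)))"
    unfolding \<zeta>_def
    by (intro continuous_intros continuous_on_compose2[OF cont]) (use R in \<open>auto simp: dist_norm norm_mult\<close>)
  have "norm (2 * pi * \<i> * g w) \<le> integral {0..1} (\<lambda>t. 4 * pi * norm (g (\<zeta> t)))"
    unfolding integral_unique[OF I, symmetric]
  proof (rule integral_norm_bound_integral[OF has_integral_integrable[OF I]])
    show "(\<lambda>t. 4 * pi * norm (g (\<zeta> t))) integrable_on {0..1}"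
      using contc by (intro integrable_continuous_interval continuous_on_mult continuous_on_const)
    fix t :: real assume "t \<in> {0..1}"
    have c: "circlepath z0 R t = \<zeta> t" by (simp add: circlepath \<zeta>_def)
    have v: "vector_derivative (circlepath z0 R) (at t) = 2 * pi * \<i> * R * exp (2 * pi * \<i> * t)"
      by (simp add: vector_derivative_circlepath)
    have "R = norm (\<zeta> t - z0)" using R by (simp add: \<zeta>_def norm_mult)
    also have "\<dots> \<le> norm (\<zeta> t - w) + norm (w - z0)" by (metis diff_add_cancel add_diff_eq norm_triangle_ineq)
    finally have d: "R / 2 \<le> norm (\<zeta> t - w)" using wb by linarith
    have "norm (g (circlepath z0 R t) / (circlepath z0 R t - w) * vector_derivative (circlepath z0 R) (at t))
      = norm (g (\<zeta> t)) * (2 * pi * R / norm (\<zeta> t - w))"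
      using R by (simp add: c v norm_mult norm_divide field_simps)
    also have "\<dots> \<le> norm (g (\<zeta> t)) * (4 * pi)"
    proof (intro mult_left_mono)
      have pos: "norm (\<zeta> t - w) > 0" using d R by linarith
      have "pi * R \<le> pi * (2 * norm (\<zeta> t - w))" using d by (intro mult_left_mono) auto
      then show "2 * pi * R / norm (\<zeta> t - w) \<le> 4 * pi" using pos by (simp add: field_simps)
    qed auto
    finally show "norm (g (circlepath z0 R t) / (circlepath z0 R t - w) * vector_derivative (circlepath z0 R) (at t))
      \<le> 4 * pi * norm (g (\<zeta> t))" by (simp add: mult_ac)
  qed
  also have "\<dots> = 4 * pi * integral {0..1} (\<lambda>t. norm (g (\<zeta> t)))" by simp
  finally show ?thesis by (simp add: norm_mult \<zeta>_def)
qed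

lemma continuous_on_norm_powr:
  fixes g :: "'c::topological_space \<Rightarrow> 'b::real_normed_vector"
  assumes "continuous_on A g" "p > 0"
  shows "continuous_on A (\<lambda>t. norm (g t) powr p)"
  by (intro continuous_on_powr' continuous_intros assms) (use assms in auto)

text \<open>From \<open>t \<le> \<eta> + \<eta> powr (1 - p) * t powr p\<close> for
  \<open>t \<ge> 0\<close>. The free \<open>\<eta>\<close> does the work of Hoelder's inequality: if
  the integral is below \<open>\<eta> powr p\<close>, the bound is
  \<open>4 * \<eta>\<close>.\<close>

lemma norm_le_circle_integral_powr:
  fixes g :: "complex \<Rightarrow> complex"
  assumes cont: "continuous_on (cball z0 R) g" and hol: "g holomorphic_on ball z0 R" and R: "R > 0"
    and w: "w \<in> cball z0 (R / 2)" and p: "1 < p" and \<eta>: "\<eta> > 0"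
  shows "norm (g w) \<le> 2 * (\<eta> + \<eta> powr (1 - p) *
    integral {0..1} (\<lambda>t::real. norm (g (z0 + R * exp (2 * pi * \<i> * t))) powr p))"
proof -
  define \<zeta> where "\<zeta> = (\<lambda>t::real. z0 + R * exp (2 * pi * \<i> * t))"
  have contc: "continuous_on {0..1} (\<lambda>t. norm (g (\<zeta> t)))"
    unfolding \<zeta>_def
    by (intro continuous_intros continuous_on_compose2[OF cont]) (use R in \<open>auto simp: dist_norm norm_mult\<close>)
  have contg: "continuous_on {0..1} (\<lambda>t. g (\<zeta> t))"
    unfolding \<zeta>_def
    by (intro continuous_intros continuous_on_compose2[OF cont]) (use R in \<open>auto simp: dist_norm norm_mult\<close>)
  have contp: "continuous_on {0..1} (\<lambda>t. norm (g (\<zeta> t)) powr p)"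
    using continuous_on_norm_powr[OF contg] p by simp
  have "x \<le> \<eta> + \<eta> powr (1 - p) * x powr p" if "x \<ge> 0" for x
  proof (cases "x \<le> \<eta>")
    case True
    have "0 \<le> \<eta> powr (1 - p) * x powr p" by simp
    with True show ?thesis by linarith
  next
    case False
    then have x: "x > 0" using \<eta> by simp
    have "x = x powr (1 - p) * x powr p" using x by (simp flip: powr_add)
    also have "\<dots> \<le> \<eta> powr (1 - p) * x powr p"
      using False \<eta> p by (intro mult_right_mono powr_mono2') auto
    finally show ?thesis using \<eta> by linarith
  qed
  then have "integral {0..1} (\<lambda>t. norm (g (\<zeta> t))) \<le>
      integral {0..1} (\<lambda>t. \<eta> + \<eta> powr (1 - p) * norm (g (\<zeta> t)) powr p)"
    using contc contp by (intro integral_le integrable_continuous_interval continuous_on_add continuous_on_mult continuous_on_const) auto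
  also have "\<dots> = \<eta> + \<eta> powr (1 - p) * integral {0..1} (\<lambda>t. norm (g (\<zeta> t)) powr p)"
    using contp by (subst integral_add) (auto intro!: integrable_continuous_interval continuous_on_mult continuous_on_const)
  finally show ?thesis
    using norm_le_circle_integral[OF cont hol R w] by (simp add: \<zeta>_def)
qed

section \<open>The Laplace method for Fourier coefficients\<close>

lemma gaussian_integral:
  fixes a :: real
  assumes a: "a > 0"
  shows "integrable lborel (\<lambda>x. exp (- a * x\<^sup>2))" "(LINT x|lborel. exp (- a * x\<^sup>2)) = sqrt (pi / a)"
proof -
  define \<sigma> where "\<sigma> = sqrt (1 / (2 * a))"
  have \<sigma>: "\<sigma> > 0" "\<sigma>\<^sup>2 = 1 / (2 * a)" using a by (auto simp: \<sigma>_def)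
  have e: "exp (- a * x\<^sup>2) = sqrt (pi / a) * normal_density 0 \<sigma> x" for x
    using a by (simp add: normal_density_def \<sigma> real_sqrt_divide)
  show "integrable lborel (\<lambda>x. exp (- a * x\<^sup>2))" unfolding e using \<sigma> by simp
  show "(LINT x|lborel. exp (- a * x\<^sup>2)) = sqrt (pi / a)" unfolding e using \<sigma> by simp
qed

text \<open>The characteristic function of the standard normal law at \<open>- t / sqrt a\<close>,
  after the substitution that scales the variable by \<open>sqrt a\<close>.\<close>

lemma gaussian_fourier_integral:
  fixes a t :: real
  assumes a: "a > 0"
  shows "(LINT x|lborel. complex_of_real (exp (- a * x\<^sup>2 / 2)) * exp (- \<i> * (x * t)))
    = complex_of_real (sqrt (2 * pi / a) * exp (- t\<^sup>2 / (2 * a)))"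
proof -
  define s where "s = t / sqrt a"
  have "complex_of_real (exp (- s\<^sup>2 / 2)) = char std_normal_distribution (- s)"
    by (simp add: char_std_normal_distribution)
  also have "\<dots> = (LINT x|lborel. std_normal_density x *\<^sub>R iexp (- s * x))"
    unfolding char_def by (subst integral_density) auto
  also have "\<dots> = sqrt a *\<^sub>R (LINT x|lborel. std_normal_density (0 + sqrt a * x) *\<^sub>R iexp (- s * (0 + sqrt a * x)))"
    using a by (subst lborel_integral_real_affine[where c = "sqrt a" and t = 0]) auto
  also have "\<dots> = sqrt a *\<^sub>R (LINT x|lborel. complex_of_real (1 / sqrt (2 * pi)) *
      (complex_of_real (exp (- a * x\<^sup>2 / 2)) * exp (- \<i> * (x * t))))"
    using a by (intro arg_cong[where f = "\<lambda>x. sqrt a *\<^sub>R x"] Bochner_Integration.integral_cong refl)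
      (simp add: normal_density_def scaleR_conv_of_real s_def power_mult_distrib mult_ac)
  also have "\<dots> = complex_of_real (sqrt (a / (2 * pi))) *
     (LINT x|lborel. (complex_of_real (exp (- a * x\<^sup>2 / 2)) * exp (- \<i> * (x * t))))"
    by (subst integral_mult_right_zero) (simp add: scaleR_conv_of_real real_sqrt_divide)
  finally have 1: "complex_of_real (exp (- s\<^sup>2 / 2)) = complex_of_real (sqrt (a / (2 * pi))) *
     (LINT x|lborel. (complex_of_real (exp (- a * x\<^sup>2 / 2)) * exp (- \<i> * (x * t))))" .
  have "complex_of_real (sqrt (2 * pi / a)) * complex_of_real (exp (- s\<^sup>2 / 2)) =
     complex_of_real (sqrt (2 * pi / a) * sqrt (a / (2 * pi))) *
     (LINT x|lborel. (complex_of_real (exp (- a * x\<^sup>2 / 2)) * exp (- \<i> * (x * t))))"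
    unfolding 1 by simp
  moreover have "sqrt (2 * pi / a) * sqrt (a / (2 * pi)) = 1"
    using a by (simp flip: real_sqrt_mult)
  moreover have "s\<^sup>2 / 2 = t\<^sup>2 / (2 * a)" using a by (simp add: s_def power_divide)
  ultimately show ?thesis by simp
qed

text \<open>The Taylor coefficient 1/2 is lowered to 1/4 to absorb the cubic remainder, which is at
  most a sixth of the square on this range.\<close>

lemma cos_le_quadratic:
  fixes x :: real
  assumes "\<bar>x\<bar> \<le> 1"
  shows "cos x \<le> 1 - x\<^sup>2 / 4"
proof -
  have "\<bar>Re (iexp x - (\<Sum>k\<le>2. (\<i> * x)^k / fact k))\<bar> \<le> \<bar>x\<bar>^3 / 6"
    using iexp_approx1[of x 2] order_trans[OF abs_Re_le_cmod] by (fastforce simp: numeral_eq_Suc)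
  then have "\<bar>cos x - (1 - x\<^sup>2 / 2)\<bar> \<le> \<bar>x\<bar>^3 / 6"
    by (simp add: numeral_2_eq_2 cis_conv_exp[symmetric] power2_eq_square algebra_simps)
  moreover have "\<bar>x\<bar>^3 \<le> \<bar>x\<bar>^2" using assms by (intro power_decreasing) auto
  moreover have "0 \<le> x\<^sup>2" by simp
  ultimately show ?thesis unfolding power2_abs by linarith
qed

lemma norm_exp_diff_le:
  fixes A B :: complex
  assumes "Re A \<le> m" "Re B \<le> m"
  shows "norm (exp A - exp B) \<le> exp m * norm (A - B)"
proof (rule field_differentiable_bound[of "{z. Re z \<le> m}" exp exp])
  show "convex {z. Re z \<le> m}" by (rule convex_halfspace_Re_le)
  show "\<And>z. z \<in> {z. Re z \<le> m} \<Longrightarrow> (exp has_field_derivative exp z) (at z within {z. Re z \<le> m})"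
    by (rule DERIV_subset[OF DERIV_exp]) auto
qed (use assms in auto)

text \<open>The first exponential is the characteristic function of a centred Poisson variable of
  mean \<open>l\<close>, the second one that of a normal variable of the same variance. The
  exponents differ by the cubic Taylor remainder, and both have real part at most
  \<open>- l * \<theta>\<^sup>2 / 4\<close>.\<close>

lemma poisson_gaussian_kernel_diff:
  fixes l \<theta> \<delta> :: real
  assumes l: "l > 0" and \<theta>: "\<bar>\<theta>\<bar> \<le> \<delta>" and \<delta>: "\<delta> \<le> 1"
  shows "norm (exp (l * (exp (\<i> * \<theta>) - 1 - \<i> * \<theta>)) - exp (- complex_of_real (l * \<theta>\<^sup>2 / 2))) \<le>
    8 * \<delta> * exp (- l * \<theta>\<^sup>2 / 8)"
    and "norm (exp (l * (exp (\<i> * \<theta>) - 1 - \<i> * \<theta>))) \<le> exp (- l * \<theta>\<^sup>2 / 4)"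
proof -
  define A where "A = l * (exp (\<i> * \<theta>) - 1 - \<i> * \<theta>)"
  define B where "B = - complex_of_real (l * \<theta>\<^sup>2 / 2)"
  have "Re A = l * (cos \<theta> - 1)" by (simp add: A_def cis_conv_exp[symmetric])
  also have "\<dots> \<le> l * (- \<theta>\<^sup>2 / 4)"
    using cos_le_quadratic[of \<theta>] assms by (intro mult_left_mono) auto
  finally have A: "Re A \<le> - l * \<theta>\<^sup>2 / 4" by simp
  then show "norm (exp (l * (exp (\<i> * \<theta>) - 1 - \<i> * \<theta>))) \<le> exp (- l * \<theta>\<^sup>2 / 4)"
    by (simp add: A_def[symmetric])
  have B: "Re B \<le> - l * \<theta>\<^sup>2 / 4" using l by (simp add: B_def)
  have "norm (A - B) = norm (l * (exp (\<i> * \<theta>) - (\<Sum>k\<le>2. (\<i> * \<theta>)^k / fact k)))"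
    by (rule arg_cong[where f = norm]) (simp add: A_def B_def numeral_2_eq_2 power2_eq_square algebra_simps)
  also have "\<dots> \<le> l * (\<bar>\<theta>\<bar>^3 / 6)"
    unfolding norm_mult using iexp_approx1[of \<theta> 2] l by (simp add: numeral_eq_Suc)
  also have "\<dots> \<le> l * (\<delta> * \<theta>\<^sup>2)"
  proof (intro mult_left_mono)
    have "\<bar>\<theta>\<bar>^3 = \<bar>\<theta>\<bar> * \<theta>\<^sup>2" by (simp add: power3_eq_cube power2_eq_square)
    also have "\<dots> \<le> \<delta> * \<theta>\<^sup>2" using \<theta> by (intro mult_right_mono) auto
    finally show "\<bar>\<theta>\<bar>^3 / 6 \<le> \<delta> * \<theta>\<^sup>2" using zero_le_power[of "\<bar>\<theta>\<bar>" 3] by linarith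
  qed (use l in auto)
  finally have AB: "norm (A - B) \<le> l * (\<delta> * \<theta>\<^sup>2)" .
  \<comment> \<open>The decay available is \<open>exp (- 2 * y)\<close> and the difference of the
    exponents is at most \<open>8 * \<delta> * y\<close>. Half of the decay is spent on absorbing
    the factor \<open>y\<close>.\<close>
  define y where "y = l * \<theta>\<^sup>2 / 8"
  have y: "y * exp (-y) \<le> 1"
  proof -
    have "y \<le> exp y" using exp_ge_add_one_self[of y] by linarith
    then show ?thesis by (simp add: exp_minus divide_simps)
  qed
  have "norm (exp A - exp B) \<le> exp (- l * \<theta>\<^sup>2 / 4) * (l * (\<delta> * \<theta>\<^sup>2))"
    using norm_exp_diff_le[OF A B] AB by (smt (verit) exp_ge_zero mult_left_mono)
  also have "\<dots> = 8 * \<delta> * (y * exp (-y)) * exp (- y)"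
    by (simp add: y_def flip: exp_add)
  also have "\<dots> \<le> 8 * \<delta> * 1 * exp (- y)"
    using \<theta> by (intro mult_right_mono mult_left_mono y) auto
  finally show "norm (exp (l * (exp (\<i> * \<theta>) - 1 - \<i> * \<theta>)) - exp (- complex_of_real (l * \<theta>\<^sup>2 / 2))) \<le>
    8 * \<delta> * exp (- l * \<theta>\<^sup>2 / 8)" by (simp add: A_def B_def y_def)
qed

text \<open>Near the real axis \<open>F n z\<close> is close to
  \<open>W z * exp (exp z * h n)\<close>. With \<open>l = exp x * h n\<close>, the product of this
  exponential with the Fourier factor is \<open>exp l\<close> times a centred Poisson kernel,
  shifted by \<open>k - l\<close>, which is replaced by a Gaussian one. Away from the axis,
  \<open>off\<close> makes the integrand exponentially small against \<open>exp l\<close>.\<close>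

lemma fourier_laplace_approximation:
  fixes h :: "nat \<Rightarrow> real" and F :: "nat \<Rightarrow> complex \<Rightarrow> complex" and W :: "complex \<Rightarrow> complex"
    and K :: "real set" and \<delta>0 :: real
  assumes h: "filterlim h at_top sequentially" and K: "compact K" "K \<noteq> {}"
    and cont: "\<And>n. continuous_on UNIV (F n)"
    and \<delta>0: "\<delta>0 > 0"
    and Wcont: "continuous_on {z. Re z \<in> K \<and> \<bar>Im z\<bar> \<le> \<delta>0} W"
    and unif: "uniform_limit {z. Re z \<in> K \<and> \<bar>Im z\<bar> \<le> \<delta>0} (\<lambda>n z. F n z * exp (- exp z * h n)) W sequentially"
    and off: "\<And>\<delta>. \<delta> > 0 \<Longrightarrow> \<exists>C \<eta>. \<eta> > 0 \<and> (\<forall>\<^sub>F n in sequentially. \<forall>x\<in>K. \<forall>\<theta>. \<delta> \<le> \<bar>\<theta>\<bar> \<and> \<bar>\<theta>\<bar> \<le> pi \<longrightarrow>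
        norm (F n (Complex x \<theta>)) \<le> C * exp ((exp x - \<eta>) * h n))"
    and \<epsilon>: "\<epsilon> > 0"
  shows "\<forall>\<^sub>F n in sequentially. \<forall>x\<in>K. \<forall>k::nat.
    norm (complex_of_real (sqrt (h n) * exp (- exp x * h n)) *
        (LINT \<theta>|lborel. indicator {-pi..pi} \<theta> *\<^sub>R (F n (Complex x \<theta>) * exp (- \<i> * (\<theta> * k))))
      - W x * complex_of_real (sqrt (2 * pi / exp x) * exp (- (k - exp x * h n)\<^sup>2 / (2 * exp x * h n)))) \<le> \<epsilon>"
proof -
  define D where "D = {z. Re z \<in> K \<and> \<bar>Im z\<bar> \<le> \<delta>0}"
  have Dim: "D = (\<lambda>(x, y). Complex x y) ` (K \<times> {-\<delta>0..\<delta>0})"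
    unfolding D_def by (force simp: image_def intro: complex_eqI)
  have compD: "compact D" unfolding Dim case_prod_beta Complex_eq
    by (intro compact_continuous_image continuous_intros compact_Times K) auto
  have contD: "continuous_on D W" using Wcont by (simp add: D_def)
  have inD: "complex_of_real x \<in> D" "Complex x \<theta> \<in> D" if "x \<in> K" "\<bar>\<theta>\<bar> \<le> \<delta>0" for x \<theta>
    using that \<delta>0 by (auto simp: D_def)
  obtain B where B: "B > 0" "\<And>z. z \<in> D \<Longrightarrow> norm (W z) \<le> B"
    using compact_imp_bounded[OF compact_continuous_image[OF contD compD]]
    unfolding bounded_pos by (auto simp: )
  obtain x0 where x0: "x0 \<in> K" "\<And>x. x \<in> K \<Longrightarrow> x0 \<le> x"
    using compact_attains_inf[OF K] by blast
  define a where "a = exp x0"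
  have a: "a > 0" "\<And>x. x \<in> K \<Longrightarrow> a \<le> exp x" using x0 by (auto simp: a_def)
  \<comment> \<open>\<open>sqrt (8 * pi / l)\<close> is the integral of
    \<open>exp (- (l / 8) * \<theta>\<^sup>2)\<close>, and \<open>l \<ge> a * h n\<close>, so after
    scaling by \<open>sqrt (h n)\<close> it is at most \<open>c1\<close>. The choice of
    \<open>e\<close> makes the central part contribute \<open>\<epsilon> / 3\<close>.\<close>
  define c1 where "c1 = sqrt (8 * pi / a)"
  have c1: "c1 > 0" using a by (simp add: c1_def)
  define e where "e = \<epsilon> / (3 * c1 * (2 + 8 * B))"
  have e: "e > 0" using \<epsilon> c1 B by (simp add: e_def)
  have "uniformly_continuous_on D W" by (rule compact_uniformly_continuous[OF contD compD])
  then obtain \<delta>1 where \<delta>1: "\<delta>1 > 0" "\<And>z w. z \<in> D \<Longrightarrow> w \<in> D \<Longrightarrow> dist w z < \<delta>1 \<Longrightarrow> dist (W w) (W z) < e"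
    unfolding uniformly_continuous_on_def using e by metis
  define \<delta> where "\<delta> = min (min \<delta>0 1) (min e (\<delta>1 / 2))"
  have \<delta>: "\<delta> > 0" "\<delta> \<le> \<delta>0" "\<delta> \<le> 1" "\<delta> \<le> e" "\<delta> < \<delta>1" using \<delta>0 \<delta>1 e by (auto simp: \<delta>_def min_def)
  obtain C \<eta> where \<eta>: "\<eta> > 0" and offC: "\<forall>\<^sub>F n in sequentially. \<forall>x\<in>K. \<forall>\<theta>. \<delta> \<le> \<bar>\<theta>\<bar> \<and> \<bar>\<theta>\<bar> \<le> pi \<longrightarrow>
        norm (F n (Complex x \<theta>)) \<le> C * exp ((exp x - \<eta>) * h n)"
    using off[OF \<delta>(1)] by blast
  have ev1: "\<forall>\<^sub>F n in sequentially. \<forall>z\<in>D. dist (F n z * exp (- exp z * h n)) (W z) < e"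
    using unif e by (simp add: D_def uniform_limit_iff)
  have ev2: "\<forall>\<^sub>F n in sequentially. h n > 0"
    using h by (simp add: filterlim_at_top_dense)
  \<comment> \<open>The other two thirds of \<open>\<epsilon>\<close>: the mass of the limiting
    Gaussian outside \<open>\<delta>\<close>, and the part of the integrand away from the
    axis.\<close>
  have "((\<lambda>y. B * exp (- a * \<delta>\<^sup>2 / 4 * y) * c1) \<longlongrightarrow> 0) at_top" using a \<delta> by real_asymp
  from filterlim_compose[OF this h] have ev3: "\<forall>\<^sub>F n in sequentially. B * exp (- a * \<delta>\<^sup>2 / 4 * h n) * c1 < \<epsilon> / 3"
    by (rule order_tendstoD) (use \<epsilon> in auto)
  have "((\<lambda>y. sqrt y * (\<bar>C\<bar> * exp (- \<eta> * y) * (2 * pi))) \<longlongrightarrow> 0) at_top" using \<eta> by real_asymp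
  from filterlim_compose[OF this h] have ev4: "\<forall>\<^sub>F n in sequentially. sqrt (h n) * (\<bar>C\<bar> * exp (- \<eta> * h n) * (2 * pi)) < \<epsilon> / 3"
    by (rule order_tendstoD) (use \<epsilon> in auto)
  show ?thesis
    using offC ev1 ev2 ev3 ev4
  proof eventually_elim
    case (elim n)
    show ?case
    proof (intro ballI allI)
      fix x k assume x: "x \<in> K"
      define l where "l = exp x * h n"
      have l: "l > 0" "a * h n \<le> l" using elim(3) a(2)[OF x] by (auto simp: l_def)
      define G1 where "G1 = (\<lambda>\<theta>. indicator {-pi..pi} \<theta> *\<^sub>R (F n (Complex x \<theta>) * exp (- \<i> * (\<theta> * real k))))"
      define G2 where "G2 = (\<lambda>\<theta>. complex_of_real (exp (- l * \<theta>\<^sup>2 / 2)) * exp (- \<i> * (\<theta> * (real k - l))))"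
      define G where "G = (\<lambda>\<theta>. exp (- complex_of_real l) * G1 \<theta> - W x * G2 \<theta>)"
      \<comment> \<open>One integrable majorant for all \<open>\<theta>\<close>. Near 0,
        \<open>2 * e\<close> comes from replacing the normalised \<open>F n\<close> by
        \<open>W x\<close> and \<open>8 * B * e\<close> from replacing the Poisson kernel; the other
        two terms take over outside \<open>\<delta>\<close>.\<close>
      define U where "U = (\<lambda>\<theta>. ((2 + 8 * B) * e + B * exp (- l * \<delta>\<^sup>2 / 4)) * exp (- (l / 8) * \<theta>\<^sup>2)
           + \<bar>C\<bar> * exp (- \<eta> * h n) * indicator {-pi..pi} \<theta>)"
      have contF: "continuous_on {-pi..pi} (\<lambda>\<theta>. F n (Complex x \<theta>) * exp (- \<i> * (\<theta> * real k)))"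
        unfolding Complex_eq by (intro continuous_intros continuous_on_compose2[OF cont]) auto
      have int1: "integrable lborel G1"
        using borel_integrable_compact[OF _ contF] unfolding G1_def set_integrable_def by auto
      have int2: "integrable lborel G2"
      proof (rule Bochner_Integration.integrable_bound)
        show "integrable lborel (\<lambda>\<theta>. exp (- (l / 2) * \<theta>\<^sup>2))" using l by (intro gaussian_integral) auto
        show "G2 \<in> borel_measurable lborel" unfolding G2_def by measurable
        show "AE \<theta> in lborel. norm (G2 \<theta>) \<le> norm (exp (- (l / 2) * \<theta>\<^sup>2))"
          by (simp add: G2_def norm_mult)
      qed
      have int: "integrable lborel G" using int1 int2 unfolding G_def by auto
      have intU: "integrable lborel U"
        unfolding U_def using l gaussian_integral(1)[of "l / 8"] by auto
      have Kx: "norm (W x) \<le> B" using B(2) inD(1)[OF x, of 0] \<delta>0 by auto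
      have GU: "norm (G \<theta>) \<le> U \<theta>" for \<theta>
      proof -
        have base: "0 \<le> (2 + 8 * B) * e * exp (- (l / 8) * \<theta>\<^sup>2)" "0 \<le> B * exp (- l * \<delta>\<^sup>2 / 4) * exp (- (l / 8) * \<theta>\<^sup>2)"
          "0 \<le> \<bar>C\<bar> * exp (- \<eta> * h n) * indicat_real {-pi..pi} \<theta>" using B e by auto
        have Ueq: "U \<theta> = (2 + 8 * B) * e * exp (- (l / 8) * \<theta>\<^sup>2) + B * exp (- l * \<delta>\<^sup>2 / 4) * exp (- (l / 8) * \<theta>\<^sup>2)
           + \<bar>C\<bar> * exp (- \<eta> * h n) * indicat_real {-pi..pi} \<theta>"
          by (simp add: U_def algebra_simps)
        have normG2: "norm (G2 \<theta>) = exp (- l * \<theta>\<^sup>2 / 2)" by (simp add: G2_def norm_mult)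
        have tail: "norm (W x * G2 \<theta>) \<le> B * exp (- l * \<delta>\<^sup>2 / 4) * exp (- (l / 8) * \<theta>\<^sup>2)" if "\<delta> \<le> \<bar>\<theta>\<bar>"
        proof -
          have "\<delta>\<^sup>2 \<le> \<theta>\<^sup>2" using that \<delta> by (metis abs_le_square_iff abs_of_pos)
          then have "l * \<delta>\<^sup>2 \<le> l * \<theta>\<^sup>2" using l by (intro mult_left_mono) auto
          moreover have "0 \<le> l * \<theta>\<^sup>2" using l by simp
          ultimately have "- l * \<theta>\<^sup>2 / 2 \<le> - l * \<delta>\<^sup>2 / 4 + - (l / 8) * \<theta>\<^sup>2" by (simp add: field_simps)
          then have "exp (- l * \<theta>\<^sup>2 / 2) \<le> exp (- l * \<delta>\<^sup>2 / 4) * exp (- (l / 8) * \<theta>\<^sup>2)"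
            unfolding exp_add[symmetric] by simp
          then show ?thesis using Kx B(1) unfolding norm_mult normG2 mult.assoc
            by (intro mult_mono) auto
        qed
        consider "\<bar>\<theta>\<bar> \<le> \<delta>" | "\<delta> < \<bar>\<theta>\<bar>" "\<bar>\<theta>\<bar> \<le> pi" | "\<bar>\<theta>\<bar> > pi" "\<delta> < \<bar>\<theta>\<bar>"
          using \<delta> pi_gt3 by linarith
        then show ?thesis
        proof cases
          case 1
          have pi: "\<theta> \<in> {-pi..pi}" using 1 \<delta> pi_gt3 by auto
          \<comment> \<open>The integrand splits into the normalised \<open>F n\<close>, the Poisson
            kernel \<open>P\<close> and the oscillation \<open>N\<close> of norm 1. All of
            \<open>k\<close> sits in \<open>N\<close>, so the estimate is uniform in
            \<open>k\<close>.\<close>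
          define V where "V = F n (Complex x \<theta>) * exp (- exp (Complex x \<theta>) * h n)"
          define P where "P = exp (l * (exp (\<i> * \<theta>) - 1 - \<i> * \<theta>))"
          define N where "N = exp (- \<i> * (\<theta> * (real k - l)))"
          have zD: "Complex x \<theta> \<in> D" using inD(2)[OF x] 1 \<delta> by auto
          have V: "norm (V - W x) \<le> 2 * e"
          proof -
            have "dist V (W (Complex x \<theta>)) < e" using elim(2) zD by (auto simp: V_def)
            moreover have "dist (Complex x \<theta>) (complex_of_real x) < \<delta>1"
              using 1 \<delta> by (simp add: dist_norm cmod_def)
            then have "dist (W (Complex x \<theta>)) (W x) < e"
              using \<delta>1(2) zD inD(1)[OF x, of 0] \<delta>0 by auto
            ultimately show ?thesis using dist_triangle[of V "W x" "W (Complex x \<theta>)"] by (simp add: dist_norm)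
          qed
          have "exp (- complex_of_real l) * G1 \<theta> = V * P * N"
          proof -
            have "exp (Complex x \<theta>) = exp x * exp (\<i> * \<theta>)"
              by (simp add: Complex_eq exp_add exp_of_real)
            then have "exp (- exp (Complex x \<theta>) * h n) * P * N = exp (- complex_of_real l) * exp (- \<i> * (\<theta> * real k))"
              unfolding P_def N_def exp_add[symmetric]
              by (intro arg_cong[where f = exp]) (simp add: l_def algebra_simps)
            then show ?thesis using pi by (simp add: G1_def V_def mult_ac)
          qed
          moreover have "G2 \<theta> = exp (- complex_of_real (l * \<theta>\<^sup>2 / 2)) * N"
            by (simp add: G2_def N_def exp_of_real[symmetric])
          ultimately have "G \<theta> = ((V - W x) * P + W x * (P - exp (- complex_of_real (l * \<theta>\<^sup>2 / 2)))) * N"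
            by (simp add: G_def algebra_simps)
          moreover have "norm N = 1" by (simp add: N_def)
          ultimately have "norm (G \<theta>) = norm ((V - W x) * P + W x * (P - exp (- complex_of_real (l * \<theta>\<^sup>2 / 2))))"
            by (simp add: norm_mult)
          also have "\<dots> \<le> norm (V - W x) * norm P + norm (W x) * norm (P - exp (- complex_of_real (l * \<theta>\<^sup>2 / 2)))"
            by (metis norm_triangle_ineq norm_mult)
          also have "\<dots> \<le> 2 * e * exp (- l * \<theta>\<^sup>2 / 4) + B * (8 * \<delta> * exp (- l * \<theta>\<^sup>2 / 8))"
            unfolding P_def using poisson_gaussian_kernel_diff[OF l(1) 1 \<delta>(3)] V Kx e B(1)
            by (intro add_mono mult_mono) auto
          also have "\<dots> \<le> 2 * e * exp (- l * \<theta>\<^sup>2 / 8) + B * (8 * e * exp (- l * \<theta>\<^sup>2 / 8))"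
            using e B(1) \<delta> l by (intro add_mono mult_left_mono mult_right_mono) auto
          also have "\<dots> = (2 + 8 * B) * e * exp (- (l / 8) * \<theta>\<^sup>2)" by (simp add: algebra_simps)
          finally show ?thesis unfolding Ueq using base by linarith
        next
          case 2
          have "norm (exp (- complex_of_real l) * G1 \<theta>) = exp (- l) * norm (F n (Complex x \<theta>))"
            using 2 by (auto simp: G1_def norm_mult indicator_def abs_le_iff)
          also have "\<dots> \<le> exp (- l) * (C * exp ((exp x - \<eta>) * h n))"
            using elim(1) x 2 by (intro mult_left_mono) auto
          also have "\<dots> = C * (exp (- l) * exp ((exp x - \<eta>) * h n))" by simp
          also have "exp (- l) * exp ((exp x - \<eta>) * h n) = exp (- \<eta> * h n)"
            by (simp add: l_def algebra_simps flip: exp_add)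
          also have "C * exp (- \<eta> * h n) \<le> \<bar>C\<bar> * exp (- \<eta> * h n) * indicat_real {-pi..pi} \<theta>"
          proof -
            have "indicat_real {-pi..pi} \<theta> = 1" using 2 by (auto simp: indicator_def abs_le_iff)
            then show ?thesis by (simp add: mult_right_mono)
          qed
          finally show ?thesis unfolding Ueq G_def using base tail 2
              norm_triangle_ineq4[of "exp (- complex_of_real l) * G1 \<theta>" "W x * G2 \<theta>"] by linarith
        next
          case 3
          then have "G1 \<theta> = 0" by (auto simp: G1_def indicator_def abs_le_iff)
          then have "norm (G \<theta>) = norm (W x * G2 \<theta>)" by (simp add: G_def)
          then show ?thesis unfolding Ueq using base tail 3 by linarith
        qed
      qed
      have "LINT \<theta>|lborel. U \<theta> = ((2 + 8 * B) * e + B * exp (- l * \<delta>\<^sup>2 / 4)) * sqrt (8 * pi / l)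
          + \<bar>C\<bar> * exp (- \<eta> * h n) * (2 * pi)"
        unfolding U_def using l gaussian_integral[of "l / 8"]
        by (subst Bochner_Integration.integral_add) (auto simp: field_simps)
      moreover have "norm (LINT \<theta>|lborel. G \<theta>) \<le> (LINT \<theta>|lborel. U \<theta>)"
        by (rule order_trans[OF integral_norm_bound integral_mono]) (use int intU GU in auto)
      ultimately have "norm (LINT \<theta>|lborel. G \<theta>) \<le> ((2 + 8 * B) * e + B * exp (- l * \<delta>\<^sup>2 / 4)) * sqrt (8 * pi / l)
          + \<bar>C\<bar> * exp (- \<eta> * h n) * (2 * pi)" by simp
      then have "sqrt (h n) * norm (LINT \<theta>|lborel. G \<theta>) \<le> sqrt (h n) * (((2 + 8 * B) * e + B * exp (- l * \<delta>\<^sup>2 / 4)) * sqrt (8 * pi / l)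
          + \<bar>C\<bar> * exp (- \<eta> * h n) * (2 * pi))"
        using elim(3) by (intro mult_left_mono) auto
      also have "\<dots> = ((2 + 8 * B) * e + B * exp (- l * \<delta>\<^sup>2 / 4)) * (sqrt (h n) * sqrt (8 * pi / l))
          + sqrt (h n) * (\<bar>C\<bar> * exp (- \<eta> * h n) * (2 * pi))" by (simp add: algebra_simps)
      also have "\<dots> \<le> ((2 + 8 * B) * e + B * exp (- a * \<delta>\<^sup>2 / 4 * h n)) * c1
          + sqrt (h n) * (\<bar>C\<bar> * exp (- \<eta> * h n) * (2 * pi))"
      proof (intro add_right_mono mult_mono add_left_mono mult_left_mono)
        show "exp (- l * \<delta>\<^sup>2 / 4) \<le> exp (- a * \<delta>\<^sup>2 / 4 * h n)"
          using mult_right_mono[OF l(2), of "\<delta>\<^sup>2"] by (simp add: mult_ac)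
        have "sqrt (h n) * sqrt (8 * pi / l) = sqrt (h n * (8 * pi / l))" by (simp only: real_sqrt_mult)
        also have "\<dots> \<le> c1" unfolding c1_def real_sqrt_le_iff using l a elim(3)
          by (simp add: field_simps mult_left_mono)
        finally show "sqrt (h n) * sqrt (8 * pi / l) \<le> c1" .
      qed (use B e elim(3) l in auto)
      also have "\<dots> = \<epsilon> / 3 + B * exp (- a * \<delta>\<^sup>2 / 4 * h n) * c1 + sqrt (h n) * (\<bar>C\<bar> * exp (- \<eta> * h n) * (2 * pi))"
      proof -
        have "3 * c1 * (2 + 8 * B) > 0" using c1 B(1) by simp
        then have "e * (3 * c1 * (2 + 8 * B)) = \<epsilon>" unfolding e_def by (metis nonzero_eq_divide_eq less_irrefl)
        then have "(2 + 8 * B) * e * c1 = \<epsilon> / 3" by (simp add: algebra_simps)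
        then show ?thesis by (simp only: distrib_right)
      qed
      also have "\<dots> \<le> \<epsilon>" using elim(4,5) by linarith
      finally have fin: "sqrt (h n) * norm (LINT \<theta>|lborel. G \<theta>) \<le> \<epsilon>" .
      have "(LINT \<theta>|lborel. G \<theta>) = exp (- complex_of_real l) * (LINT \<theta>|lborel. G1 \<theta>) - W x * (LINT \<theta>|lborel. G2 \<theta>)"
        unfolding G_def using int1 int2 by simp
      also have "(LINT \<theta>|lborel. G2 \<theta>) = complex_of_real (sqrt (2 * pi / l) * exp (- (real k - l)\<^sup>2 / (2 * l)))"
        unfolding G2_def by (rule gaussian_fourier_integral[OF l(1)])
      finally have eq: "(LINT \<theta>|lborel. G \<theta>) = exp (- complex_of_real l) * (LINT \<theta>|lborel. G1 \<theta>)
          - W x * complex_of_real (sqrt (2 * pi / l) * exp (- (real k - l)\<^sup>2 / (2 * l)))" .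
      have E: "exp (- complex_of_real l) = complex_of_real (exp (- l))" by (metis exp_of_real of_real_minus)
      have "complex_of_real (sqrt (h n)) * (LINT \<theta>|lborel. G \<theta>) =
          complex_of_real (sqrt (h n) * exp (- l)) * (LINT \<theta>|lborel. G1 \<theta>)
          - W x * complex_of_real (sqrt (h n) * sqrt (2 * pi / l) * exp (- (real k - l)\<^sup>2 / (2 * l)))"
        unfolding eq E by (simp only: right_diff_distrib of_real_mult mult_ac)
      also have "sqrt (h n) * sqrt (2 * pi / l) = sqrt (2 * pi / exp x)"
        using elim(3) by (simp add: l_def flip: real_sqrt_mult)
      finally have "norm (complex_of_real (sqrt (h n) * exp (- l)) * (LINT \<theta>|lborel. G1 \<theta>)
          - W x * complex_of_real (sqrt (2 * pi / exp x) * exp (- (real k - l)\<^sup>2 / (2 * l)))) \<le> \<epsilon>"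
        using fin elim(3) by (metis norm_mult norm_of_real abs_of_pos real_sqrt_gt_zero)
      then show "norm (complex_of_real (sqrt (h n) * exp (- exp x * h n)) *
        (LINT \<theta>|lborel. indicator {-pi..pi} \<theta> *\<^sub>R (F n (Complex x \<theta>) * exp (- \<i> * (\<theta> * k))))
      - W x * complex_of_real (sqrt (2 * pi / exp x) * exp (- (k - exp x * h n)\<^sup>2 / (2 * exp x * h n)))) \<le> \<epsilon>"
        by (simp add: l_def G1_def mult.assoc)
    qed
  qed
qed

section \<open>Depths, adapted functionals and a maximal inequality\<close>

text \<open>A label that is 0 at the root and rises by at most 1 along an edge is a lower bound for
  the length of every walk from the root. A walk of exactly that length makes it the
  minimum.\<close>

lemma depth_eqI:
  assumes root: "e (root_vertex t) = 0"
    and step: "\<And>x y. {x, y} \<in> edges t \<Longrightarrow> e y \<le> Suc (e x)"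
    and walk: "(root_vertex t, v) \<in> adjacency t ^^ e v"
  shows "depth t v = e v"
proof -
  have "e v \<le> m" if "(root_vertex t, v) \<in> adjacency t ^^ m" for m v
    using that
  proof (induction m arbitrary: v)
    case 0
    then show ?case using root by simp
  next
    case (Suc m)
    then obtain x where "(root_vertex t, x) \<in> adjacency t ^^ m" "(x, v) \<in> adjacency t" by auto
    then show ?case using Suc.IH[of x] step[of x v] by (auto simp: adjacency_def)
  qed
  then show ?thesis unfolding depth_def using walk by (intro Least_equality) auto
qed

text \<open>The invariant of the growth. It stores the edge inequality and the walks that
  \<open>depth_eqI\<close> asks for, so that it passes to the tree with one more leaf. As
  \<open>{x, y}\<close> is unordered, the inequality bounds the depths in both directions.\<close>

definition recursive_tree :: "nat \<Rightarrow> nat rooted_tree \<Rightarrow> bool" where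
  "recursive_tree n t \<longleftrightarrow> verts t = {..n} \<and> root_vertex t = 0 \<and> depth t 0 = 0 \<and>
     (\<forall>x y. {x, y} \<in> edges t \<longrightarrow> x \<le> n \<and> y \<le> n \<and> depth t y \<le> Suc (depth t x)) \<and>
     (\<forall>v\<le>n. (0, v) \<in> adjacency t ^^ depth t v)"

lemma recursive_tree_single: "recursive_tree 0 (single_vertex_tree 0)"
proof -
  have "depth (single_vertex_tree 0) (0::nat) = 0"
    unfolding depth_def by (rule Least_equality) (auto simp: single_vertex_tree_def)
  then show ?thesis by (auto simp: recursive_tree_def single_vertex_tree_def)
qed

lemma recursive_tree_attach:
  assumes t: "recursive_tree n t" and u: "u \<le> n"
  shows "recursive_tree (Suc n) (attach t u (Suc n))"
    and "\<And>v. v \<le> n \<Longrightarrow> depth (attach t u (Suc n)) v = depth t v"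
    and "depth (attach t u (Suc n)) (Suc n) = Suc (depth t u)"
proof -
  define t' where "t' = attach t u (Suc n)"
  \<comment> \<open>The labels to which \<open>depth_eqI\<close> is applied: a new leaf opens no
    shorter way to an old vertex, so the old depths are kept.\<close>
  define e where "e = (depth t)(Suc n := Suc (depth t u))"
  have t'[simp]: "verts t' = insert (Suc n) (verts t)" "edges t' = insert {u, Suc n} (edges t)" "root_vertex t' = root_vertex t"
    by (auto simp: t'_def attach_def)
  have root[simp]: "root_vertex t = 0" and vt: "verts t = {..n}" and d0: "depth t 0 = 0" using t by (auto simp: recursive_tree_def)
  have edge: "x \<le> n \<and> y \<le> n \<and> depth t y \<le> Suc (depth t x)" if "{x, y} \<in> edges t" for x y
    using t that by (auto simp: recursive_tree_def)
  have adj: "adjacency t' = adjacency t \<union> {(u, Suc n), (Suc n, u)}"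
    by (auto simp: adjacency_def doubleton_eq_iff)
  have mono: "adjacency t ^^ m \<subseteq> adjacency t' ^^ m" for m
    unfolding adj by (induction m) auto
  have walk: "(0, v) \<in> adjacency t' ^^ e v" if "v \<le> Suc n" for v
  proof (cases "v = Suc n")
    case True
    have "(0, u) \<in> adjacency t ^^ depth t u" using t u by (simp add: recursive_tree_def)
    then have "(0, u) \<in> adjacency t' ^^ depth t u" using mono by blast
    moreover have "(u, Suc n) \<in> adjacency t'" by (simp add: adj)
    ultimately have "(0, Suc n) \<in> adjacency t' ^^ Suc (depth t u)" by (rule relpow_Suc_I)
    then show ?thesis using True by (simp add: e_def)
  next
    case False
    then have "(0, v) \<in> adjacency t ^^ e v" using t that by (simp add: recursive_tree_def e_def)
    then show ?thesis using mono by blast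
  qed
  have step: "x \<le> Suc n \<and> y \<le> Suc n \<and> e y \<le> Suc (e x)" if "{x, y} \<in> edges t'" for x y
  proof (cases "{x, y} \<in> edges t")
    case True
    then show ?thesis using edge[OF True] by (auto simp: e_def)
  next
    case False
    then have "{x, y} = {u, Suc n}" using that by auto
    then show ?thesis using u by (auto simp: doubleton_eq_iff e_def)
  qed
  have de: "depth t' v = e v" if "v \<le> Suc n" for v
    by (rule depth_eqI) (use step walk[OF that] d0 in \<open>auto simp: e_def\<close>)
  show "depth t' v = depth t v" if "v \<le> n" for v using de[of v] that by (auto simp: e_def)
  show "depth t' (Suc n) = Suc (depth t u)" using de[of "Suc n"] by (auto simp: e_def)
  have step': "x \<le> Suc n \<and> y \<le> Suc n \<and> depth t' y \<le> Suc (depth t' x)" if "{x, y} \<in> edges t'" for x y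
    using step[OF that] de[of x] de[of y] by simp
  have walk': "(0, v) \<in> adjacency t' ^^ depth t' v" if "v \<le> Suc n" for v
    using walk[OF that] de[OF that] by simp
  have "depth t' 0 = 0" using de[of 0] d0 by (simp add: e_def)
  moreover have "verts t' = {..Suc n}" by (auto simp: vt)
  ultimately show "recursive_tree (Suc n) t'"
    unfolding recursive_tree_def using step' walk' t'(3) root by (intro conjI allI impI) simp_all
qed

lemma S_Suc: "log_weight_sum f (Suc k) = log_weight_sum f k + ln (f k)"
  by (simp add: log_weight_sum_def)

section \<open>The tree process read off from the depths of its vertices\<close>

context depth_weighted_rrt
begin

text \<open>The depth on arrival. By \<open>depth_T\<close> it never changes afterwards, so the
  total weight, the level sizes and the depth of every tree are functions of this one
  sequence.\<close>

definition vdepth :: "nat \<Rightarrow> 'a \<Rightarrow> nat" where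
  "vdepth n \<omega> = depth (T n \<omega>) n"

lemma recursive_tree_T: "\<omega> \<in> space M \<Longrightarrow> recursive_tree n (T n \<omega>)"
proof (induction n)
  case 0 then show ?case by (simp add: tree_0 recursive_tree_single)
next
  case (Suc n)
  then have "X n \<omega> \<le> n" using choice_in_verts[of \<omega> n] by (auto simp: recursive_tree_def)
  then show ?case using Suc recursive_tree_attach(1)[of n "T n \<omega>" "X n \<omega>"] by (simp add: tree_Suc)
qed

lemma verts_T: "\<omega> \<in> space M \<Longrightarrow> verts (T n \<omega>) = {..n}"
  using recursive_tree_T[of \<omega> n] by (simp add: recursive_tree_def)

lemma X_le: "\<omega> \<in> space M \<Longrightarrow> X n \<omega> \<le> n"
  using choice_in_verts[of \<omega> n] verts_T[of \<omega> n] by auto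

lemma depth_T: "\<omega> \<in> space M \<Longrightarrow> v \<le> n \<Longrightarrow> depth (T n \<omega>) v = vdepth v \<omega>"
proof (induction n)
  case 0 then show ?case by (simp add: vdepth_def)
next
  case (Suc n)
  show ?case
  proof (cases "v = Suc n")
    case False
    then show ?thesis
      using Suc recursive_tree_attach(2)[OF recursive_tree_T[of \<omega> n] X_le[of \<omega> n], of v] by (simp add: tree_Suc)
  qed (simp add: vdepth_def)
qed

lemma vdepth_Suc: "\<omega> \<in> space M \<Longrightarrow> vdepth (Suc n) \<omega> = Suc (vdepth (X n \<omega>) \<omega>)"
  using recursive_tree_attach(3)[OF recursive_tree_T[of \<omega> n] X_le[of \<omega> n]] depth_T[of \<omega> "X n \<omega>" n] X_le[of \<omega> n]
  by (simp add: vdepth_def tree_Suc)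

lemma total_weight_T: "\<omega> \<in> space M \<Longrightarrow> total_weight f (T n \<omega>) = (\<Sum>v\<le>n. f (vdepth v \<omega>))"
  by (simp add: total_weight_def verts_T depth_T)

lemma level_size_T: "\<omega> \<in> space M \<Longrightarrow> level_size (T n \<omega>) k = card {v. v \<le> n \<and> vdepth v \<omega> = k}"
  unfolding level_size_def by (rule arg_cong[where f = card]) (auto simp: verts_T depth_T)

lemma tree_depth_T: "\<omega> \<in> space M \<Longrightarrow> tree_depth (T n \<omega>) = Max ((\<lambda>v. vdepth v \<omega>) ` {..n})"
  unfolding tree_depth_def by (rule arg_cong[where f = Max]) (auto simp: verts_T depth_T intro!: image_cong)

lemma simple_function_X: "simple_function M (X n)"
  unfolding simple_function_def
proof
  show "finite (X n ` space M)" by (rule finite_subset[of _ "{..n}"]) (auto simp: X_le)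
  show "\<forall>x\<in>X n ` space M. X n -` {x} \<inter> space M \<in> sets M"
    using measurable_sets[OF choice_measurable[of n]] by simp
qed

lemma simple_function_T: "simple_function M (T n)"
proof (induction n)
  case 0
  have "simple_function M (\<lambda>_. single_vertex_tree (0::nat))" by simp
  then show ?case by (subst simple_function_cong[of M _ "\<lambda>_. single_vertex_tree 0"]) (auto simp: tree_0)
next
  case (Suc n)
  have "simple_function M (\<lambda>\<omega>. attach (T n \<omega>) (X n \<omega>) (Suc n))"
    using simple_function_compose2[OF Suc simple_function_X[of n], of "\<lambda>t u. attach t u (Suc n)"] by simp
  then show ?case by (subst simple_function_cong[of M _ "\<lambda>\<omega>. attach (T n \<omega>) (X n \<omega>) (Suc n)"]) (auto simp: tree_Suc)
qed

text \<open>Adapted functionals take finitely many values, so they are integrable and no filtration is needed.\<close>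

definition adapted :: "nat \<Rightarrow> ('a \<Rightarrow> 'b) \<Rightarrow> bool" where
  "adapted n Y \<longleftrightarrow> (\<forall>\<omega>\<in>space M. \<forall>\<omega>'\<in>space M. (\<forall>v\<le>n. vdepth v \<omega> = vdepth v \<omega>') \<longrightarrow> Y \<omega> = Y \<omega>')"

lemma adaptedI:
  assumes "\<And>\<omega> \<omega>'. \<omega> \<in> space M \<Longrightarrow> \<omega>' \<in> space M \<Longrightarrow>
    (\<And>v. v \<le> n \<Longrightarrow> vdepth v \<omega> = vdepth v \<omega>') \<Longrightarrow> Y \<omega> = Y \<omega>'"
  shows "adapted n Y"
  using assms unfolding adapted_def by blast

lemma adaptedD:
  assumes "adapted n Y" "\<omega> \<in> space M" "\<omega>' \<in> space M" "\<And>v. v \<le> n \<Longrightarrow> vdepth v \<omega> = vdepth v \<omega>'"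
  shows "Y \<omega> = Y \<omega>'"
  using assms unfolding adapted_def by blast

lemma adapted_mono: "adapted m Y \<Longrightarrow> m \<le> n \<Longrightarrow> adapted n Y"
  unfolding adapted_def by (meson order_trans)

lemma adapted_eq_T: "adapted n Y \<Longrightarrow> \<omega> \<in> space M \<Longrightarrow> \<omega>' \<in> space M \<Longrightarrow> T n \<omega> = T n \<omega>' \<Longrightarrow> Y \<omega> = Y \<omega>'"
  unfolding adapted_def by (metis depth_T)

text \<open>The attachment law conditions on the tree, whereas \<open>adapted\<close> speaks of
  depths. The tree determines the depths, so one representative outcome for each tree defines the
  function.\<close>

lemma adapted_factor:
  assumes "adapted n Y"
  obtains y where "\<And>\<omega>. \<omega> \<in> space M \<Longrightarrow> Y \<omega> = y (T n \<omega>)"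
proof
  fix \<omega> assume \<omega>: "\<omega> \<in> space M"
  define \<omega>' where "\<omega>' = (SOME \<omega>'. \<omega>' \<in> space M \<and> T n \<omega>' = T n \<omega>)"
  have "\<omega>' \<in> space M \<and> T n \<omega>' = T n \<omega>" unfolding \<omega>'_def by (rule someI) (use \<omega> in auto)
  then have "Y \<omega> = Y \<omega>'" using adapted_eq_T[OF assms \<omega>, of \<omega>'] by auto
  then show "Y \<omega> = (\<lambda>t. Y (SOME \<omega>'. \<omega>' \<in> space M \<and> T n \<omega>' = t)) (T n \<omega>)" by (simp add: \<omega>'_def)
qed

lemma simple_function_adapted:
  assumes "adapted n Y" shows "simple_function M Y"
proof -
  obtain y where y: "\<And>\<omega>. \<omega> \<in> space M \<Longrightarrow> Y \<omega> = y (T n \<omega>)" using adapted_factor[OF assms] by blast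
  have "simple_function M (y \<circ> T n)" by (rule simple_function_compose[OF simple_function_T])
  then show ?thesis by (subst simple_function_cong[of M _ "y \<circ> T n"]) (auto simp: y)
qed

lemma integrable_adapted:
  fixes Y :: "'a \<Rightarrow> real"
  assumes "adapted n Y" shows "integrable M Y"
proof -
  have sf: "simple_function M Y" by (rule simple_function_adapted[OF assms])
  then have "finite (Y ` space M)" by (rule simple_functionD)
  then have "finite ((\<lambda>\<omega>. norm (Y \<omega>)) ` space M)" by (metis finite_imageI image_image)
  then have "norm (Y \<omega>) \<le> Max ((\<lambda>\<omega>. norm (Y \<omega>)) ` space M)" if "\<omega> \<in> space M" for \<omega> using that by (intro Max_ge) auto
  then show ?thesis using borel_measurable_simple_function[OF sf]
    by (intro integrable_const_bound[where B = "Max ((\<lambda>\<omega>. norm (Y \<omega>)) ` space M)"]) auto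
qed

lemma adapted_event: "adapted n P \<Longrightarrow> {\<omega> \<in> space M. P \<omega>} \<in> sets M"
  using simple_functionD(2)[OF simple_function_adapted, of n P "{True}"]
  by (simp add: vimage_def Int_def conj_commute)

lemma expectation_of_bool:
  assumes "{\<omega> \<in> space M. P \<omega>} \<in> sets M"
  shows "expectation (\<lambda>\<omega>. of_bool (P \<omega>)) = prob {\<omega> \<in> space M. P \<omega>}"
    and "integrable M (\<lambda>\<omega>. of_bool (P \<omega>) :: real)"
proof -
  define E where "E = {\<omega> \<in> space M. P \<omega>}"
  have E: "E \<in> sets M" "E \<inter> space M = E" using assms by (auto simp: E_def)
  have "expectation (\<lambda>\<omega>. of_bool (P \<omega>) :: real) = expectation (indicator E)"
    by (intro Bochner_Integration.integral_cong) (auto simp: indicator_def E_def)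
  then show "expectation (\<lambda>\<omega>. of_bool (P \<omega>)) = prob {\<omega> \<in> space M. P \<omega>}"
    using E by (simp flip: E_def)
  have "integrable M (indicator E :: 'a \<Rightarrow> real)" using E
    by (intro integrable_real_indicator) (auto simp: emeasure_eq_measure)
  then show "integrable M (\<lambda>\<omega>. of_bool (P \<omega>) :: real)"
    by (rule Bochner_Integration.integrable_cong[THEN iffD1, rotated -1]) (auto simp: indicator_def E_def)
qed

text \<open>Both sides split over the finitely many values of the tree. Where such a value has
  positive probability \<open>choice_law\<close> applies; the other values contribute 0 to both
  sides.\<close>

lemma expectation_choice:
  fixes Y :: "'a \<Rightarrow> real"
  assumes Y: "adapted n Y" and v: "v \<le> n"
  shows "expectation (\<lambda>\<omega>. Y \<omega> * of_bool (X n \<omega> = v)) =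
    expectation (\<lambda>\<omega>. Y \<omega> * (f (vdepth v \<omega>) / (\<Sum>u\<le>n. f (vdepth u \<omega>))))"
proof -
  obtain y where y: "\<And>\<omega>. \<omega> \<in> space M \<Longrightarrow> Y \<omega> = y (T n \<omega>)" using adapted_factor[OF Y] by blast
  define R where "R = T n ` space M"
  have R: "finite R" using simple_functionD(1)[OF simple_function_T[of n]] by (simp add: R_def)
  have mT: "{\<omega> \<in> space M. T n \<omega> = t} \<in> sets M" for t
    using simple_functionD(2)[OF simple_function_T, of n "{t}"] by (simp add: vimage_def Int_def conj_commute)
  have mX: "{\<omega> \<in> space M. X n \<omega> = u} \<in> sets M" for u
    using simple_functionD(2)[OF simple_function_X, of n "{u}"] by (simp add: vimage_def Int_def conj_commute)
  have mTX: "{\<omega> \<in> space M. X n \<omega> = u \<and> T n \<omega> = t} \<in> sets M" for u t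
  proof -
    have "{\<omega> \<in> space M. X n \<omega> = u \<and> T n \<omega> = t} = {\<omega> \<in> space M. X n \<omega> = u} \<inter> {\<omega> \<in> space M. T n \<omega> = t}" by blast
    then show ?thesis using mX mT by (simp only: sets.Int)
  qed
  have split: "g (T n \<omega>) = (\<Sum>t\<in>R. g t * of_bool (T n \<omega> = t))" if "\<omega> \<in> space M" for g :: "nat rooted_tree \<Rightarrow> real" and \<omega>
    using that R by (simp add: R_def sum.delta' of_bool_def if_distrib cong: if_cong)
  have mTX': "{\<omega> \<in> space M. T n \<omega> = t \<and> X n \<omega> = v} \<in> sets M" for t
    using mTX[of v t] by (simp add: conj_commute)
  have e1: "expectation (\<lambda>\<omega>. of_bool (T n \<omega> = t \<and> X n \<omega> = v) :: real) = prob {\<omega> \<in> space M. X n \<omega> = v \<and> T n \<omega> = t}" for t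
    unfolding expectation_of_bool(1)[OF mTX'] by (simp add: conj_commute)
  note e2 = expectation_of_bool(1)[OF mT] and i1 = expectation_of_bool(2)[OF mTX'] and i2 = expectation_of_bool(2)[OF mT]
  have law: "prob {\<omega> \<in> space M. X n \<omega> = v \<and> T n \<omega> = t} = prob {\<omega> \<in> space M. T n \<omega> = t} * (f (depth t v) / total_weight f t)" if "t \<in> R" for t
  proof (cases "prob {\<omega> \<in> space M. T n \<omega> = t} > 0")
    case True
    have "v \<in> verts t" using that v by (auto simp: R_def verts_T)
    from choice_law[OF True this] show ?thesis using True unfolding cond_prob_def by (simp add: field_simps)
  next
    case False
    then have z: "prob {\<omega> \<in> space M. T n \<omega> = t} = 0" using measure_nonneg[of M] by (metis antisym_conv2)
    have "prob {\<omega> \<in> space M. X n \<omega> = v \<and> T n \<omega> = t} \<le> prob {\<omega> \<in> space M. T n \<omega> = t}"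
      by (intro finite_measure_mono mT) auto
    then show ?thesis using z by (simp add: measure_le_0_iff)
  qed
  have "expectation (\<lambda>\<omega>. Y \<omega> * of_bool (X n \<omega> = v)) = expectation (\<lambda>\<omega>. \<Sum>t\<in>R. y t * of_bool (T n \<omega> = t \<and> X n \<omega> = v))"
  proof (intro Bochner_Integration.integral_cong refl)
    fix \<omega> assume \<omega>: "\<omega> \<in> space M"
    show "Y \<omega> * of_bool (X n \<omega> = v) = (\<Sum>t\<in>R. y t * of_bool (T n \<omega> = t \<and> X n \<omega> = v))"
      using split[OF \<omega>, of y] by (simp add: y[OF \<omega>] sum_distrib_right of_bool_conj mult.assoc)
  qed
  also have "\<dots> = (\<Sum>t\<in>R. y t * prob {\<omega> \<in> space M. X n \<omega> = v \<and> T n \<omega> = t})"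
    using i1 by (subst Bochner_Integration.integral_sum) (auto simp: e1)
  also have "\<dots> = (\<Sum>t\<in>R. y t * (f (depth t v) / total_weight f t) * prob {\<omega> \<in> space M. T n \<omega> = t})"
    by (intro sum.cong refl) (simp add: law)
  also have "\<dots> = expectation (\<lambda>\<omega>. \<Sum>t\<in>R. y t * (f (depth t v) / total_weight f t) * of_bool (T n \<omega> = t))"
    using i2 by (subst Bochner_Integration.integral_sum) (auto simp: e2)
  also have "\<dots> = expectation (\<lambda>\<omega>. Y \<omega> * (f (vdepth v \<omega>) / (\<Sum>u\<le>n. f (vdepth u \<omega>))))"
  proof (intro Bochner_Integration.integral_cong refl)
    fix \<omega> assume \<omega>: "\<omega> \<in> space M"
    show "(\<Sum>t\<in>R. y t * (f (depth t v) / total_weight f t) * of_bool (T n \<omega> = t)) = Y \<omega> * (f (vdepth v \<omega>) / (\<Sum>u\<le>n. f (vdepth u \<omega>)))"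
      using split[OF \<omega>, of "\<lambda>t. y t * (f (depth t v) / total_weight f t)"] v \<omega>
      by (simp add: y depth_T total_weight_T)
  qed
  finally show ?thesis .
qed

text \<open>This plays the part of a conditional expectation given the past: \<open>G\<close> is
  known at time \<open>n\<close> except for its second argument, the depth of the new vertex, which
  is one more than that of the random parent.\<close>

lemma expectation_step:
  fixes G :: "'a \<Rightarrow> nat \<Rightarrow> real"
  assumes G: "\<And>k. adapted n (\<lambda>\<omega>. G \<omega> k)"
  shows "expectation (\<lambda>\<omega>. G \<omega> (vdepth (Suc n) \<omega>)) =
    expectation (\<lambda>\<omega>. \<Sum>v\<le>n. f (vdepth v \<omega>) / (\<Sum>u\<le>n. f (vdepth u \<omega>)) * G \<omega> (Suc (vdepth v \<omega>)))"
proof -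
  have ad: "adapted n (\<lambda>\<omega>. G \<omega> (Suc (vdepth v \<omega>)))" if "v \<le> n" for v
  proof (rule adaptedI)
    fix \<omega> \<omega>' assume \<omega>: "\<omega> \<in> space M" "\<omega>' \<in> space M" and eq: "\<And>v. v \<le> n \<Longrightarrow> vdepth v \<omega> = vdepth v \<omega>'"
    show "G \<omega> (Suc (vdepth v \<omega>)) = G \<omega>' (Suc (vdepth v \<omega>'))"
      using adaptedD[OF G \<omega> eq] eq[OF that] by simp
  qed
  have ad2: "adapted n (\<lambda>\<omega>. G \<omega> (Suc (vdepth v \<omega>)) * (f (vdepth v \<omega>) / (\<Sum>u\<le>n. f (vdepth u \<omega>))))" if v: "v \<le> n" for v
  proof (rule adaptedI)
    fix \<omega> \<omega>' assume \<omega>: "\<omega> \<in> space M" "\<omega>' \<in> space M" and eq: "\<And>v. v \<le> n \<Longrightarrow> vdepth v \<omega> = vdepth v \<omega>'"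
    have "(\<Sum>u\<le>n. f (vdepth u \<omega>)) = (\<Sum>u\<le>n. f (vdepth u \<omega>'))" by (intro sum.cong refl) (simp add: eq)
    then show "G \<omega> (Suc (vdepth v \<omega>)) * (f (vdepth v \<omega>) / (\<Sum>u\<le>n. f (vdepth u \<omega>))) =
        G \<omega>' (Suc (vdepth v \<omega>')) * (f (vdepth v \<omega>') / (\<Sum>u\<le>n. f (vdepth u \<omega>')))"
      using adaptedD[OF ad[OF v] \<omega> eq] eq[OF v] by simp
  qed
  have mX: "{\<omega> \<in> space M. X n \<omega> = v} \<in> sets M" for v
    using simple_functionD(2)[OF simple_function_X, of n "{v}"] by (simp add: vimage_def Int_def conj_commute)
  have int: "integrable M (\<lambda>\<omega>. G \<omega> (Suc (vdepth v \<omega>)) * of_bool (X n \<omega> = v))" if "v \<le> n" for v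
    using integrable_mult_indicator[OF mX[of v] integrable_adapted[OF ad[OF that]]]
    by (rule Bochner_Integration.integrable_cong[THEN iffD1, rotated -1]) (auto simp: indicator_def)
  have "expectation (\<lambda>\<omega>. G \<omega> (vdepth (Suc n) \<omega>)) = expectation (\<lambda>\<omega>. \<Sum>v\<le>n. G \<omega> (Suc (vdepth v \<omega>)) * of_bool (X n \<omega> = v))"
  proof (intro Bochner_Integration.integral_cong refl)
    fix \<omega> assume \<omega>: "\<omega> \<in> space M"
    have "(\<Sum>v\<le>n. G \<omega> (Suc (vdepth v \<omega>)) * of_bool (X n \<omega> = v)) = (\<Sum>v\<in>{X n \<omega>}. G \<omega> (Suc (vdepth v \<omega>)))"
      using X_le[OF \<omega>, of n] by (intro sum.mono_neutral_cong_right) auto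
    then show "G \<omega> (vdepth (Suc n) \<omega>) = (\<Sum>v\<le>n. G \<omega> (Suc (vdepth v \<omega>)) * of_bool (X n \<omega> = v))"
      using \<omega> by (simp only: vdepth_Suc) simp
  qed
  also have "\<dots> = (\<Sum>v\<le>n. expectation (\<lambda>\<omega>. G \<omega> (Suc (vdepth v \<omega>)) * of_bool (X n \<omega> = v)))"
    using int by (intro Bochner_Integration.integral_sum) auto
  also have "\<dots> = (\<Sum>v\<le>n. expectation (\<lambda>\<omega>. G \<omega> (Suc (vdepth v \<omega>)) * (f (vdepth v \<omega>) / (\<Sum>u\<le>n. f (vdepth u \<omega>)))))"
    by (intro sum.cong refl expectation_choice ad) auto
  also have "\<dots> = expectation (\<lambda>\<omega>. \<Sum>v\<le>n. G \<omega> (Suc (vdepth v \<omega>)) * (f (vdepth v \<omega>) / (\<Sum>u\<le>n. f (vdepth u \<omega>))))"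
    using integrable_adapted[OF ad2] by (intro Bochner_Integration.integral_sum[symmetric]) auto
  finally show ?thesis by (simp add: mult.commute)
qed

lemma adapted_compose: "adapted n Y \<Longrightarrow> adapted n (\<lambda>\<omega>. g (Y \<omega>))"
  unfolding adapted_def by metis

lemma adapted_compose2: "adapted n Y \<Longrightarrow> adapted n Z \<Longrightarrow> adapted n (\<lambda>\<omega>. g (Y \<omega>) (Z \<omega>))"
  unfolding adapted_def by metis

lemma adapted_sum:
  assumes "\<And>i. i \<in> I \<Longrightarrow> adapted n (Y i)"
  shows "adapted n (\<lambda>\<omega>. \<Sum>i\<in>I. Y i \<omega>)"
  by (rule adaptedI) (intro sum.cong refl, rule adaptedD[OF assms])

lemma adapted_prod:
  assumes "\<And>i. i \<in> I \<Longrightarrow> adapted n (Y i)"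
  shows "adapted n (\<lambda>\<omega>. \<Prod>i\<in>I. Y i \<omega>)"
  by (rule adaptedI) (intro prod.cong refl, rule adaptedD[OF assms])

lemma adapted_vdepth: "v \<le> n \<Longrightarrow> adapted n (vdepth v)"
  by (rule adaptedI)

lemma adapted_const: "adapted n (\<lambda>_. a)"
  by (rule adaptedI) simp

text \<open>Doob's inequality. Testing against all non-negative adapted \<open>Y\<close> replaces
  conditional expectations; the test used is the indicator that the level has not been reached
  yet.\<close>

lemma supermartingale_maximal_inequality:
  fixes V :: "nat \<Rightarrow> 'a \<Rightarrow> real"
  assumes ad: "\<And>n. n \<ge> m \<Longrightarrow> adapted n (V n)"
    and nn: "\<And>n \<omega>. n \<ge> m \<Longrightarrow> \<omega> \<in> space M \<Longrightarrow> 0 \<le> V n \<omega>"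
    and super: "\<And>n Y. n \<ge> m \<Longrightarrow> adapted n Y \<Longrightarrow> (\<And>\<omega>. 0 \<le> Y \<omega>) \<Longrightarrow>
      expectation (\<lambda>\<omega>. Y \<omega> * V (Suc n) \<omega>) \<le> expectation (\<lambda>\<omega>. Y \<omega> * V n \<omega>)"
    and r: "r \<ge> 0"
  shows "r * prob {\<omega> \<in> space M. \<exists>n\<ge>m. r \<le> V n \<omega>} \<le> expectation (V m)"
proof -
  define B where "B = (\<lambda>j \<omega>. \<exists>n. m \<le> n \<and> n \<le> m + j \<and> r \<le> V n \<omega>)"
  have adB: "adapted (m + j) (B j)" for j
  proof (rule adaptedI)
    fix \<omega> \<omega>' assume \<omega>: "\<omega> \<in> space M" "\<omega>' \<in> space M" and eq: "\<And>v. v \<le> m + j \<Longrightarrow> vdepth v \<omega> = vdepth v \<omega>'"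
    have "V n \<omega> = V n \<omega>'" if "m \<le> n" "n \<le> m + j" for n
      using adaptedD[OF adapted_mono[OF ad[OF that(1)] that(2)] \<omega> eq] .
    then show "B j \<omega> = B j \<omega>'" unfolding B_def by metis
  qed
  have B_Suc: "B (Suc j) \<omega> \<longleftrightarrow> B j \<omega> \<or> r \<le> V (Suc (m + j)) \<omega>" for j \<omega>
    unfolding B_def using le_Suc_eq[of _ "m + j"] by (metis add_Suc_right le_add1 le_SucI order_refl)
  \<comment> \<open>The stopped process: a path that has reached the level \<open>r\<close> is
    frozen at the value \<open>r\<close>, which is at most the value of \<open>V\<close> there, and
    the supermartingale inequality is used on the remaining paths only.\<close>
  have claim: "expectation (\<lambda>\<omega>. r * of_bool (B j \<omega>) + of_bool (\<not> B j \<omega>) * V (m + j) \<omega>) \<le> expectation (V m)" for j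
  proof (induction j)
    case 0
    have "adapted m (\<lambda>\<omega>. r * of_bool (B 0 \<omega>) + of_bool (\<not> B 0 \<omega>) * V (m + 0) \<omega>)"
      using adapted_compose2[OF adB[of 0, unfolded add_0_right] ad[of m], of "\<lambda>b v. r * of_bool b + of_bool (\<not> b) * v"] by simp
    from integrable_adapted[OF this] integrable_adapted[OF ad[OF order_refl]] show ?case
    proof (rule integral_mono)
      show "r * of_bool (B 0 \<omega>) + of_bool (\<not> B 0 \<omega>) * V (m + 0) \<omega> \<le> V m \<omega>" for \<omega>
        by (cases "r \<le> V m \<omega>") (auto simp: B_def)
    qed
  next
    case (Suc j)
    have a1: "adapted (Suc (m + j)) (\<lambda>\<omega>. r * of_bool (B (Suc j) \<omega>) + of_bool (\<not> B (Suc j) \<omega>) * V (m + Suc j) \<omega>)"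
      using adapted_compose2[OF adB[of "Suc j", unfolded add_Suc_right] ad[of "Suc (m + j)"], of "\<lambda>b v. r * of_bool b + of_bool (\<not> b) * v"] by simp
    have adB': "adapted (Suc (m + j)) (B j)" using adapted_mono[OF adB] by simp
    have a2: "adapted (Suc (m + j)) (\<lambda>\<omega>. of_bool (\<not> B j \<omega>) * V (Suc (m + j)) \<omega>)"
      using adapted_compose2[OF adB' ad[of "Suc (m + j)"], of "\<lambda>b v. of_bool (\<not> b) * v"] by simp
    have a3: "adapted (Suc (m + j)) (\<lambda>\<omega>. r * of_bool (B j \<omega>))" by (rule adapted_compose[OF adB'])
    have a4: "adapted (m + j) (\<lambda>\<omega>. of_bool (\<not> B j \<omega>) * V (m + j) \<omega>)"
      using adapted_compose2[OF adB[of j] ad[of "m + j"], of "\<lambda>b v. of_bool (\<not> b) * v"] by simp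
    have a5: "adapted (m + j) (\<lambda>\<omega>. of_bool (\<not> B j \<omega>) :: real)" by (rule adapted_compose[OF adB])
    note ints = a1[THEN integrable_adapted] a2[THEN integrable_adapted] a3[THEN integrable_adapted] a4[THEN integrable_adapted]
    have "expectation (\<lambda>\<omega>. r * of_bool (B (Suc j) \<omega>) + of_bool (\<not> B (Suc j) \<omega>) * V (m + Suc j) \<omega>)
      \<le> expectation (\<lambda>\<omega>. r * of_bool (B j \<omega>) + of_bool (\<not> B j \<omega>) * V (Suc (m + j)) \<omega>)"
    proof (rule integral_mono)
      show "r * of_bool (B (Suc j) \<omega>) + of_bool (\<not> B (Suc j) \<omega>) * V (m + Suc j) \<omega>
        \<le> r * of_bool (B j \<omega>) + of_bool (\<not> B j \<omega>) * V (Suc (m + j)) \<omega>" for \<omega>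
        by (cases "B j \<omega>"; cases "r \<le> V (Suc (m + j)) \<omega>") (auto simp: B_Suc)
    qed (use ints in auto)
    also have "\<dots> = expectation (\<lambda>\<omega>. r * of_bool (B j \<omega>)) + expectation (\<lambda>\<omega>. of_bool (\<not> B j \<omega>) * V (Suc (m + j)) \<omega>)"
      using ints by (intro Bochner_Integration.integral_add) auto
    also have "expectation (\<lambda>\<omega>. of_bool (\<not> B j \<omega>) * V (Suc (m + j)) \<omega>) \<le> expectation (\<lambda>\<omega>. of_bool (\<not> B j \<omega>) * V (m + j) \<omega>)"
      by (rule super[OF _ a5]) auto
    also have "expectation (\<lambda>\<omega>. r * of_bool (B j \<omega>)) + expectation (\<lambda>\<omega>. of_bool (\<not> B j \<omega>) * V (m + j) \<omega>)
      = expectation (\<lambda>\<omega>. r * of_bool (B j \<omega>) + of_bool (\<not> B j \<omega>) * V (m + j) \<omega>)"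
      using ints by (intro Bochner_Integration.integral_add[symmetric]) auto
    finally show ?case using Suc.IH by linarith
  qed
  have mB: "{\<omega> \<in> space M. B j \<omega>} \<in> sets M" for j by (rule adapted_event[OF adB])
  have le: "r * prob {\<omega> \<in> space M. B j \<omega>} \<le> expectation (V m)" for j
  proof -
    have a1: "adapted (m + j) (\<lambda>\<omega>. r * of_bool (B j \<omega>) + of_bool (\<not> B j \<omega>) * V (m + j) \<omega>)"
      using adapted_compose2[OF adB[of j] ad[of "m + j"], of "\<lambda>b v. r * of_bool b + of_bool (\<not> b) * v"] by simp
    have "r * prob {\<omega> \<in> space M. B j \<omega>} = expectation (\<lambda>\<omega>. r * of_bool (B j \<omega>))"
      using expectation_of_bool(1)[OF mB[of j]] by simp
    also have "\<dots> \<le> expectation (\<lambda>\<omega>. r * of_bool (B j \<omega>) + of_bool (\<not> B j \<omega>) * V (m + j) \<omega>)"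
      using expectation_of_bool(2)[OF mB[of j]] nn
      by (intro integral_mono integrable_adapted[OF a1]) auto
    finally show ?thesis using claim[of j] by linarith
  qed
  have "incseq (\<lambda>j. {\<omega> \<in> space M. B j \<omega>})" by (intro incseq_SucI) (auto simp: B_Suc)
  then have "(\<lambda>j. prob {\<omega> \<in> space M. B j \<omega>}) \<longlonglongrightarrow> prob (\<Union>j. {\<omega> \<in> space M. B j \<omega>})"
    using mB by (intro finite_Lim_measure_incseq) auto
  moreover have "(\<Union>j. {\<omega> \<in> space M. B j \<omega>}) = {\<omega> \<in> space M. \<exists>n\<ge>m. r \<le> V n \<omega>}"
    unfolding B_def using le_Suc_ex by fastforce
  ultimately have "(\<lambda>j. r * prob {\<omega> \<in> space M. B j \<omega>}) \<longlonglongrightarrow> r * prob {\<omega> \<in> space M. \<exists>n\<ge>m. r \<le> V n \<omega>}"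
    by (intro tendsto_intros) simp
  then show ?thesis using le by (intro LIMSEQ_le_const2) auto
qed

lemma adapted_seq_event:
  assumes "\<And>n. n \<ge> m \<Longrightarrow> adapted n (V n :: 'a \<Rightarrow> real)"
  shows "{\<omega> \<in> space M. \<exists>n\<ge>m. l \<le> V n \<omega>} \<in> sets M"
proof -
  have "{\<omega> \<in> space M. \<exists>n\<ge>m. l \<le> V n \<omega>} = (\<Union>n\<in>{m..}. {\<omega> \<in> space M. l \<le> V n \<omega>})" by auto
  also have "\<dots> \<in> sets M"
    by (intro sets.countable_UN') (auto intro!: adapted_event adapted_compose[OF assms])
  finally show ?thesis .
qed

text \<open>By the maximal inequality at the levels \<open>Suc j\<close>, the event that all levels
  are exceeded has probability 0.\<close>

lemma supermartingale_AE_bounded: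
  fixes V :: "nat \<Rightarrow> 'a \<Rightarrow> real"
  assumes ad: "\<And>n. n \<ge> m \<Longrightarrow> adapted n (V n)"
    and nn: "\<And>n \<omega>. n \<ge> m \<Longrightarrow> \<omega> \<in> space M \<Longrightarrow> 0 \<le> V n \<omega>"
    and super: "\<And>n Y. n \<ge> m \<Longrightarrow> adapted n Y \<Longrightarrow> (\<And>\<omega>. 0 \<le> Y \<omega>) \<Longrightarrow>
      expectation (\<lambda>\<omega>. Y \<omega> * V (Suc n) \<omega>) \<le> expectation (\<lambda>\<omega>. Y \<omega> * V n \<omega>)"
  shows "AE \<omega> in M. \<exists>C. \<forall>n\<ge>m. V n \<omega> \<le> C"
proof -
  define E where "E = (\<lambda>j::nat. {\<omega> \<in> space M. \<exists>n\<ge>m. real (Suc j) \<le> V n \<omega>})"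
  have mE: "E j \<in> sets M" for j unfolding E_def by (rule adapted_seq_event[OF ad])
  have "prob (\<Inter>j. E j) \<le> expectation (V m) * (1 / real (Suc j))" for j
  proof -
    have "prob (\<Inter>j. E j) \<le> prob (E j)" by (intro finite_measure_mono mE) auto
    also have "real (Suc j) * prob (E j) \<le> expectation (V m)"
      unfolding E_def by (rule supermartingale_maximal_inequality[OF ad nn super]) auto
    then have "prob (E j) \<le> expectation (V m) * (1 / real (Suc j))" by (simp add: field_simps)
    finally show ?thesis .
  qed
  moreover have "(\<lambda>j. expectation (V m) * (1 / real (Suc j))) \<longlonglongrightarrow> expectation (V m) * 0"
    by (intro tendsto_intros LIMSEQ_Suc[OF lim_1_over_n])
  ultimately have "prob (\<Inter>j. E j) \<le> 0" using LIMSEQ_le_const by fastforce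
  then have "prob (\<Inter>j. E j) = 0" by (simp add: measure_le_0_iff)
  moreover have "(\<Inter>j. E j) \<in> sets M" using mE by auto
  ultimately have "(\<Inter>j. E j) \<in> null_sets M" by (intro null_setsI) (auto simp: emeasure_eq_measure)
  then have "AE \<omega> in M. \<omega> \<notin> (\<Inter>j. E j)" by (rule AE_not_in)
  with AE_space show ?thesis
  proof eventually_elim
    case (elim \<omega>)
    then obtain j where "\<forall>n\<ge>m. \<not> (real (Suc j) \<le> V n \<omega>)" by (auto simp: E_def)
    then show ?case by (intro exI[of _ "real (Suc j)"]) (auto simp: not_le intro: less_imp_le)
  qed
qed

end

section \<open>The exponential martingales\<close>

text \<open>The form in which \<open>S k = o(k)\<close> is used throughout: an arbitrarily small
  linear rate, with the finitely many early values absorbed by the constant.\<close>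

lemma sublinear_bound:
  fixes S :: "nat \<Rightarrow> real"
  assumes lim: "(\<lambda>n. S n / real n) \<longlonglongrightarrow> 0" and e: "e > 0"
  obtains C where "C > 0" "\<And>k. \<bar>S k\<bar> \<le> e * real k + C"
proof -
  from lim e obtain N where N: "\<And>n. n \<ge> N \<Longrightarrow> \<bar>S n / real n\<bar> < e"
    unfolding LIMSEQ_iff by (metis diff_zero real_norm_def)
  define C where "C = (\<Sum>k\<le>N. \<bar>S k\<bar>) + 1"
  show ?thesis
  proof (rule that[of C])
    show "C > 0" unfolding C_def by (smt (verit) sum_nonneg abs_ge_zero)
    fix k
    show "\<bar>S k\<bar> \<le> e * real k + C"
    proof (cases "k \<le> N")
      case True
      then have "\<bar>S k\<bar> \<le> (\<Sum>k\<le>N. \<bar>S k\<bar>)" by (intro member_le_sum) auto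
      moreover have "0 \<le> e * real k" using e by simp
      ultimately show ?thesis by (simp add: C_def)
    next
      case False
      then have "\<bar>S k\<bar> / real k < e" "real k > 0" using N[of k] by auto
      then have "\<bar>S k\<bar> < e * real k" by (simp add: field_simps)
      then show ?thesis using \<open>C > 0\<close> by linarith
    qed
  qed
qed

locale bounded_rrt = depth_weighted_rrt M f T X
  for M :: "'a measure" and f :: "nat \<Rightarrow> real"
    and T :: "nat \<Rightarrow> 'a \<Rightarrow> nat rooted_tree" and X :: "nat \<Rightarrow> 'a \<Rightarrow> nat" +
  fixes c :: real
  assumes c_pos: "c > 0"
    and f_bounds: "\<And>n. c \<le> f n \<and> f n \<le> 1 / c"
    and S_lim: "(\<lambda>n. log_weight_sum f n / real n) \<longlonglongrightarrow> 0"
begin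

section \<open>The weighted sums over vertices and their normalisers\<close>

abbreviation "S \<equiv> log_weight_sum f"
abbreviation "n0 \<equiv> start_index c"

definition Z :: "nat \<Rightarrow> 'a \<Rightarrow> real" where "Z n \<omega> = (\<Sum>u\<le>n. f (vdepth u \<omega>))"
definition h :: "nat \<Rightarrow> 'a \<Rightarrow> real" where "h n \<omega> = (\<Sum>k=n0..<n. 1 / Z k \<omega>)"
definition vterm :: "complex \<Rightarrow> nat \<Rightarrow> complex" where "vterm z k = exp (z * of_nat k - of_real (S k))"
definition rterm :: "real \<Rightarrow> nat \<Rightarrow> real" where "rterm x k = exp (x * of_nat k - S k)"
definition \<Phi> :: "nat \<Rightarrow> complex \<Rightarrow> 'a \<Rightarrow> complex" where "\<Phi> n z \<omega> = (\<Sum>v\<le>n. vterm z (vdepth v \<omega>))"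
definition \<phi> :: "nat \<Rightarrow> real \<Rightarrow> 'a \<Rightarrow> real" where "\<phi> n x \<omega> = (\<Sum>v\<le>n. rterm x (vdepth v \<omega>))"
text \<open>In contrast to \<open>Q\<close>, the parameter is the growth rate itself and not its
  logarithm. This allows normalising at rates other than that of \<open>\<Phi>\<close>.\<close>

definition q :: "nat \<Rightarrow> real \<Rightarrow> 'a \<Rightarrow> real" where "q n x \<omega> = (\<Prod>k=n0..<n. 1 + x / Z k \<omega>)"
definition Q :: "nat \<Rightarrow> complex \<Rightarrow> 'a \<Rightarrow> complex" where "Q n z \<omega> = (\<Prod>k=n0..<n. 1 + exp z / Z k \<omega>)"

lemma n0_pos: "n0 > 0" by (simp add: start_index_def)

lemma Z_lower: "c * real (Suc n) \<le> Z n \<omega>"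
proof -
  have "(\<Sum>u\<le>n. c) \<le> Z n \<omega>" unfolding Z_def by (intro sum_mono) (use f_bounds in auto)
  then show ?thesis by (simp add: mult.commute)
qed

lemma Z_upper: "Z n \<omega> \<le> real (Suc n) / c"
proof -
  have "Z n \<omega> \<le> (\<Sum>u\<le>n. 1 / c)" unfolding Z_def by (intro sum_mono) (use f_bounds in auto)
  then show ?thesis by (simp add: mult.commute)
qed

lemma Z_pos: "Z n \<omega> > 0"
  using Z_lower[of n \<omega>] c_pos by (smt (verit) mult_pos_pos of_nat_0_less_iff zero_less_Suc)

text \<open>The starting index is made for this bound: \<open>exp 2 / c < n0\<close>, and every
  vertex weighs at least \<open>c\<close>.\<close>

lemma Z_ge: "n \<ge> n0 \<Longrightarrow> Z n \<omega> > exp 2"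
proof -
  assume n: "n \<ge> n0"
  have "exp 2 / c < real n0" unfolding start_index_def using c_pos by simp linarith
  also have "\<dots> \<le> real (Suc n)" using n by simp
  finally have "exp 2 < c * real (Suc n)" using c_pos by (simp add: field_simps)
  then show ?thesis using Z_lower[of n \<omega>] by linarith
qed

lemma Z_ge_1: "n \<ge> n0 \<Longrightarrow> Z n \<omega> > 1"
  using Z_ge[of n \<omega>] one_le_exp_iff[of "2::real"] by linarith

lemma h_Suc: "n \<ge> n0 \<Longrightarrow> h (Suc n) \<omega> = h n \<omega> + 1 / Z n \<omega>"
  by (simp add: h_def)
lemma q_Suc: "n \<ge> n0 \<Longrightarrow> q (Suc n) x \<omega> = q n x \<omega> * (1 + x / Z n \<omega>)"
  by (simp add: q_def)
lemma Q_Suc: "n \<ge> n0 \<Longrightarrow> Q (Suc n) x \<omega> = Q n x \<omega> * (1 + exp x / Z n \<omega>)"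
  by (simp add: Q_def)
lemma \<Phi>_Suc: "\<Phi> (Suc n) z \<omega> = \<Phi> n z \<omega> + vterm z (vdepth (Suc n) \<omega>)"
  by (simp add: \<Phi>_def)
lemma \<phi>_Suc: "\<phi> (Suc n) z \<omega> = \<phi> n z \<omega> + rterm z (vdepth (Suc n) \<omega>)"
  by (simp add: \<phi>_def)

lemma rterm_pos: "rterm x k > 0" by (simp add: rterm_def)
lemma norm_vterm: "norm (vterm z k) = rterm (Re z) k" by (simp add: vterm_def rterm_def)
lemma vterm_of_real: "vterm (of_real x) k = of_real (rterm x k)"
  by (simp add: vterm_def rterm_def flip: exp_of_real)
lemma \<Phi>_of_real: "\<Phi> n (of_real x) \<omega> = of_real (\<phi> n x \<omega>)"
  by (simp add: \<Phi>_def \<phi>_def vterm_of_real)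
lemma \<phi>_pos: "\<phi> n x \<omega> > 0" unfolding \<phi>_def by (intro sum_pos) (auto simp: rterm_pos)
lemma Q_of_real: "Q n (of_real x) \<omega> = of_real (q n (exp x) \<omega>)"
  by (simp add: Q_def q_def exp_of_real)
lemma q_ge_1: "x \<ge> 0 \<Longrightarrow> q n x \<omega> \<ge> 1"
  unfolding q_def by (intro prod_ge_1) (auto simp: Z_pos less_imp_le)
lemma q_pos: "x \<ge> 0 \<Longrightarrow> q n x \<omega> > 0" using q_ge_1[of x n \<omega>] by simp
lemma q_le_exp: "x \<ge> 0 \<Longrightarrow> q n x \<omega> \<le> exp (x * h n \<omega>)"
proof -
  assume x: "x \<ge> 0"
  have "q n x \<omega> \<le> (\<Prod>k=n0..<n. exp (x / Z k \<omega>))"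
    unfolding q_def using x Z_pos by (intro prod_mono) (auto intro!: add_nonneg_nonneg divide_nonneg_pos)
  also have "\<dots> = exp (x * h n \<omega>)" by (simp add: h_def exp_sum sum_distrib_left)
  finally show ?thesis .
qed
text \<open>Each factor has norm at least its real part. Where \<open>Re (exp z)\<close> is
  positive, \<open>Q\<close> therefore stays away from 0 and may be divided by.\<close>

lemma norm_Q_ge: "x \<ge> 0 \<Longrightarrow> Re (exp z) \<ge> x \<Longrightarrow> norm (Q n z \<omega>) \<ge> q n x \<omega>"
proof -
  assume x: "x \<ge> 0" "Re (exp z) \<ge> x"
  have "1 + x / Z k \<omega> \<le> norm (1 + exp z / Z k \<omega>)" for k
  proof -
    have "1 + x / Z k \<omega> \<le> Re (1 + exp z / Z k \<omega>)"
      using x Z_pos[of k \<omega>] by (simp add: divide_right_mono Re_divide_of_real)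
    then show ?thesis using complex_Re_le_cmod[of "1 + exp z / Z k \<omega>"] by linarith
  qed
  then show ?thesis unfolding Q_def q_def prod_norm[symmetric] using x Z_pos
    by (intro prod_mono) (auto intro!: add_nonneg_nonneg divide_nonneg_pos)
qed

lemma exp_minus_S_Suc: "exp (- S (Suc k)) = exp (- S k) / f k"
  using weight_pos[of k] by (simp add: S_Suc exp_diff)

lemma weights_sum: "(\<Sum>v\<le>n. f (vdepth v \<omega>) / Z n \<omega>) = 1"
  using Z_pos[of n \<omega>] by (simp add: Z_def flip: sum_divide_distrib)

lemma weights_nonneg: "0 \<le> f (vdepth v \<omega>) / Z n \<omega>"
  using Z_pos[of n \<omega>] weight_pos[of "vdepth v \<omega>"] by simp

text \<open>The purpose of the factor \<open>exp (- S k)\<close>: the increment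
  \<open>ln (f k)\<close> of \<open>S\<close> cancels the weight with which a vertex at depth
  \<open>k\<close> is chosen as the parent.\<close>

lemma rterm_Suc: "f k * rterm x (Suc k) = exp x * rterm x k"
proof -
  have "rterm x (Suc k) = exp (x * real (Suc k)) * exp (- S (Suc k))" by (simp add: rterm_def exp_diff exp_minus divide_inverse)
  then show ?thesis using weight_pos[of k] unfolding exp_minus_S_Suc
    by (simp add: rterm_def exp_diff exp_minus divide_inverse algebra_simps exp_add)
qed

lemma vterm_Suc: "f k * vterm z (Suc k) = exp z * vterm z k"
proof -
  have "vterm z (Suc k) = exp (z * of_nat (Suc k)) * of_real (exp (- S (Suc k)))"
    unfolding vterm_def diff_conv_add_uminus exp_add by (simp flip: exp_of_real)
  then show ?thesis using weight_pos[of k] unfolding exp_minus_S_Suc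
    by (simp add: vterm_def exp_diff exp_minus divide_inverse algebra_simps exp_add flip: exp_of_real)
qed

lemma mean_rterm: "(\<Sum>v\<le>n. f (vdepth v \<omega>) / Z n \<omega> * rterm x (Suc (vdepth v \<omega>))) = exp x / Z n \<omega> * \<phi> n x \<omega>"
proof -
  have "f (vdepth v \<omega>) / Z n \<omega> * rterm x (Suc (vdepth v \<omega>)) = exp x / Z n \<omega> * rterm x (vdepth v \<omega>)" for v
    using rterm_Suc[of "vdepth v \<omega>" x] by (simp add: field_simps)
  then show ?thesis unfolding \<phi>_def sum_distrib_left by (intro sum.cong refl)
qed

lemma mean_vterm: "(\<Sum>v\<le>n. complex_of_real (f (vdepth v \<omega>) / Z n \<omega>) * vterm z (Suc (vdepth v \<omega>))) = exp z / Z n \<omega> * \<Phi> n z \<omega>"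
proof -
  have "complex_of_real (f (vdepth v \<omega>) / Z n \<omega>) * vterm z (Suc (vdepth v \<omega>)) = exp z / Z n \<omega> * vterm z (vdepth v \<omega>)" for v
    using vterm_Suc[of "vdepth v \<omega>" z] by (simp add: field_simps)
  then show ?thesis unfolding \<Phi>_def sum_distrib_left by (intro sum.cong refl)
qed

lemma adapted_Z: "k \<le> n \<Longrightarrow> adapted n (Z k)"
  unfolding Z_def by (intro adapted_sum adapted_compose[OF adapted_vdepth]) auto
lemma adapted_\<Phi>: "k \<le> n \<Longrightarrow> adapted n (\<Phi> k z)"
  unfolding \<Phi>_def by (intro adapted_sum adapted_compose[OF adapted_vdepth]) auto
lemma adapted_\<phi>: "k \<le> n \<Longrightarrow> adapted n (\<phi> k z)"
  unfolding \<phi>_def by (intro adapted_sum adapted_compose[OF adapted_vdepth]) auto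
lemma adapted_h: "k \<le> Suc n \<Longrightarrow> adapted n (h k)"
  unfolding h_def by (intro adapted_sum adapted_compose[OF adapted_Z]) auto
lemma adapted_q: "k \<le> Suc n \<Longrightarrow> adapted n (q k x)"
  unfolding q_def by (intro adapted_prod adapted_compose[OF adapted_Z]) auto
lemma adapted_Q: "k \<le> Suc n \<Longrightarrow> adapted n (Q k x)"
  unfolding Q_def by (intro adapted_prod adapted_compose[OF adapted_Z]) auto
lemma adapted_fun: "(\<And>t. adapted n (\<lambda>\<omega>. Y \<omega> t)) \<Longrightarrow> adapted n Y"
  unfolding adapted_def by blast

lemma expectation_Suc:
  fixes G :: "'a \<Rightarrow> nat \<Rightarrow> real"
  assumes "\<And>k. adapted n (\<lambda>\<omega>. G \<omega> k)"
  shows "expectation (\<lambda>\<omega>. G \<omega> (vdepth (Suc n) \<omega>)) =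
    expectation (\<lambda>\<omega>. \<Sum>v\<le>n. f (vdepth v \<omega>) / Z n \<omega> * G \<omega> (Suc (vdepth v \<omega>)))"
  unfolding Z_def by (rule expectation_step[OF assms])

lemma adapted_mean:
  assumes G: "adapted n G"
  shows "adapted n (\<lambda>\<omega>. \<Sum>v\<le>n. f (vdepth v \<omega>) / Z n \<omega> * G \<omega> (Suc (vdepth v \<omega>)))"
proof (intro adapted_sum)
  fix v assume v: "v \<in> {..n}"
  have a: "adapted n (\<lambda>\<omega>. f (vdepth v \<omega>) / Z n \<omega>)"
    by (rule adapted_compose2[OF adapted_vdepth adapted_Z, of v n n "\<lambda>d z. f d / z"]) (use v in auto)
  have b: "adapted n (\<lambda>\<omega>. G \<omega> (Suc (vdepth v \<omega>)))"
    by (rule adapted_compose2[OF G adapted_vdepth, of v "\<lambda>g d. g (Suc d)"]) (use v in auto)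
  show "adapted n (\<lambda>\<omega>. f (vdepth v \<omega>) / Z n \<omega> * G \<omega> (Suc (vdepth v \<omega>)))"
    by (rule adapted_compose2[OF a b])
qed

text \<open>Reduces a supermartingale inequality to a bound, for each fixed outcome, of the average
  over the possible parents.\<close>

lemma expectation_Suc_le:
  fixes G :: "'a \<Rightarrow> nat \<Rightarrow> real"
  assumes G: "adapted n G" and Y: "adapted n Y" "\<And>\<omega>. 0 \<le> Y \<omega>" and B: "adapted n B"
    and le: "\<And>\<omega>. \<omega> \<in> space M \<Longrightarrow> (\<Sum>v\<le>n. f (vdepth v \<omega>) / Z n \<omega> * G \<omega> (Suc (vdepth v \<omega>))) \<le> B \<omega>"
  shows "expectation (\<lambda>\<omega>. Y \<omega> * G \<omega> (vdepth (Suc n) \<omega>)) \<le> expectation (\<lambda>\<omega>. Y \<omega> * B \<omega>)"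
proof -
  have "expectation (\<lambda>\<omega>. Y \<omega> * G \<omega> (vdepth (Suc n) \<omega>)) =
    expectation (\<lambda>\<omega>. \<Sum>v\<le>n. f (vdepth v \<omega>) / Z n \<omega> * (Y \<omega> * G \<omega> (Suc (vdepth v \<omega>))))"
    by (rule expectation_Suc[of n "\<lambda>\<omega> k. Y \<omega> * G \<omega> k"]) (rule adapted_compose2[OF Y(1) G])
  also have "\<dots> = expectation (\<lambda>\<omega>. Y \<omega> * (\<Sum>v\<le>n. f (vdepth v \<omega>) / Z n \<omega> * G \<omega> (Suc (vdepth v \<omega>))))"
    by (simp add: sum_distrib_left mult_ac)
  also have "\<dots> \<le> expectation (\<lambda>\<omega>. Y \<omega> * B \<omega>)"
    by (intro integral_mono integrable_adapted[where n = n] adapted_compose2[OF Y(1) adapted_mean[OF G]]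
        adapted_compose2[OF Y(1) B] mult_left_mono le Y(2))
  finally show ?thesis .
qed

text \<open>The factor \<open>g\<close> stands for a normaliser such as
  \<open>1 / q (Suc n) r \<omega>\<close>, which involves only \<open>Z k\<close> with
  \<open>k \<le> n\<close> and is therefore known one step ahead.\<close>

lemma \<phi>_step:
  assumes Y: "adapted n Y" "\<And>\<omega>. 0 \<le> Y \<omega>" and g: "adapted n g"
  shows "expectation (\<lambda>\<omega>. Y \<omega> * (\<phi> (Suc n) y \<omega> * g \<omega>)) \<le> expectation (\<lambda>\<omega>. Y \<omega> * (\<phi> n y \<omega> * (1 + exp y / Z n \<omega>) * g \<omega>))"
  unfolding \<phi>_Suc
proof (rule expectation_Suc_le[of n "\<lambda>\<omega> k. (\<phi> n y \<omega> + rterm y k) * g \<omega>"])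
  show "adapted n (\<lambda>\<omega> k. (\<phi> n y \<omega> + rterm y k) * g \<omega>)"
    by (rule adapted_compose2[OF adapted_\<phi>[OF order_refl] g])
  show "adapted n (\<lambda>\<omega>. \<phi> n y \<omega> * (1 + exp y / Z n \<omega>) * g \<omega>)"
    by (rule adapted_compose2[OF adapted_compose2[OF adapted_\<phi>[OF order_refl] adapted_Z[OF order_refl]] g])
  fix \<omega>
  have "(\<Sum>v\<le>n. f (vdepth v \<omega>) / Z n \<omega> * ((\<phi> n y \<omega> + rterm y (Suc (vdepth v \<omega>))) * g \<omega>)) =
    ((\<Sum>v\<le>n. f (vdepth v \<omega>) / Z n \<omega>) * \<phi> n y \<omega> + (\<Sum>v\<le>n. f (vdepth v \<omega>) / Z n \<omega> * rterm y (Suc (vdepth v \<omega>)))) * g \<omega>"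
    by (simp add: sum_distrib_left sum_distrib_right sum.distrib algebra_simps)
  then show "(\<Sum>v\<le>n. f (vdepth v \<omega>) / Z n \<omega> * ((\<phi> n y \<omega> + rterm y (Suc (vdepth v \<omega>))) * g \<omega>)) \<le> \<phi> n y \<omega> * (1 + exp y / Z n \<omega>) * g \<omega>"
    unfolding mean_rterm weights_sum by (simp add: algebra_simps)
qed (use Y in auto)

text \<open>Dividing by \<open>q n (exp y)\<close> gives a non-negative supermartingale, so the
  maximal inequality suffices and \<open>y\<close> may be any real number. At \<open>y = 1\<close>
  this later bounds the depths.\<close>

lemma AE_\<phi>_bounded: "AE \<omega> in M. \<exists>C. \<forall>n\<ge>n0. \<phi> n y \<omega> \<le> C * exp (exp y * h n \<omega>)"
proof -
  have "AE \<omega> in M. \<exists>C. \<forall>n\<ge>n0. \<phi> n y \<omega> * inverse (q n (exp y) \<omega>) \<le> C"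
  proof (rule supermartingale_AE_bounded)
    fix n assume n: "n \<ge> n0"
    have adg: "adapted n (\<lambda>\<omega>. inverse (q k (exp y) \<omega>))" if "k \<le> Suc n" for k
      by (rule adapted_compose[OF adapted_q]) (use that in auto)
    show "adapted n (\<lambda>\<omega>. \<phi> n y \<omega> * inverse (q n (exp y) \<omega>))"
      by (rule adapted_compose2[OF adapted_\<phi> adg]) auto
    show "0 \<le> \<phi> n y \<omega> * inverse (q n (exp y) \<omega>)" for \<omega>
      using \<phi>_pos[of n y \<omega>] q_pos[of "exp y" n \<omega>] by simp
    fix Y :: "'a \<Rightarrow> real" assume Y: "adapted n Y" "\<And>\<omega>. 0 \<le> Y \<omega>"
    have eq: "\<phi> n y \<omega> * (1 + exp y / Z n \<omega>) * inverse (q (Suc n) (exp y) \<omega>) = \<phi> n y \<omega> * inverse (q n (exp y) \<omega>)" for \<omega>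
    proof -
      have "1 + exp y / Z n \<omega> > 0" using Z_pos[of n \<omega>] by (simp add: add_pos_pos)
      then show ?thesis unfolding q_Suc[OF n] by simp
    qed
    show "expectation (\<lambda>\<omega>. Y \<omega> * (\<phi> (Suc n) y \<omega> * inverse (q (Suc n) (exp y) \<omega>))) \<le>
        expectation (\<lambda>\<omega>. Y \<omega> * (\<phi> n y \<omega> * inverse (q n (exp y) \<omega>)))"
      using \<phi>_step[OF Y adg[OF order_refl], of y] unfolding eq .
  qed
  then show ?thesis
  proof eventually_elim
    case (elim \<omega>)
    then obtain C where C: "\<And>n. n \<ge> n0 \<Longrightarrow> \<phi> n y \<omega> * inverse (q n (exp y) \<omega>) \<le> C" by blast
    have "\<phi> n y \<omega> \<le> C * exp (exp y * h n \<omega>)" if n: "n \<ge> n0" for n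
    proof -
      have q: "q n (exp y) \<omega> > 0" by (simp add: q_pos)
      have "C \<ge> 0" using C[OF n] \<phi>_pos[of n y \<omega>] q by (smt (verit) inverse_positive_iff_positive mult_pos_pos)
      have "\<phi> n y \<omega> \<le> C * q n (exp y) \<omega>" using C[OF n] q by (simp add: field_simps)
      also have "\<dots> \<le> C * exp (exp y * h n \<omega>)" using \<open>C \<ge> 0\<close> by (intro mult_left_mono q_le_exp) auto
      finally show ?thesis .
    qed
    then show ?case by blast
  qed
qed

end

section \<open>A supermartingale dominating contour integrals\<close>

text \<open>To first order the norm grows by \<open>Re w / x\<close>. The second-order term
  \<open>(norm w)\<^sup>2 / x\<^sup>2\<close> is paid for by the gap \<open>s - r\<close> once
  \<open>x\<close> is large.\<close>

lemma norm_one_plus_le: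
  fixes w :: complex and x :: real
  assumes "Re w \<le> r" "r < s" "0 \<le> s" "x > 0" "(norm w)\<^sup>2 \<le> 2 * (s - r) * x"
  shows "norm (1 + w / x) \<le> 1 + s / x"
proof (rule power2_le_imp_le)
  have "(norm (1 + w / x))\<^sup>2 = 1 + 2 * Re w / x + (norm w)\<^sup>2 / x\<^sup>2"
  proof -
    have "Re (1 + w / x) = 1 + Re w / x" "Im (1 + w / x) = Im w / x"
      by (simp_all add: Re_divide_of_real Im_divide_of_real)
    then show ?thesis using assms(4) unfolding cmod_power2 by (simp add: power2_eq_square field_simps)
  qed
  also have "(norm w)\<^sup>2 / x\<^sup>2 \<le> 2 * (s - r) * x / x\<^sup>2" using assms by (intro divide_right_mono) auto
  also have "2 * (s - r) * x / x\<^sup>2 = 2 * s / x - 2 * r / x"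
    using assms(4) by (simp add: power2_eq_square field_simps)
  also have "1 + 2 * Re w / x + (2 * s / x - 2 * r / x) \<le> 1 + 2 * s / x"
    using assms by (simp add: divide_right_mono)
  also have "\<dots> \<le> (1 + s / x)\<^sup>2" by (simp add: power2_eq_square algebra_simps)
  finally show "(norm (1 + w / x))\<^sup>2 \<le> (1 + s / x)\<^sup>2" by simp
  show "0 \<le> 1 + s / x" using assms by simp
qed

context bounded_rrt
begin

text \<open>The power multiplies \<open>S k\<close> by \<open>p\<close>. One copy of
  \<open>S k\<close> stays in \<open>rterm y k\<close>, and the other \<open>p - 1\<close> copies
  are absorbed by the linear bound, at the price of the rate \<open>(p - 1) * e\<close>. The
  constant \<open>C\<close> depends neither on \<open>y\<close> nor on \<open>z\<close>.\<close>

lemma vterm_powr_bound: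
  assumes p: "1 < p" and e: "e > 0"
  obtains C where "C > 0" "\<And>y z k. p * Re z + (p - 1) * e \<le> y \<Longrightarrow> norm (vterm z k) powr p \<le> C * rterm y k"
proof -
  obtain C' where C': "\<And>k. \<bar>S k\<bar> \<le> e * real k + C'" using sublinear_bound[OF S_lim e] by blast
  show ?thesis
  proof (rule that[of "exp ((p - 1) * C')"])
    fix y z k assume y: "p * Re z + (p - 1) * e \<le> y"
    have "(p - 1) * (- S k) \<le> (p - 1) * (e * real k + C')"
      using C'[of k] p by (intro mult_left_mono) auto
    moreover have "(p * Re z + (p - 1) * e) * real k \<le> y * real k" using y by (intro mult_right_mono) auto
    ultimately have "p * (Re z * real k - S k) \<le> (p - 1) * C' + (y * real k - S k)"
      by (simp add: algebra_simps)
    then show "norm (vterm z k) powr p \<le> exp ((p - 1) * C') * rterm y k"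
      by (simp add: norm_vterm rterm_def powr_def flip: exp_add)
  qed simp
qed

lemma continuous_\<Phi>: "continuous_on A (\<lambda>z. \<Phi> n z \<omega>)"
  unfolding \<Phi>_def vterm_def by (intro continuous_intros)

lemma holomorphic_\<Phi>: "(\<lambda>z. \<Phi> n z \<omega>) holomorphic_on A"
  unfolding \<Phi>_def vterm_def by (intro holomorphic_intros)

lemma continuous_Q: "continuous_on A (\<lambda>z. Q n z \<omega>)"
  unfolding Q_def using Z_pos[of _ \<omega>] by (intro continuous_intros) (metis less_irrefl of_real_eq_0_iff)

lemma holomorphic_Q: "(\<lambda>z. Q n z \<omega>) holomorphic_on A"
  unfolding Q_def using Z_pos[of _ \<omega>] by (intro holomorphic_intros) (metis less_irrefl of_real_eq_0_iff)

text \<open>The moment inequality for the random choice of the parent. Since the \<open>p\<close>-th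
  powers of the new terms are dominated by \<open>rterm y\<close>, whose average over the parents is
  a multiple of \<open>\<phi> n y\<close>, the cost of a step is expressed by the process
  itself.\<close>

lemma mean_norm_powr_le:
  assumes p: "1 < p" "p \<le> 2" and g: "g \<noteq> 0" and B: "\<And>k. norm (vterm z k) powr p \<le> C * rterm y k"
  shows "(\<Sum>v\<le>n. f (vdepth v \<omega>) / Z n \<omega> * norm ((\<Phi> n z \<omega> + vterm z (Suc (vdepth v \<omega>))) / g - a) powr p)
    \<le> norm (\<Phi> n z \<omega> * (1 + exp z / Z n \<omega>) / g - a) powr p + 6 * (C * (exp y / Z n \<omega> * \<phi> n y \<omega>)) / norm g powr p"
proof -
  define w where "w = (\<lambda>v. f (vdepth v \<omega>) / Z n \<omega>)"
  have w: "sum w {..n} = 1" "\<And>v. 0 \<le> w v" using weights_sum[of \<omega> n] weights_nonneg[of _ \<omega> n] by (auto simp: w_def)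
  have "(\<Sum>v\<le>n. w v * norm ((\<Phi> n z \<omega> + vterm z (Suc (vdepth v \<omega>))) / g - a) powr p) =
     (\<Sum>v\<le>n. w v * norm ((\<Phi> n z \<omega> / g - a) + vterm z (Suc (vdepth v \<omega>)) / g) powr p)"
    by (simp add: add_divide_distrib algebra_simps)
  also have "\<dots> \<le> norm ((\<Phi> n z \<omega> / g - a) + (\<Sum>v\<le>n. w v * (vterm z (Suc (vdepth v \<omega>)) / g))) powr p
      + 6 * (\<Sum>v\<le>n. w v * norm (vterm z (Suc (vdepth v \<omega>)) / g) powr p)"
    by (rule weighted_sum_norm_powr_le) (use p w in auto)
  also have "(\<Sum>v\<le>n. w v * (vterm z (Suc (vdepth v \<omega>)) / g)) = exp z / Z n \<omega> * \<Phi> n z \<omega> / g"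
    by (simp only: w_def times_divide_eq_right sum_divide_distrib[symmetric] mean_vterm)
  also have "(\<Phi> n z \<omega> / g - a) + exp z / Z n \<omega> * \<Phi> n z \<omega> / g = \<Phi> n z \<omega> * (1 + exp z / Z n \<omega>) / g - a"
    by (simp add: algebra_simps add_divide_distrib)
  also have "(\<Sum>v\<le>n. w v * norm (vterm z (Suc (vdepth v \<omega>)) / g) powr p) \<le>
      (\<Sum>v\<le>n. w v * (C * rterm y (Suc (vdepth v \<omega>)) / norm g powr p))"
    using B p w by (intro sum_mono mult_left_mono) (auto simp: norm_divide powr_divide divide_right_mono)
  also have "\<dots> = (C * (\<Sum>v\<le>n. w v * rterm y (Suc (vdepth v \<omega>)))) / norm g powr p"
    by (simp add: sum_distrib_left sum_divide_distrib mult_ac)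
  also have "(\<Sum>v\<le>n. w v * rterm y (Suc (vdepth v \<omega>))) = exp y / Z n \<omega> * \<phi> n y \<omega>"
    unfolding w_def by (rule mean_rterm)
  finally show ?thesis by (simp add: w_def)
qed

text \<open>The average over the parents is moved under the integral. The lower bound
  \<open>r\<close> for the normaliser along the path makes the cost independent of
  \<open>t\<close>.\<close>

lemma mean_integral_norm_powr_le:
  assumes p: "1 < p" "p \<le> 2" and \<zeta>: "continuous_on {0..1} \<zeta>"
    and B: "\<And>t k. t \<in> {0..1} \<Longrightarrow> norm (vterm (\<zeta> t) k) powr p \<le> C * rterm y k"
    and g: "continuous_on {0..1::real} g" "\<And>t. t \<in> {0..1} \<Longrightarrow> r \<le> norm (g t)" "r > 0"
    and a: "continuous_on {0..1} a" and C: "C \<ge> 0"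
  shows "(\<Sum>v\<le>n. f (vdepth v \<omega>) / Z n \<omega> *
      integral {0..1} (\<lambda>t. norm ((\<Phi> n (\<zeta> t) \<omega> + vterm (\<zeta> t) (Suc (vdepth v \<omega>))) / g t - a t) powr p))
    \<le> integral {0..1} (\<lambda>t. norm (\<Phi> n (\<zeta> t) \<omega> * (1 + exp (\<zeta> t) / Z n \<omega>) / g t - a t) powr p)
      + 6 * (C * (exp y / Z n \<omega> * \<phi> n y \<omega>)) / r powr p"
proof -
  have g0: "g t \<noteq> 0" if "t \<in> {0..1}" for t using g(2)[OF that] g(3) by auto
  have c\<Phi>: "continuous_on {0..1} (\<lambda>t. \<Phi> n (\<zeta> t) \<omega>)" by (rule continuous_on_compose2[OF continuous_\<Phi>[of UNIV] \<zeta>]) auto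
  have c1: "continuous_on {0..1} (\<lambda>t. norm ((\<Phi> n (\<zeta> t) \<omega> + vterm (\<zeta> t) k) / g t - a t) powr p)" for k
    using p g0 unfolding vterm_def by (intro continuous_on_norm_powr continuous_intros c\<Phi> \<zeta> g a) auto
  have c2: "continuous_on {0..1} (\<lambda>t. norm (\<Phi> n (\<zeta> t) \<omega> * (1 + exp (\<zeta> t) / Z n \<omega>) / g t - a t) powr p)"
    using p g0 Z_pos[of n \<omega>] by (intro continuous_on_norm_powr continuous_intros c\<Phi> \<zeta> g a) auto
  define K where "K = 6 * (C * (exp y / Z n \<omega> * \<phi> n y \<omega>))"
  have K: "K \<ge> 0" unfolding K_def using C Z_pos[of n \<omega>] \<phi>_pos[of n y \<omega>] by simp
  have "(\<Sum>v\<le>n. f (vdepth v \<omega>) / Z n \<omega> *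
      integral {0..1} (\<lambda>t. norm ((\<Phi> n (\<zeta> t) \<omega> + vterm (\<zeta> t) (Suc (vdepth v \<omega>))) / g t - a t) powr p)) =
     integral {0..1} (\<lambda>t. \<Sum>v\<le>n. f (vdepth v \<omega>) / Z n \<omega> *
       norm ((\<Phi> n (\<zeta> t) \<omega> + vterm (\<zeta> t) (Suc (vdepth v \<omega>))) / g t - a t) powr p)"
  proof (subst integral_sum)
    fix v
    show "(\<lambda>t. f (vdepth v \<omega>) / Z n \<omega> *
       norm ((\<Phi> n (\<zeta> t) \<omega> + vterm (\<zeta> t) (Suc (vdepth v \<omega>))) / g t - a t) powr p) integrable_on {0..1}"
      by (intro integrable_continuous_interval continuous_on_mult continuous_on_const c1)
  qed auto
  also have "\<dots> \<le> integral {0..1} (\<lambda>t. norm (\<Phi> n (\<zeta> t) \<omega> * (1 + exp (\<zeta> t) / Z n \<omega>) / g t - a t) powr p + K / r powr p)"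
  proof (rule integral_le)
    show "(\<lambda>t. \<Sum>v\<le>n. f (vdepth v \<omega>) / Z n \<omega> * norm ((\<Phi> n (\<zeta> t) \<omega> + vterm (\<zeta> t) (Suc (vdepth v \<omega>))) / g t - a t) powr p) integrable_on {0..1}"
      using c1 by (intro integrable_continuous_interval continuous_on_sum continuous_on_mult continuous_on_const)
    show "(\<lambda>t. norm (\<Phi> n (\<zeta> t) \<omega> * (1 + exp (\<zeta> t) / Z n \<omega>) / g t - a t) powr p + K / r powr p) integrable_on {0..1}"
      using c2 by (intro integrable_continuous_interval continuous_on_add continuous_on_const)
    fix t :: real assume t: "t \<in> {0..1}"
    have "(\<Sum>v\<le>n. f (vdepth v \<omega>) / Z n \<omega> * norm ((\<Phi> n (\<zeta> t) \<omega> + vterm (\<zeta> t) (Suc (vdepth v \<omega>))) / g t - a t) powr p)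
      \<le> norm (\<Phi> n (\<zeta> t) \<omega> * (1 + exp (\<zeta> t) / Z n \<omega>) / g t - a t) powr p + K / norm (g t) powr p"
      unfolding K_def by (rule mean_norm_powr_le[OF p g0[OF t] B[OF t]])
    also have "K / norm (g t) powr p \<le> K / r powr p"
      using g(2)[OF t] g(3) p K g0[OF t] by (intro divide_left_mono powr_mono2 mult_pos_pos) auto
    finally show "(\<Sum>v\<le>n. f (vdepth v \<omega>) / Z n \<omega> * norm ((\<Phi> n (\<zeta> t) \<omega> + vterm (\<zeta> t) (Suc (vdepth v \<omega>))) / g t - a t) powr p)
      \<le> norm (\<Phi> n (\<zeta> t) \<omega> * (1 + exp (\<zeta> t) / Z n \<omega>) / g t - a t) powr p + K / r powr p" by simp
  qed
  also have "\<dots> = integral {0..1} (\<lambda>t. norm (\<Phi> n (\<zeta> t) \<omega> * (1 + exp (\<zeta> t) / Z n \<omega>) / g t - a t) powr p) + K / r powr p"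
    using c2 by (subst integral_add) (auto intro!: integrable_continuous_interval continuous_on_const)
  finally show ?thesis by (simp add: K_def)
qed

text \<open>The process that pays for future moments: the numerator grows at rate
  \<open>exp y\<close>, the denominator at rate about \<open>p * r\<close>, so it decreases in mean
  if \<open>exp y < p * r\<close>.\<close>

definition R :: "real \<Rightarrow> real \<Rightarrow> real \<Rightarrow> nat \<Rightarrow> 'a \<Rightarrow> real" where
  "R y r p n \<omega> = \<phi> n y \<omega> / q n r \<omega> powr p"

lemma R_nonneg: "0 \<le> R y r p n \<omega>"
  unfolding R_def using \<phi>_pos[of n y \<omega>] by simp

lemma adapted_R: "adapted n (R y r p n)"
  unfolding R_def by (rule adapted_compose2[OF adapted_\<phi> adapted_q]) auto

lemma q_Suc_powr_ge:
  assumes p: "1 < p" and r: "r > 0" and n: "n \<ge> n0"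
  shows "q n r \<omega> powr p * (1 + p * r / Z n \<omega>) \<le> q (Suc n) r \<omega> powr p"
proof -
  have "1 + p * r / Z n \<omega> \<le> (1 + r / Z n \<omega>) powr p"
  proof -
    have "0 \<le> r / Z n \<omega>" using r Z_pos[of n \<omega>] by simp
    then show ?thesis using powr_one_plus_ge[OF p, of "r / Z n \<omega>"] by simp
  qed
  then have "q n r \<omega> powr p * (1 + p * r / Z n \<omega>) \<le> q n r \<omega> powr p * (1 + r / Z n \<omega>) powr p"
    by (intro mult_left_mono) auto
  also have "\<dots> = q (Suc n) r \<omega> powr p"
    unfolding q_Suc[OF n] by (simp add: powr_mult)
  finally show ?thesis .
qed

text \<open>The surplus \<open>p * r - exp y\<close> makes each step a contraction by a multiple of
  \<open>1 / Z n\<close>. As \<open>Z n\<close> is at most \<open>Suc n / c\<close>, the factor can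
  be made deterministic.\<close>

lemma expectation_R_Suc_le:
  assumes p: "1 < p" and r: "r > 0" and y: "exp y < p * r" and n: "n \<ge> n0"
  shows "expectation (R y r p (Suc n)) \<le> exp (- ((p * r - exp y) / (1 + p * r) * c) * (1 / real (Suc n))) * expectation (R y r p n)"
proof -
  \<comment> \<open>The surplus is divided by \<open>1 + p * r\<close> because
    \<open>Z n > 1\<close> bounds \<open>1 + p * r / Z n\<close> by that number. So the factor
    \<open>1 - \<delta> / Z n\<close> can be split off.\<close>
  define \<delta> where "\<delta> = (p * r - exp y) / (1 + p * r)"
  have pr: "p * r > 0" using p r by simp
  have \<delta>: "\<delta> > 0" using y pr by (simp add: \<delta>_def)
  have ad: "adapted n (\<lambda>\<omega>. 1 / q (Suc n) r \<omega> powr p)" by (rule adapted_compose[OF adapted_q]) simp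
  have "expectation (R y r p (Suc n)) \<le> expectation (\<lambda>\<omega>. \<phi> n y \<omega> * (1 + exp y / Z n \<omega>) * (1 / q (Suc n) r \<omega> powr p))"
    using \<phi>_step[OF adapted_const[of n "1::real"] _ ad, of y] by (simp add: R_def[abs_def])
  also have "\<dots> \<le> expectation (\<lambda>\<omega>. exp (- (\<delta> * c) * (1 / real (Suc n))) * R y r p n \<omega>)"
  proof (intro integral_mono integrable_adapted[where n = n])
    show "adapted n (\<lambda>\<omega>. \<phi> n y \<omega> * (1 + exp y / Z n \<omega>) * (1 / q (Suc n) r \<omega> powr p))"
      by (rule adapted_compose2[OF adapted_compose2[OF adapted_\<phi>[OF order_refl] adapted_Z[OF order_refl]] ad])
    show "adapted n (\<lambda>\<omega>. exp (- (\<delta> * c) * (1 / real (Suc n))) * R y r p n \<omega>)"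
      by (rule adapted_compose[OF adapted_R])
    fix \<omega>
    have Z: "Z n \<omega> > 1" using Z_ge_1[OF n] .
    have q: "q n r \<omega> > 0" using q_pos[of r n \<omega>] r by simp
    have pos: "1 + p * r / Z n \<omega> > 0" using pr Z by (simp add: add_pos_pos)
    have "(1 + exp y / Z n \<omega>) = (1 + p * r / Z n \<omega>) - (p * r - exp y) / Z n \<omega>" by (simp add: diff_divide_distrib)
    also have "\<dots> \<le> (1 + p * r / Z n \<omega>) - \<delta> / Z n \<omega> * (1 + p * r / Z n \<omega>)"
    proof -
      have "\<delta> / Z n \<omega> * (1 + p * r / Z n \<omega>) \<le> \<delta> / Z n \<omega> * (1 + p * r)"
      proof (intro mult_left_mono add_left_mono)
        have "p * r / Z n \<omega> \<le> p * r / 1" using pr Z by (intro divide_left_mono) auto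
        then show "p * r / Z n \<omega> \<le> p * r" by simp
      qed (use \<delta> Z in auto)
      also have "\<dots> = (p * r - exp y) / Z n \<omega>" using pr by (simp add: \<delta>_def)
      finally show ?thesis by simp
    qed
    also have "\<dots> = (1 - \<delta> / Z n \<omega>) * (1 + p * r / Z n \<omega>)" by (simp only: left_diff_distrib mult_1_left)
    also have "\<dots> \<le> exp (- (\<delta> * c) * (1 / real (Suc n))) * (1 + p * r / Z n \<omega>)"
    proof (intro mult_right_mono)
      have "\<delta> * c * (1 / real (Suc n)) = \<delta> / (real (Suc n) / c)" using c_pos by simp
      also have "\<dots> \<le> \<delta> / Z n \<omega>" using Z_upper[of n \<omega>] \<delta> Z by (intro divide_left_mono) (auto intro!: mult_pos_pos simp: c_pos)
      finally have "1 - \<delta> / Z n \<omega> \<le> 1 + (- (\<delta> * c) * (1 / real (Suc n)))" by simp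
      also have "\<dots> \<le> exp (- (\<delta> * c) * (1 / real (Suc n)))" by (rule exp_ge_add_one_self)
      finally show "1 - \<delta> / Z n \<omega> \<le> exp (- (\<delta> * c) * (1 / real (Suc n)))" .
    qed (use pos in auto)
    finally have 1: "1 + exp y / Z n \<omega> \<le> exp (- (\<delta> * c) * (1 / real (Suc n))) * (1 + p * r / Z n \<omega>)" .
    have "\<phi> n y \<omega> * (1 + exp y / Z n \<omega>) * (1 / q (Suc n) r \<omega> powr p) \<le>
       \<phi> n y \<omega> * (exp (- (\<delta> * c) * (1 / real (Suc n))) * (1 + p * r / Z n \<omega>)) * (1 / (q n r \<omega> powr p * (1 + p * r / Z n \<omega>)))"
    proof (intro mult_mono mult_left_mono 1 divide_left_mono q_Suc_powr_ge[OF p r n])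
      show "0 < q (Suc n) r \<omega> powr p * (q n r \<omega> powr p * (1 + p * r / Z n \<omega>))"
        using q q_pos[of r "Suc n" \<omega>] r pos by (intro mult_pos_pos) auto
    qed (use \<phi>_pos[of n y \<omega>] pos Z in \<open>auto intro!: mult_nonneg_nonneg add_nonneg_nonneg\<close>)
    also have "\<dots> = exp (- (\<delta> * c) * (1 / real (Suc n))) * R y r p n \<omega>"
    proof -
      have "a * (E * b) * (1 / (Q' * b)) = E * (a / Q')" if "b \<noteq> 0" for a E b Q' :: real using that by simp
      then show ?thesis using pos unfolding R_def by (metis less_irrefl)
    qed
    finally show "\<phi> n y \<omega> * (1 + exp y / Z n \<omega>) * (1 / q (Suc n) r \<omega> powr p) \<le> exp (- (\<delta> * c) * (1 / real (Suc n))) * R y r p n \<omega>" .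
  qed
  also have "\<dots> = exp (- (\<delta> * c) * (1 / real (Suc n))) * expectation (R y r p n)" by simp
  finally show ?thesis by (simp add: \<delta>_def)
qed

lemma harmonic_tail_at_top: "filterlim (\<lambda>n. \<Sum>k=N..<n. 1 / real (Suc k)) at_top sequentially"
proof -
  have eq: "(\<Sum>k=N..<n. 1 / real (Suc k)) = harm n - harm N" if "n \<ge> N" for n
  proof -
    have "harm n = (\<Sum>k<n. 1 / real (Suc k))" for n
      unfolding harm_def by (rule sum.reindex_bij_witness[of _ Suc "\<lambda>k. k - 1"]) (auto simp: inverse_eq_divide)
    moreover have "(\<Sum>k<n. 1 / real (Suc k)) = (\<Sum>k<N. 1 / real (Suc k)) + (\<Sum>k=N..<n. 1 / real (Suc k))"
      using that by (metis sum.atLeastLessThan_concat atLeast0LessThan le0)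
    ultimately show ?thesis by simp
  qed
  have "filterlim (\<lambda>n. - harm N + harm n :: real) at_top sequentially"
    by (rule filterlim_tendsto_add_at_top[OF tendsto_const harm_at_top])
  then show ?thesis
    by (rule filterlim_cong[THEN iffD1, rotated -1]) (auto intro!: eventually_mono[OF eventually_ge_at_top[of N]] simp: eq simp del: of_nat_Suc)
qed

text \<open>The contraction factors multiply to the exponential of a negative multiple of a harmonic
  sum, which diverges.\<close>

lemma expectation_R_tendsto_0:
  assumes p: "1 < p" and r: "r > 0" and y: "exp y < p * r"
  shows "(\<lambda>n. expectation (R y r p n)) \<longlonglongrightarrow> 0"
proof -
  define d where "d = (p * r - exp y) / (1 + p * r) * c"
  have d: "d > 0" unfolding d_def using y p r c_pos by (intro mult_pos_pos divide_pos_pos) (auto intro: add_pos_pos)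
  have bound: "expectation (R y r p (n0 + j)) \<le> exp (- d * (\<Sum>k=n0..<n0+j. 1 / real (Suc k))) * expectation (R y r p n0)" for j
  proof (induction j)
    case (Suc j)
    have "expectation (R y r p (n0 + Suc j)) \<le> exp (- d * (1 / real (Suc (n0 + j)))) * expectation (R y r p (n0 + j))"
      using expectation_R_Suc_le[OF p r y, of "n0 + j"] by (simp add: d_def)
    also have "\<dots> \<le> exp (- d * (1 / real (Suc (n0 + j)))) * (exp (- d * (\<Sum>k=n0..<n0+j. 1 / real (Suc k))) * expectation (R y r p n0))"
      by (intro mult_left_mono Suc.IH) auto
    also have "\<dots> = exp (- d * (\<Sum>k=n0..<n0+Suc j. 1 / real (Suc k))) * expectation (R y r p n0)"
      by (simp add: algebra_simps flip: exp_add)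
    finally show ?case .
  qed simp
  have "((\<lambda>x. exp (- d * x)) \<longlongrightarrow> 0) at_top" using d by real_asymp
  then have "((\<lambda>x. exp (- d * x) * expectation (R y r p n0)) \<longlongrightarrow> 0) at_top" by (rule tendsto_mult_left_zero)
  from filterlim_compose[OF this harmonic_tail_at_top[of n0]]
  have lim: "(\<lambda>n. exp (- d * (\<Sum>k=n0..<n. 1 / real (Suc k))) * expectation (R y r p n0)) \<longlonglongrightarrow> 0" .
  show ?thesis
  proof (rule tendsto_sandwich[OF _ _ tendsto_const lim])
    show "\<forall>\<^sub>F n in sequentially. 0 \<le> expectation (R y r p n)"
      by (intro always_eventually allI integral_nonneg_AE) (simp add: R_nonneg)
    show "\<forall>\<^sub>F n in sequentially. expectation (R y r p n) \<le> exp (- d * (\<Sum>k=n0..<n. 1 / real (Suc k))) * expectation (R y r p n0)"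
      using eventually_ge_at_top[of n0] by eventually_elim (metis bound le_add_diff_inverse)
  qed
qed

text \<open>The term \<open>D * R\<close> pays for the \<open>p\<close>-th moments of all future increments. With \<open>g = Q\<close> and \<open>a\<close> the value at
  time \<open>m\<close> the lemma controls the oscillation of the martingale, with \<open>a = 0\<close> and a faster growing \<open>g\<close> the size
  of \<open>\<Phi>\<close>; a constant path \<open>\<zeta>\<close> gives the pointwise statement.\<close>

lemma contour_supermartingale:
  fixes \<zeta> :: "real \<Rightarrow> complex" and g :: "nat \<Rightarrow> 'a \<Rightarrow> real \<Rightarrow> complex" and a :: "'a \<Rightarrow> real \<Rightarrow> complex"
  assumes p: "1 < p" "p \<le> 2" and r: "r > 0" and y: "exp y < p * r" and C: "C \<ge> 0"
    and \<zeta>: "continuous_on {0..1} \<zeta>"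
    and B: "\<And>t k. t \<in> {0..1} \<Longrightarrow> norm (vterm (\<zeta> t) k) powr p \<le> C * rterm y k"
    and m: "m \<ge> n0"
    and gc: "\<And>n \<omega>. n \<ge> m \<Longrightarrow> continuous_on {0..1} (g n \<omega>)"
    and gq: "\<And>n \<omega> t. n \<ge> m \<Longrightarrow> t \<in> {0..1} \<Longrightarrow> q n r \<omega> \<le> norm (g n \<omega> t)"
    and ga: "\<And>n. n \<ge> m \<Longrightarrow> adapted n (g n)" "\<And>n. n \<ge> m \<Longrightarrow> adapted n (g (Suc n))"
    and ac: "\<And>\<omega>. continuous_on {0..1} (a \<omega>)" and aa: "adapted m a"
    and mean: "\<And>n \<omega> t. n \<ge> m \<Longrightarrow> t \<in> {0..1} \<Longrightarrow>
      norm (\<Phi> n (\<zeta> t) \<omega> * (1 + exp (\<zeta> t) / Z n \<omega>) / g (Suc n) \<omega> t - a \<omega> t) \<le> norm (\<Phi> n (\<zeta> t) \<omega> / g n \<omega> t - a \<omega> t)"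
  defines "D \<equiv> 6 * C * exp y / (p * r - exp y)"
  defines "V \<equiv> \<lambda>n \<omega>. integral {0..1} (\<lambda>t. norm (\<Phi> n (\<zeta> t) \<omega> / g n \<omega> t - a \<omega> t) powr p) + D * R y r p n \<omega>"
  shows "n \<ge> m \<Longrightarrow> adapted n (V n)"
    and "n \<ge> m \<Longrightarrow> 0 \<le> V n \<omega>"
    and "n \<ge> m \<Longrightarrow> adapted n Y \<Longrightarrow> (\<And>\<omega>. 0 \<le> Y \<omega>) \<Longrightarrow>
      expectation (\<lambda>\<omega>. Y \<omega> * V (Suc n) \<omega>) \<le> expectation (\<lambda>\<omega>. Y \<omega> * V n \<omega>)"
proof -
  assume n: "n \<ge> m"
  then have nn: "n \<ge> n0" using m by simp
  have D: "D \<ge> 0" unfolding D_def using C y by simp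
  have g0: "g n \<omega> t \<noteq> 0" if "t \<in> {0..1}" "n \<ge> m" for n t \<omega>
    using gq[OF that(2,1), of \<omega>] q_pos[of r n \<omega>] r by auto
  have ada: "adapted n a" using adapted_mono[OF aa n] .
  have ad\<Phi>: "adapted n (\<lambda>\<omega> t. \<Phi> n (\<zeta> t) \<omega>)" by (intro adapted_fun adapted_\<Phi>) auto
  have ad1: "adapted n (\<lambda>\<omega>. (\<lambda>t. norm (\<Phi> n (\<zeta> t) \<omega> / g n \<omega> t - a \<omega> t) powr p))"
    by (rule adapted_compose2[OF adapted_compose2[OF ad\<Phi> ga(1)[OF n]] ada, of "\<lambda>(\<Phi>', g') a' t. norm (\<Phi>' t / g' t - a' t) powr p" Pair, unfolded case_prod_conv])
  show adV: "adapted n (V n)" unfolding V_def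
    by (rule adapted_compose2[OF adapted_compose[OF ad1, of "integral {0..1}"] adapted_R])
  have c\<Phi>: "continuous_on {0..1} (\<lambda>t. \<Phi> n (\<zeta> t) \<omega>)" for \<omega> by (rule continuous_on_compose2[OF continuous_\<Phi>[of UNIV] \<zeta>]) auto
  have cont1: "continuous_on {0..1} (\<lambda>t. norm (\<Phi> n (\<zeta> t) \<omega> / g n \<omega> t - a \<omega> t) powr p)" for \<omega>
    using p g0[OF _ n] by (intro continuous_on_norm_powr continuous_intros c\<Phi> gc[OF n] ac) auto
  show "0 \<le> V n \<omega>" unfolding V_def using D R_nonneg p
    by (intro add_nonneg_nonneg mult_nonneg_nonneg integral_nonneg integrable_continuous_interval cont1) auto
  assume Y: "adapted n Y" "\<And>\<omega>. 0 \<le> Y \<omega>"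
  \<comment> \<open>\<open>V (Suc n)\<close> as a function of the depth \<open>k\<close> of the new
    vertex; everything else in it is known at time \<open>n\<close>.\<close>
  define G where "G = (\<lambda>\<omega> k. integral {0..1} (\<lambda>t. norm ((\<Phi> n (\<zeta> t) \<omega> + vterm (\<zeta> t) k) / g (Suc n) \<omega> t - a \<omega> t) powr p)
     + D * ((\<phi> n y \<omega> + rterm y k) / q (Suc n) r \<omega> powr p))"
  have VG: "V (Suc n) \<omega> = G \<omega> (vdepth (Suc n) \<omega>)" for \<omega>
    by (simp add: V_def G_def R_def \<Phi>_Suc \<phi>_Suc)
  have adG: "adapted n G"
  proof (rule adapted_fun)
    fix k
    have "adapted n (\<lambda>\<omega>. (\<lambda>t. norm ((\<Phi> n (\<zeta> t) \<omega> + vterm (\<zeta> t) k) / g (Suc n) \<omega> t - a \<omega> t) powr p))"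
      by (rule adapted_compose2[OF adapted_compose2[OF ad\<Phi> ga(2)[OF n]] ada, of "\<lambda>(\<Phi>', g') a' t. norm ((\<Phi>' t + vterm (\<zeta> t) k) / g' t - a' t) powr p" Pair, unfolded case_prod_conv])
    then have "adapted n (\<lambda>\<omega>. integral {0..1} (\<lambda>t. norm ((\<Phi> n (\<zeta> t) \<omega> + vterm (\<zeta> t) k) / g (Suc n) \<omega> t - a \<omega> t) powr p))"
      by (rule adapted_compose)
    moreover have "adapted n (\<lambda>\<omega>. D * ((\<phi> n y \<omega> + rterm y k) / q (Suc n) r \<omega> powr p))"
      by (rule adapted_compose2[OF adapted_\<phi>[OF order_refl] adapted_q[OF order_refl]])
    ultimately show "adapted n (\<lambda>\<omega>. G \<omega> k)" unfolding G_def by (rule adapted_compose2)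
  qed
  show "expectation (\<lambda>\<omega>. Y \<omega> * V (Suc n) \<omega>) \<le> expectation (\<lambda>\<omega>. Y \<omega> * V n \<omega>)" unfolding VG
  proof (rule expectation_Suc_le[OF adG Y])
    show "adapted n (V n)" by (rule adV)
    fix \<omega>
    have Zp: "Z n \<omega> > 0" by (rule Z_pos)
    have qS: "q (Suc n) r \<omega> > 0" "q n r \<omega> > 0" using q_pos[of r _ \<omega>] r by auto
    define w where "w = (\<lambda>v. f (vdepth v \<omega>) / Z n \<omega>)"
    have e1: "(\<Sum>v\<le>n. w v * G \<omega> (Suc (vdepth v \<omega>))) =
      (\<Sum>v\<le>n. w v * integral {0..1} (\<lambda>t. norm ((\<Phi> n (\<zeta> t) \<omega> + vterm (\<zeta> t) (Suc (vdepth v \<omega>))) / g (Suc n) \<omega> t - a \<omega> t) powr p))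
      + D * (((\<Sum>v\<le>n. w v) * \<phi> n y \<omega> + (\<Sum>v\<le>n. w v * rterm y (Suc (vdepth v \<omega>)))) / q (Suc n) r \<omega> powr p)"
      by (simp add: G_def sum.distrib distrib_left sum_distrib_left sum_distrib_right sum_divide_distrib add_divide_distrib mult_ac)
    have e2: "(\<Sum>v\<le>n. w v * rterm y (Suc (vdepth v \<omega>))) = exp y / Z n \<omega> * \<phi> n y \<omega>"
      unfolding w_def by (rule mean_rterm)
    have e3: "(\<Sum>v\<le>n. w v) = 1" unfolding w_def by (rule weights_sum)
    have e4: "(\<Sum>v\<le>n. w v * integral {0..1} (\<lambda>t. norm ((\<Phi> n (\<zeta> t) \<omega> + vterm (\<zeta> t) (Suc (vdepth v \<omega>))) / g (Suc n) \<omega> t - a \<omega> t) powr p))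
      \<le> integral {0..1} (\<lambda>t. norm (\<Phi> n (\<zeta> t) \<omega> * (1 + exp (\<zeta> t) / Z n \<omega>) / g (Suc n) \<omega> t - a \<omega> t) powr p)
      + 6 * (C * (exp y / Z n \<omega> * \<phi> n y \<omega>)) / q (Suc n) r \<omega> powr p"
      unfolding w_def using n gq[of "Suc n"] gc[of "Suc n"] qS
      by (intro mean_integral_norm_powr_le p \<zeta> B ac C) auto
    have e5: "integral {0..1} (\<lambda>t. norm (\<Phi> n (\<zeta> t) \<omega> * (1 + exp (\<zeta> t) / Z n \<omega>) / g (Suc n) \<omega> t - a \<omega> t) powr p)
      \<le> integral {0..1} (\<lambda>t. norm (\<Phi> n (\<zeta> t) \<omega> / g n \<omega> t - a \<omega> t) powr p)"
    proof (rule integral_le)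
      show "(\<lambda>t. norm (\<Phi> n (\<zeta> t) \<omega> * (1 + exp (\<zeta> t) / Z n \<omega>) / g (Suc n) \<omega> t - a \<omega> t) powr p) integrable_on {0..1}"
        using p g0[of _ "Suc n"] Zp n
        by (intro integrable_continuous_interval continuous_on_norm_powr continuous_intros c\<Phi> gc ac \<zeta>) auto
      show "(\<lambda>t. norm (\<Phi> n (\<zeta> t) \<omega> / g n \<omega> t - a \<omega> t) powr p) integrable_on {0..1}"
        by (intro integrable_continuous_interval cont1)
    qed (use p mean[OF n] in \<open>auto intro!: powr_mono2\<close>)
    \<comment> \<open>The origin of \<open>D\<close>: as
      \<open>D * (p * r - exp y) = 6 * C * exp y\<close>, the moment cost of this step raises the
      growth rate of \<open>\<phi> n y\<close> from \<open>exp y\<close> to exactly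
      \<open>p * r\<close>, and the next step lets \<open>q powr p\<close> outgrow it.\<close>
    have e6: "integral {0..1} (\<lambda>t. norm (\<Phi> n (\<zeta> t) \<omega> / g n \<omega> t - a \<omega> t) powr p)
       + 6 * (C * (exp y / Z n \<omega> * \<phi> n y \<omega>)) / q (Suc n) r \<omega> powr p
       + D * ((1 * \<phi> n y \<omega> + exp y / Z n \<omega> * \<phi> n y \<omega>) / q (Suc n) r \<omega> powr p)
      = integral {0..1} (\<lambda>t. norm (\<Phi> n (\<zeta> t) \<omega> / g n \<omega> t - a \<omega> t) powr p) + D * (\<phi> n y \<omega> * (1 + p * r / Z n \<omega>) / q (Suc n) r \<omega> powr p)"
    proof -
      have "6 * C * exp y = D * (p * r - exp y)" using y by (simp add: D_def)
      then have eq: "6 * (C * (exp y / Z n \<omega> * \<phi> n y \<omega>)) = D * (p * r - exp y) / Z n \<omega> * \<phi> n y \<omega>"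
        by (simp add: mult_ac)
      show ?thesis unfolding eq by (simp add: algebra_simps add_divide_distrib diff_divide_distrib)
    qed
    have e7: "D * (\<phi> n y \<omega> * (1 + p * r / Z n \<omega>) / q (Suc n) r \<omega> powr p) \<le> D * R y r p n \<omega>"
    proof (intro mult_left_mono D)
      have "0 < 1 + p * r / Z n \<omega>" using p r Zp by (simp add: add_pos_pos)
      then have "\<phi> n y \<omega> * (1 + p * r / Z n \<omega>) / q (Suc n) r \<omega> powr p \<le>
         \<phi> n y \<omega> * (1 + p * r / Z n \<omega>) / (q n r \<omega> powr p * (1 + p * r / Z n \<omega>))"
        using qS \<phi>_pos[of n y \<omega>]
        by (intro divide_left_mono q_Suc_powr_ge[OF p(1) r nn] mult_nonneg_nonneg mult_pos_pos) auto
      then show "\<phi> n y \<omega> * (1 + p * r / Z n \<omega>) / q (Suc n) r \<omega> powr p \<le> R y r p n \<omega>"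
        using \<open>0 < 1 + p * r / Z n \<omega>\<close> by (simp add: R_def)
    qed
    have "(\<Sum>v\<le>n. w v * G \<omega> (Suc (vdepth v \<omega>))) \<le> V n \<omega>"
      unfolding e1 e2 e3 V_def using e4 e5 e6 e7 by linarith
    then show "(\<Sum>v\<le>n. f (vdepth v \<omega>) / Z n \<omega> * G \<omega> (Suc (vdepth v \<omega>))) \<le> V n \<omega>"
      by (simp add: w_def)
  qed
qed

end

section \<open>Local uniform convergence and decay off the real axis\<close>

text \<open>The intersection of all \<open>E m\<close> with \<open>m \<ge> N\<close> is no more
  likely than any single one of them. Avoiding one of the events is enough here, so mere convergence
  of the probabilities is the right assumption.\<close>

lemma (in prob_space) AE_ex_not_in:
  fixes E :: "nat \<Rightarrow> 'a set"
  assumes E: "\<And>m. E m \<in> sets M" and lim: "(\<lambda>m. prob (E m)) \<longlonglongrightarrow> 0"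
  shows "AE \<omega> in M. \<exists>m\<ge>N. \<omega> \<notin> E m"
proof -
  define F where "F = (\<Inter>m\<in>{N..}. E m)"
  have F: "F \<in> sets M" unfolding F_def by (intro sets.countable_INT') (auto simp: E)
  have "prob F \<le> prob (E m)" if "m \<ge> N" for m
    by (intro finite_measure_mono E) (use that in \<open>auto simp: F_def\<close>)
  then have "prob F \<le> 0" by (intro LIMSEQ_le_const[OF lim]) auto
  then have "prob F = 0" by (simp add: measure_le_0_iff)
  then have "F \<in> null_sets M" using F by (intro null_setsI) (auto simp: emeasure_eq_measure)
  then show ?thesis by (rule AE_mp[OF AE_not_in]) (auto simp: F_def)
qed

context bounded_rrt
begin

definition osc :: "real \<Rightarrow> (real \<Rightarrow> complex) \<Rightarrow> nat \<Rightarrow> nat \<Rightarrow> 'a \<Rightarrow> real" where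
  "osc p \<zeta> m n \<omega> = integral {0..1} (\<lambda>t. norm (\<Phi> n (\<zeta> t) \<omega> / Q n (\<zeta> t) \<omega> - \<Phi> m (\<zeta> t) \<omega> / Q m (\<zeta> t) \<omega>) powr p)"

lemma adapted_osc: "m \<le> n \<Longrightarrow> adapted n (osc p \<zeta> m n)"
proof -
  assume mn: "m \<le> n"
  have "adapted n (\<lambda>\<omega>. \<Phi> n (\<zeta> t) \<omega> / Q n (\<zeta> t) \<omega> - \<Phi> m (\<zeta> t) \<omega> / Q m (\<zeta> t) \<omega>)" for t
    by (intro adapted_compose2[of n _ _ "(-)"] adapted_compose2[of n _ _ "(/)"] adapted_\<Phi> adapted_Q) (use mn in auto)
  then have "adapted n (\<lambda>\<omega> t. norm (\<Phi> n (\<zeta> t) \<omega> / Q n (\<zeta> t) \<omega> - \<Phi> m (\<zeta> t) \<omega> / Q m (\<zeta> t) \<omega>) powr p)"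
    by (intro adapted_fun adapted_compose[where g = "\<lambda>x. norm x powr p"])
  then show ?thesis unfolding osc_def[abs_def] by (rule adapted_compose)
qed

text \<open>At time \<open>m\<close> the oscillation is 0, so only the term with \<open>R\<close> is
  left in the maximal inequality. The weight \<open>G\<close>, known at time \<open>m\<close>, makes
  it possible to measure the oscillation against a random scale.\<close>

lemma oscillation_probability:
  fixes \<zeta> :: "real \<Rightarrow> complex"
  assumes p: "1 < p" "p \<le> 2" and r: "r > 0" and y: "exp y < p * r" and C: "C \<ge> 0"
    and \<zeta>: "continuous_on {0..1} \<zeta>" "\<And>t. t \<in> {0..1} \<Longrightarrow> r \<le> Re (exp (\<zeta> t))"
    and B: "\<And>t k. t \<in> {0..1} \<Longrightarrow> norm (vterm (\<zeta> t) k) powr p \<le> C * rterm y k"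
    and m: "m \<ge> n0" and G: "adapted m G" "\<And>\<omega>. 0 \<le> G \<omega>" and l: "l \<ge> 0"
  shows "l * prob {\<omega> \<in> space M. \<exists>n\<ge>m. l \<le> G \<omega> * osc p \<zeta> m n \<omega>}
    \<le> 6 * C * exp y / (p * r - exp y) * expectation (\<lambda>\<omega>. G \<omega> * R y r p m \<omega>)"
proof -
  define D where "D = 6 * C * exp y / (p * r - exp y)"
  have D: "D \<ge> 0" unfolding D_def using C y by simp
  define g where "g = (\<lambda>n \<omega> t. Q n (\<zeta> t) \<omega>)"
  define a where "a = (\<lambda>\<omega> t. \<Phi> m (\<zeta> t) \<omega> / Q m (\<zeta> t) \<omega>)"
  define V where "V = (\<lambda>n \<omega>. integral {0..1} (\<lambda>t. norm (\<Phi> n (\<zeta> t) \<omega> / g n \<omega> t - a \<omega> t) powr p) + D * R y r p n \<omega>)"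
  have Vosc: "V n \<omega> = osc p \<zeta> m n \<omega> + D * R y r p n \<omega>" for n \<omega> by (simp add: V_def osc_def g_def a_def)
  have gq: "q n r \<omega> \<le> norm (g n \<omega> t)" if "n \<ge> m" "t \<in> {0..1}" for n \<omega> t
    unfolding g_def using norm_Q_ge[OF _ \<zeta>(2)[OF that(2)]] r by simp
  have g0: "Q n (\<zeta> t) \<omega> \<noteq> 0" if "t \<in> {0..1}" for n \<omega> t
    using norm_Q_ge[OF _ \<zeta>(2)[OF that], of n \<omega>] q_pos[of r n \<omega>] r by auto
  have gc: "continuous_on {0..1} (\<lambda>t. Q n (\<zeta> t) \<omega>)" for n \<omega>
    by (rule continuous_on_compose2[OF continuous_Q[of UNIV] \<zeta>(1)]) auto
  have c\<Phi>: "continuous_on {0..1} (\<lambda>t. \<Phi> n (\<zeta> t) \<omega>)" for n \<omega>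
    by (rule continuous_on_compose2[OF continuous_\<Phi>[of UNIV] \<zeta>(1)]) auto
  have mean: "norm (\<Phi> n (\<zeta> t) \<omega> * (1 + exp (\<zeta> t) / Z n \<omega>) / g (Suc n) \<omega> t - a \<omega> t) \<le> norm (\<Phi> n (\<zeta> t) \<omega> / g n \<omega> t - a \<omega> t)"
    if n: "n \<ge> m" and t: "t \<in> {0..1}" for n \<omega> t
  proof -
    have eq: "g (Suc n) \<omega> t = g n \<omega> t * (1 + exp (\<zeta> t) / Z n \<omega>)" unfolding g_def using n m by (simp add: Q_Suc)
    moreover have "g (Suc n) \<omega> t \<noteq> 0" using g0[OF t] by (simp add: g_def)
    ultimately have "1 + exp (\<zeta> t) / Z n \<omega> \<noteq> 0" by auto
    then show ?thesis unfolding eq by simp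
  qed
  have ac: "continuous_on {0..1} (a \<omega>)" for \<omega> unfolding a_def by (intro continuous_intros c\<Phi> gc ballI g0)
  have ga: "adapted n (g n)" "adapted n (g (Suc n))" if "n \<ge> m" for n
    unfolding g_def by (intro adapted_fun adapted_Q; simp)+
  have aa: "adapted m a" unfolding a_def
    by (intro adapted_fun adapted_compose2[of m _ _ "(/)"] adapted_\<Phi> adapted_Q) auto
  have gc': "continuous_on {0..1} (g n \<omega>)" if "n \<ge> m" for n \<omega> using gc by (simp add: g_def)
  have adV: "adapted n (V n)" if "n \<ge> m" for n unfolding V_def D_def by (rule contour_supermartingale(1)[of p r y C \<zeta> m g a]; fact)
  have nnV: "0 \<le> V n \<omega>" if "n \<ge> m" for n \<omega> unfolding V_def D_def by (rule contour_supermartingale(2)[of p r y C \<zeta> m g a]; fact)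
  have superV: "expectation (\<lambda>\<omega>. Y \<omega> * V (Suc n) \<omega>) \<le> expectation (\<lambda>\<omega>. Y \<omega> * V n \<omega>)"
    if "n \<ge> m" "adapted n Y" "\<And>\<omega>. 0 \<le> Y \<omega>" for n and Y :: "'a \<Rightarrow> real"
    unfolding V_def D_def by (rule contour_supermartingale(3)[of p r y C \<zeta> m g a]; fact)
  have adGV: "adapted n (\<lambda>\<omega>. G \<omega> * V n \<omega>)" if "n \<ge> m" for n
    by (rule adapted_compose2[OF adapted_mono[OF G(1) that] adV[OF that]])
  have max: "l * prob {\<omega> \<in> space M. \<exists>n\<ge>m. l \<le> G \<omega> * V n \<omega>} \<le> expectation (\<lambda>\<omega>. G \<omega> * V m \<omega>)"
  proof (rule supermartingale_maximal_inequality[OF adGV _ _ l])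
    show "0 \<le> G \<omega> * V n \<omega>" if "n \<ge> m" for n \<omega> using G nnV[OF that] by simp
    fix n and Y :: "'a \<Rightarrow> real" assume n: "n \<ge> m" and Y: "adapted n Y" "\<And>\<omega>. 0 \<le> Y \<omega>"
    have "expectation (\<lambda>\<omega>. (Y \<omega> * G \<omega>) * V (Suc n) \<omega>) \<le> expectation (\<lambda>\<omega>. (Y \<omega> * G \<omega>) * V n \<omega>)"
      by (rule superV[OF n adapted_compose2[OF Y(1) adapted_mono[OF G(1) n]]]) (simp add: Y G)
    then show "expectation (\<lambda>\<omega>. Y \<omega> * (G \<omega> * V (Suc n) \<omega>)) \<le> expectation (\<lambda>\<omega>. Y \<omega> * (G \<omega> * V n \<omega>))"
      by (simp add: mult.assoc)
  qed
  have "osc p \<zeta> m m \<omega> = 0" for \<omega> by (simp add: osc_def)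
  then have "expectation (\<lambda>\<omega>. G \<omega> * V m \<omega>) = D * expectation (\<lambda>\<omega>. G \<omega> * R y r p m \<omega>)"
    unfolding Vosc by (simp add: mult.left_commute)
  moreover have "prob {\<omega> \<in> space M. \<exists>n\<ge>m. l \<le> G \<omega> * osc p \<zeta> m n \<omega>} \<le> prob {\<omega> \<in> space M. \<exists>n\<ge>m. l \<le> G \<omega> * V n \<omega>}"
  proof (rule finite_measure_mono)
    have "G \<omega> * osc p \<zeta> m n \<omega> \<le> G \<omega> * V n \<omega>" for n \<omega>
      unfolding Vosc using G(2) D R_nonneg by (intro mult_left_mono) auto
    then show "{\<omega> \<in> space M. \<exists>n\<ge>m. l \<le> G \<omega> * osc p \<zeta> m n \<omega>} \<subseteq> {\<omega> \<in> space M. \<exists>n\<ge>m. l \<le> G \<omega> * V n \<omega>}"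
      using order_trans by blast
    show "{\<omega> \<in> space M. \<exists>n\<ge>m. l \<le> G \<omega> * V n \<omega>} \<in> sets M" by (rule adapted_seq_event[OF adGV])
  qed
  ultimately show ?thesis using max l mult_left_mono unfolding D_def by (smt (verit))
qed

text \<open>The probability of a late oscillation tends to 0 with the mean of \<open>R\<close>. For
  each level some restart time is therefore almost surely successful, and the levels
  \<open>1 / Suc j\<close> suffice.\<close>

lemma AE_oscillation_small:
  fixes \<zeta> :: "real \<Rightarrow> complex"
  assumes p: "1 < p" "p \<le> 2" and r: "r > 0" and y: "exp y < p * r" and C: "C \<ge> 0"
    and \<zeta>: "continuous_on {0..1} \<zeta>" "\<And>t. t \<in> {0..1} \<Longrightarrow> r \<le> Re (exp (\<zeta> t))"
    and B: "\<And>t k. t \<in> {0..1} \<Longrightarrow> norm (vterm (\<zeta> t) k) powr p \<le> C * rterm y k"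
  shows "AE \<omega> in M. \<forall>l>0. \<exists>m\<ge>n0. \<forall>n\<ge>m. osc p \<zeta> m n \<omega> < l"
proof -
  have "AE \<omega> in M. \<exists>m\<ge>n0. \<forall>n\<ge>m. osc p \<zeta> m n \<omega> < l" if l: "l > 0" for l
  proof -
    define E where "E = (\<lambda>m. {\<omega> \<in> space M. \<exists>n\<ge>m. l \<le> osc p \<zeta> m n \<omega>})"
    have E: "E m \<in> sets M" for m unfolding E_def by (rule adapted_seq_event[OF adapted_osc])
    define D where "D = 6 * C * exp y / (p * r - exp y)"
    have le: "prob (E m) \<le> D / l * expectation (R y r p m)" if "m \<ge> n0" for m
    proof -
      have "l * prob (E m) \<le> D * expectation (R y r p m)"
        using oscillation_probability[OF p r y C \<zeta> B that adapted_const[of m 1], of l] l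
        by (simp add: E_def D_def)
      then show ?thesis using l by (simp add: field_simps)
    qed
    have "(\<lambda>m. D / l * expectation (R y r p m)) \<longlonglongrightarrow> D / l * 0"
      by (intro tendsto_intros expectation_R_tendsto_0 p r y)
    then have lim: "(\<lambda>m. D / l * expectation (R y r p m)) \<longlonglongrightarrow> 0" by simp
    have "(\<lambda>m. prob (E m)) \<longlonglongrightarrow> 0"
    proof (rule tendsto_sandwich[OF _ _ tendsto_const lim])
      show "\<forall>\<^sub>F m in sequentially. prob (E m) \<le> D / l * expectation (R y r p m)"
        using eventually_ge_at_top[of n0] by eventually_elim (rule le)
    qed auto
    from AE_ex_not_in[of E, OF E this, of n0] AE_space show ?thesis
      by eventually_elim (simp add: E_def not_le, meson leD)
  qed
  then have "AE \<omega> in M. \<forall>j::nat. \<exists>m\<ge>n0. \<forall>n\<ge>m. osc p \<zeta> m n \<omega> < 1 / real (Suc j)"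
    unfolding AE_all_countable by simp
  then show ?thesis
  proof eventually_elim
    case (elim \<omega>)
    show ?case
    proof (intro allI impI)
      fix l :: real assume "l > 0"
      then obtain j :: nat where j: "1 / real (Suc j) < l" using reals_Archimedean by (metis inverse_eq_divide)
      obtain m where "m \<ge> n0" "\<forall>n\<ge>m. osc p \<zeta> m n \<omega> < 1 / real (Suc j)" using elim by blast
      then show "\<exists>m\<ge>n0. \<forall>n\<ge>m. osc p \<zeta> m n \<omega> < l" using j by (meson less_trans)
    qed
  qed
qed

text \<open>The moment condition and \<open>Re (exp w) > r\<close> are open and persist on a disc
  around \<open>x\<close>. Cauchy's formula then turns a small oscillation on the boundary circle
  into a uniformly small one on the disc of half the radius.\<close>

lemma martingale_locally_uniformly_Cauchy:
  fixes x :: real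
  assumes x: "x < 1"
  shows "\<exists>s>0. (\<forall>w\<in>cball (complex_of_real x) s. Re (exp w) > 0) \<and>
    (AE \<omega> in M. uniformly_Cauchy_on (cball (complex_of_real x) s) (\<lambda>n z. \<Phi> n z \<omega> / Q n z \<omega>))"
proof -
  obtain p e where p: "1 < p" "p \<le> 2" and e: "e > 0" and less: "exp (p * x + (p - 1) * e) < p * exp x"
    using exists_moment_exponent[OF x] .
  \<comment> \<open>A number strictly in between, so that \<open>Re (exp w) > r\<close> and the
    moment condition relative to \<open>r\<close> both leave room for moving
    \<open>w\<close>.\<close>
  obtain r where r1: "exp (p * x + (p - 1) * e) / p < r" "r < exp x"
    using less p dense[of "exp (p * x + (p - 1) * e) / p" "exp x"] by (auto simp: field_simps)
  have r: "r > 0" using r1(1) p by (smt (verit) divide_pos_pos exp_gt_zero)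
  define x' where "x' = complex_of_real x"
  have "((\<lambda>w. Re (exp w)) \<longlongrightarrow> Re (exp x')) (nhds x')" by (intro tendsto_intros filterlim_ident)
  then have ev1: "\<forall>\<^sub>F w in nhds x'. r < Re (exp w)" by (rule order_tendstoD) (use r1 in \<open>simp add: x'_def Re_exp\<close>)
  have "((\<lambda>w. exp (p * Re w + (p - 1) * e)) \<longlongrightarrow> exp (p * Re x' + (p - 1) * e)) (nhds x')"
    by (intro tendsto_intros filterlim_ident)
  then have ev2: "\<forall>\<^sub>F w in nhds x'. exp (p * Re w + (p - 1) * e) < p * r"
    by (rule order_tendstoD) (use r1 p in \<open>simp add: x'_def field_simps\<close>)
  from eventually_conj[OF ev1 ev2] obtain d where d: "d > 0"
    "\<And>w. dist w x' < d \<Longrightarrow> r < Re (exp w) \<and> exp (p * Re w + (p - 1) * e) < p * r"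
    unfolding eventually_nhds_metric by blast
  define s where "s = d / 2"
  have s: "s > 0" "s < d" using d by (auto simp: s_def)
  have disc: "r < Re (exp w)" "p * Re w + (p - 1) * e \<le> p * (x + s) + (p - 1) * e" if "w \<in> cball x' s" for w
  proof -
    have "dist w x' < d" using that s by (simp add: dist_commute)
    then show "r < Re (exp w)" using d by blast
    have "Re w - x \<le> norm (w - x')" using complex_Re_le_cmod[of "w - x'"] by (simp add: x'_def)
    then show "p * Re w + (p - 1) * e \<le> p * (x + s) + (p - 1) * e" using that p by (simp add: dist_norm norm_minus_commute)
  qed
  \<comment> \<open>The moment exponent at the rightmost point of the disc, where it is
    largest.\<close>
  define y where "y = p * (x + s) + (p - 1) * e"
  have "dist (complex_of_real (x + s)) x' < d" using s by (simp add: x'_def dist_norm)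
  then have y: "exp y < p * r" using d(2)[of "complex_of_real (x + s)"] by (simp add: y_def)
  obtain C where C: "C > 0" "\<And>y z k. p * Re z + (p - 1) * e \<le> y \<Longrightarrow> norm (vterm z k) powr p \<le> C * rterm y k"
    using vterm_powr_bound[OF p(1) e] by blast
  define \<zeta> where "\<zeta> = (\<lambda>t::real. x' + s * exp (2 * pi * \<i> * t))"
  have \<zeta>c: "continuous_on {0..1} \<zeta>" unfolding \<zeta>_def by (intro continuous_intros)
  have \<zeta>d: "\<zeta> t \<in> cball x' s" for t using s by (simp add: \<zeta>_def dist_norm norm_mult)
  have B: "norm (vterm (\<zeta> t) k) powr p \<le> C * rterm y k" for t k
    using disc(2)[OF \<zeta>d] by (intro C) (simp add: y_def)
  have "AE \<omega> in M. \<forall>l>0. \<exists>m\<ge>n0. \<forall>n\<ge>m. osc p \<zeta> m n \<omega> < l"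
    by (rule AE_oscillation_small[OF p r y _ \<zeta>c _ B]) (use C disc(1)[OF \<zeta>d] in \<open>auto intro: less_imp_le\<close>)
  then have "AE \<omega> in M. uniformly_Cauchy_on (cball x' (s / 2)) (\<lambda>n z. \<Phi> n z \<omega> / Q n z \<omega>)"
  proof eventually_elim
    case (elim \<omega>)
    have Q0: "Q n w \<omega> \<noteq> 0" if "w \<in> cball x' s" for n w
      using norm_Q_ge[of r w n \<omega>] q_pos[of r n \<omega>] disc(1)[OF that] r by auto
    show ?case
    proof (rule uniformly_Cauchy_onI)
      fix \<epsilon> :: real assume \<epsilon>: "\<epsilon> > 0"
      \<comment> \<open>An oscillation below \<open>\<eta> powr p\<close> gives a distance of at
        most \<open>4 * \<eta>\<close> to the value at time \<open>m\<close>, and two such distances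
        add up to \<open>\<epsilon> / 2\<close>.\<close>
      define \<eta> where "\<eta> = \<epsilon> / 16"
      have \<eta>: "\<eta> > 0" using \<epsilon> by (simp add: \<eta>_def)
      obtain m where m: "\<And>n. n \<ge> m \<Longrightarrow> osc p \<zeta> m n \<omega> < \<eta> powr p" using elim \<eta> by (metis powr_gt_zero less_irrefl)
      have key: "norm (\<Phi> n w \<omega> / Q n w \<omega> - \<Phi> m w \<omega> / Q m w \<omega>) \<le> 4 * \<eta>" if n: "n \<ge> m" and w: "w \<in> cball x' (s / 2)" for n w
      proof -
        define g where "g = (\<lambda>w. \<Phi> n w \<omega> / Q n w \<omega> - \<Phi> m w \<omega> / Q m w \<omega>)"
        have cg: "continuous_on (cball x' s) g" unfolding g_def
          by (intro continuous_intros continuous_\<Phi> continuous_Q ballI Q0)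
        have hg: "g holomorphic_on ball x' s" unfolding g_def
          by (intro holomorphic_intros holomorphic_\<Phi> holomorphic_Q Q0) auto
        have "norm (g w) \<le> 2 * (\<eta> + \<eta> powr (1 - p) * integral {0..1} (\<lambda>t::real. norm (g (x' + s * exp (2 * pi * \<i> * t))) powr p))"
          by (rule norm_le_circle_integral_powr[OF cg hg s(1) w p(1) \<eta>])
        also have "integral {0..1} (\<lambda>t::real. norm (g (x' + s * exp (2 * pi * \<i> * t))) powr p) = osc p \<zeta> m n \<omega>"
          by (simp add: osc_def g_def \<zeta>_def)
        also have "2 * (\<eta> + \<eta> powr (1 - p) * osc p \<zeta> m n \<omega>) \<le> 2 * (\<eta> + \<eta> powr (1 - p) * \<eta> powr p)"
          using m[OF n] by (intro mult_left_mono add_left_mono) auto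
        also have "\<dots> = 4 * \<eta>" using \<eta> by (simp flip: powr_add)
        finally show ?thesis by (simp add: g_def)
      qed
      show "\<exists>N. \<forall>w\<in>cball x' (s / 2). \<forall>n\<ge>N. \<forall>n'\<ge>N. dist (\<Phi> n w \<omega> / Q n w \<omega>) (\<Phi> n' w \<omega> / Q n' w \<omega>) < \<epsilon>"
      proof (intro exI ballI allI impI)
        fix w n n' assume w: "w \<in> cball x' (s / 2)" and n: "m \<le> n" "m \<le> n'"
        have "dist (\<Phi> n w \<omega> / Q n w \<omega>) (\<Phi> n' w \<omega> / Q n' w \<omega>) \<le>
           dist (\<Phi> n w \<omega> / Q n w \<omega>) (\<Phi> m w \<omega> / Q m w \<omega>) + dist (\<Phi> n' w \<omega> / Q n' w \<omega>) (\<Phi> m w \<omega> / Q m w \<omega>)"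
          by (rule dist_triangle2)
        also have "\<dots> \<le> 4 * \<eta> + 4 * \<eta>" using key[OF n(1) w] key[OF n(2) w] by (simp add: dist_norm)
        also have "\<dots> < \<epsilon>" using \<epsilon> by (simp add: \<eta>_def)
        finally show "dist (\<Phi> n w \<omega> / Q n w \<omega>) (\<Phi> n' w \<omega> / Q n' w \<omega>) < \<epsilon>" .
      qed
    qed
  qed
  moreover have "\<forall>w\<in>cball x' (s / 2). Re (exp w) > 0"
    using disc(1) r s by (smt (verit) mem_cball field_sum_of_halves)
  ultimately show ?thesis using s(1) by (intro exI[of _ "s / 2"]) (simp add: x'_def)
qed

text \<open>Off the axis the conditional mean grows in norm only at a rate near
  \<open>Re (exp z0)\<close>, strictly below \<open>exp (Re z0)\<close>. Normalising by
  \<open>q\<close> at a rate \<open>\<kappa>\<close> in between gives a supermartingale. Since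
  \<open>\<kappa>\<close> must also satisfy the moment condition, it is taken above the maximum
  \<open>\<kappa>0\<close>.\<close>

lemma off_axis_bound:
  fixes z0 :: complex
  assumes x: "Re z0 < 1" and off: "Re (exp z0) < exp (Re z0)"
  shows "\<exists>s>0. \<exists>\<kappa>. (\<forall>w\<in>cball z0 s. \<kappa> < exp (Re w)) \<and>
    (AE \<omega> in M. \<exists>C. \<forall>\<^sub>F n in sequentially. \<forall>w\<in>cball z0 s. norm (\<Phi> n w \<omega>) \<le> C * exp (\<kappa> * h n \<omega>))"
proof -
  define x where "x = Re z0"
  obtain p e where p: "1 < p" "p \<le> 2" and e: "e > 0" and less: "exp (p * x + (p - 1) * e) < p * exp x"
    using exists_moment_exponent[of x] assms(1) unfolding x_def by blast
  define \<kappa>0 where "\<kappa>0 = max (Re (exp z0)) (exp (p * x + (p - 1) * e) / p)"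
  have "\<kappa>0 < exp x" using off less p by (auto simp: \<kappa>0_def x_def field_simps)
  then obtain \<kappa> where \<kappa>: "\<kappa>0 < \<kappa>" "\<kappa> < exp x" using dense by blast
  \<comment> \<open>\<open>\<kappa>'\<close> bounds \<open>Re (exp w)\<close> on the disc. The gap
    to \<open>\<kappa>\<close> pays for the second-order term in
    \<open>norm_one_plus_le\<close>.\<close>
  obtain \<kappa>' where \<kappa>': "\<kappa>0 < \<kappa>'" "\<kappa>' < \<kappa>" using \<kappa>(1) dense by blast
  have \<kappa>pos: "\<kappa> > 0" using \<kappa> p unfolding \<kappa>0_def by (smt (verit) divide_pos_pos exp_gt_zero)
  have "((\<lambda>w. Re (exp w)) \<longlongrightarrow> Re (exp z0)) (nhds z0)" by (intro tendsto_intros filterlim_ident)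
  then have ev1: "\<forall>\<^sub>F w in nhds z0. Re (exp w) < \<kappa>'" by (rule order_tendstoD) (use \<kappa>' in \<open>simp add: \<kappa>0_def\<close>)
  have "((\<lambda>w. exp (p * Re w + (p - 1) * e)) \<longlongrightarrow> exp (p * Re z0 + (p - 1) * e)) (nhds z0)"
    by (intro tendsto_intros filterlim_ident)
  then have ev2: "\<forall>\<^sub>F w in nhds z0. exp (p * Re w + (p - 1) * e) < p * \<kappa>"
    by (rule order_tendstoD) (use \<kappa> p in \<open>simp add: \<kappa>0_def x_def field_simps\<close>)
  have "((\<lambda>w. exp (Re w)) \<longlongrightarrow> exp (Re z0)) (nhds z0)" by (intro tendsto_intros filterlim_ident)
  then have ev3: "\<forall>\<^sub>F w in nhds z0. \<kappa> < exp (Re w)" by (rule order_tendstoD) (use \<kappa> in \<open>simp add: x_def\<close>)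
  from eventually_conj[OF ev1 eventually_conj[OF ev2 ev3]] obtain d where d: "d > 0"
    "\<And>w. dist w z0 < d \<Longrightarrow> Re (exp w) < \<kappa>' \<and> exp (p * Re w + (p - 1) * e) < p * \<kappa> \<and> \<kappa> < exp (Re w)"
    unfolding eventually_nhds_metric by blast
  define s where "s = d / 2"
  have s: "s > 0" "s < d" using d by (auto simp: s_def)
  have disc: "Re (exp w) < \<kappa>'" "\<kappa> < exp (Re w)" "Re w \<le> x + s" if "w \<in> cball z0 s" for w
  proof -
    have "dist w z0 < d" using that s by (simp add: dist_commute)
    then show "Re (exp w) < \<kappa>'" "\<kappa> < exp (Re w)" using d by blast+
    have "Re w - x \<le> norm (w - z0)" using complex_Re_le_cmod[of "w - z0"] by (simp add: x_def)
    then show "Re w \<le> x + s" using that by (simp add: dist_norm norm_minus_commute)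
  qed
  define y where "y = p * (x + s) + (p - 1) * e"
  have "dist (z0 + complex_of_real s) z0 < d" using s by (simp add: dist_norm)
  then have y: "exp y < p * \<kappa>" using d(2)[of "z0 + complex_of_real s"] by (simp add: y_def x_def)
  obtain C where C: "C > 0" "\<And>y z k. p * Re z + (p - 1) * e \<le> y \<Longrightarrow> norm (vterm z k) powr p \<le> C * rterm y k"
    using vterm_powr_bound[OF p(1) e] by blast
  define \<zeta> where "\<zeta> = (\<lambda>t::real. z0 + s * exp (2 * pi * \<i> * t))"
  have \<zeta>c: "continuous_on {0..1} \<zeta>" unfolding \<zeta>_def by (intro continuous_intros)
  have \<zeta>d: "\<zeta> t \<in> cball z0 s" for t using s by (simp add: \<zeta>_def dist_norm norm_mult)
  have B: "norm (vterm (\<zeta> t) k) powr p \<le> C * rterm y k" for t k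
    using disc(3)[OF \<zeta>d] p by (intro C) (simp add: y_def)
  \<comment> \<open>From this time on the lower bound for \<open>Z n\<close> makes the gap
    sufficient on the whole disc, where the norm of \<open>exp w\<close> is at most
    \<open>exp (x + s)\<close>.\<close>
  obtain m0 where m0: "real m0 \<ge> (exp (x + s))\<^sup>2 / (2 * (\<kappa> - \<kappa>') * c)" using real_arch_simple by blast
  define m where "m = max m0 n0"
  have m: "m \<ge> n0" by (simp add: m_def)
  have Zbig: "(exp (x + s))\<^sup>2 \<le> 2 * (\<kappa> - \<kappa>') * Z n \<omega>" if "n \<ge> m" for n \<omega>
  proof -
    have pos: "2 * (\<kappa> - \<kappa>') * c > 0" using \<kappa>' c_pos by simp
    then have "(exp (x + s))\<^sup>2 \<le> 2 * (\<kappa> - \<kappa>') * c * real m0" using m0 by (simp add: field_simps)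
    also have "\<dots> \<le> 2 * (\<kappa> - \<kappa>') * c * real (Suc n)" using that pos by (intro mult_left_mono) (auto simp: m_def)
    also have "\<dots> \<le> 2 * (\<kappa> - \<kappa>') * Z n \<omega>" using Z_lower[of n \<omega>] \<kappa>' by (simp add: mult.assoc mult_left_mono)
    finally show ?thesis .
  qed
  define g where "g = (\<lambda>n \<omega> (t::real). complex_of_real (q n \<kappa> \<omega>))"
  define a where "a = (\<lambda>(\<omega>::'a) (t::real). 0 :: complex)"
  define D where "D = 6 * C * exp y / (p * \<kappa> - exp y)"
  define V where "V = (\<lambda>n \<omega>. integral {0..1} (\<lambda>t. norm (\<Phi> n (\<zeta> t) \<omega> / g n \<omega> t - a \<omega> t) powr p) + D * R y \<kappa> p n \<omega>)"
  have qp: "q n \<kappa> \<omega> > 0" for n \<omega> using q_pos[of \<kappa> n \<omega>] \<kappa>pos by simp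
  have mean: "norm (\<Phi> n (\<zeta> t) \<omega> * (1 + exp (\<zeta> t) / Z n \<omega>) / g (Suc n) \<omega> t - a \<omega> t) \<le> norm (\<Phi> n (\<zeta> t) \<omega> / g n \<omega> t - a \<omega> t)"
    if n: "n \<ge> m" and "t \<in> {0..1}" for n \<omega> t
  proof -
    have "norm (exp (\<zeta> t)) \<le> exp (x + s)" using disc(3)[OF \<zeta>d] by simp
    then have "(norm (exp (\<zeta> t)))\<^sup>2 \<le> (exp (x + s))\<^sup>2" by (intro power_mono) auto
    then have sq: "(norm (exp (\<zeta> t)))\<^sup>2 \<le> 2 * (\<kappa> - \<kappa>') * Z n \<omega>" using Zbig[OF n, of \<omega>] by linarith
    have le: "norm (1 + exp (\<zeta> t) / Z n \<omega>) \<le> 1 + \<kappa> / Z n \<omega>"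
      by (rule norm_one_plus_le[of _ \<kappa>', OF _ _ _ Z_pos sq]) (use disc(1)[OF \<zeta>d[of t]] \<kappa>' \<kappa>pos in auto)
    have eq: "q (Suc n) \<kappa> \<omega> = q n \<kappa> \<omega> * (1 + \<kappa> / Z n \<omega>)" using n m by (simp add: q_Suc)
    have pos: "1 + \<kappa> / Z n \<omega> > 0" using \<kappa>pos Z_pos[of n \<omega>] by (simp add: add_pos_pos)
    have "norm (\<Phi> n (\<zeta> t) \<omega> * (1 + exp (\<zeta> t) / Z n \<omega>) / g (Suc n) \<omega> t - a \<omega> t) =
       norm (\<Phi> n (\<zeta> t) \<omega>) / q n \<kappa> \<omega> * (norm (1 + exp (\<zeta> t) / Z n \<omega>) / (1 + \<kappa> / Z n \<omega>))"
    proof -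
      have nq: "norm (complex_of_real (q (Suc n) \<kappa> \<omega>)) = q n \<kappa> \<omega> * (1 + \<kappa> / Z n \<omega>)"
        using qp[of "Suc n" \<omega>] eq by (simp only: norm_of_real abs_of_pos)
      show ?thesis by (simp only: g_def a_def diff_zero norm_divide norm_mult nq times_divide_times_eq)
    qed
    also have "\<dots> \<le> norm (\<Phi> n (\<zeta> t) \<omega>) / q n \<kappa> \<omega> * 1"
      using qp[of n \<omega>] le pos by (intro mult_left_mono) auto
    finally show ?thesis using qp[of n \<omega>] by (simp add: g_def a_def norm_divide)
  qed
  have gc: "continuous_on {0..1} (g n \<omega>)" if "n \<ge> m" for n \<omega> by (simp add: g_def)
  have C0: "C \<ge> 0" using C(1) by simp
  have B': "norm (vterm (\<zeta> t) k) powr p \<le> C * rterm y k" if "t \<in> {0..1}" for t k by (rule B)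
  have gq: "q n \<kappa> \<omega> \<le> norm (g n \<omega> t)" if "n \<ge> m" "t \<in> {0..1}" for n \<omega> t using qp[of n \<omega>] by (simp add: g_def)
  have ga: "adapted n (g n)" "adapted n (g (Suc n))" if "n \<ge> m" for n
    unfolding g_def by (intro adapted_fun adapted_compose[OF adapted_q]; simp)+
  have ac: "continuous_on {0..1} (a \<omega>)" for \<omega> by (simp add: a_def)
  have aa: "adapted m a" unfolding a_def by (rule adapted_const)
  have D: "D \<ge> 0" unfolding D_def using C y by simp
  have "AE \<omega> in M. \<exists>C. \<forall>n\<ge>m. V n \<omega> \<le> C"
  proof (rule supermartingale_AE_bounded)
    show "adapted n (V n)" if "n \<ge> m" for n unfolding V_def D_def by (rule contour_supermartingale(1)[of p \<kappa> y C \<zeta> m g a]; fact)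
    show "0 \<le> V n \<omega>" if "n \<ge> m" for n \<omega> unfolding V_def D_def by (rule contour_supermartingale(2)[of p \<kappa> y C \<zeta> m g a]; fact)
    show "expectation (\<lambda>\<omega>. Y \<omega> * V (Suc n) \<omega>) \<le> expectation (\<lambda>\<omega>. Y \<omega> * V n \<omega>)"
      if "n \<ge> m" "adapted n Y" "\<And>\<omega>. 0 \<le> Y \<omega>" for n and Y :: "'a \<Rightarrow> real"
      unfolding V_def D_def by (rule contour_supermartingale(3)[of p \<kappa> y C \<zeta> m g a]; fact)
  qed
  then have "AE \<omega> in M. \<exists>C. \<forall>\<^sub>F n in sequentially. \<forall>w\<in>cball z0 (s / 2). norm (\<Phi> n w \<omega>) \<le> C * exp (\<kappa> * h n \<omega>)"
  proof eventually_elim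
    case (elim \<omega>)
    then obtain B' where B': "\<And>n. n \<ge> m \<Longrightarrow> V n \<omega> \<le> B'" by blast
    have "norm (\<Phi> n w \<omega>) \<le> 2 * (1 + B') * exp (\<kappa> * h n \<omega>)" if n: "n \<ge> m" and w: "w \<in> cball z0 (s / 2)" for n w
    proof -
      define G where "G = (\<lambda>w. \<Phi> n w \<omega> / complex_of_real (q n \<kappa> \<omega>))"
      have q0: "complex_of_real (q n \<kappa> \<omega>) \<noteq> 0" using qp[of n \<omega>] by simp
      have cg: "continuous_on (cball z0 s) G" unfolding G_def
        by (intro continuous_intros continuous_\<Phi> ballI q0)
      have hg: "G holomorphic_on ball z0 s" unfolding G_def
        by (intro holomorphic_intros holomorphic_\<Phi> q0)
      have "norm (G w) \<le> 2 * (1 + 1 powr (1 - p) * integral {0..1} (\<lambda>t::real. norm (G (z0 + s * exp (2 * pi * \<i> * t))) powr p))"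
        by (rule norm_le_circle_integral_powr[OF cg hg s(1) w p(1)]) simp
      also have "integral {0..1} (\<lambda>t::real. norm (G (z0 + s * exp (2 * pi * \<i> * t))) powr p) = V n \<omega> - D * R y \<kappa> p n \<omega>"
        by (simp add: V_def G_def \<zeta>_def g_def a_def)
      also have "2 * (1 + 1 powr (1 - p) * (V n \<omega> - D * R y \<kappa> p n \<omega>)) \<le> 2 * (1 + B')"
      proof -
        have "2 * (1 + 1 powr (1 - p) * (v - t)) \<le> 2 * (1 + B')" if "v \<le> B'" "0 \<le> t" for v t
          using that by simp
        then show ?thesis using B'[OF n] mult_nonneg_nonneg[OF D R_nonneg[of y \<kappa> p n \<omega>]] by blast
      qed
      finally have 1: "norm (\<Phi> n w \<omega>) / q n \<kappa> \<omega> \<le> 2 * (1 + B')" using qp[of n \<omega>] by (simp add: G_def norm_divide)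
      then have "0 \<le> 2 * (1 + B')" using qp[of n \<omega>] by (smt (verit) divide_nonneg_pos norm_ge_zero)
      have "norm (\<Phi> n w \<omega>) \<le> 2 * (1 + B') * q n \<kappa> \<omega>" using 1 qp[of n \<omega>] by (simp add: field_simps)
      also have "\<dots> \<le> 2 * (1 + B') * exp (\<kappa> * h n \<omega>)"
        using \<open>0 \<le> 2 * (1 + B')\<close> \<kappa>pos by (intro mult_left_mono q_le_exp) auto
      finally show ?thesis .
    qed
    then show ?case by (intro exI[of _ "2 * (1 + B')"]) (auto intro: eventually_mono[OF eventually_ge_at_top[of m]])
  qed
  moreover have "\<forall>w\<in>cball z0 (s / 2). \<kappa> < exp (Re w)" using disc(2) s by auto
  ultimately show ?thesis using s(1) by (intro exI[of _ "s / 2"]) auto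
qed

end

section \<open>The limit and its positivity at 0\<close>

context bounded_rrt
begin

section \<open>Growth of the clock \<open>h n\<close> and of the depths\<close>

lemma h_le_ln: "n \<ge> n0 \<Longrightarrow> h n \<omega> \<le> ln (real n) / c"
proof (induction n rule: dec_induct)
  case base
  then show ?case using n0_pos c_pos by (simp add: h_def)
next
  case (step n)
  have n: "real n > 0" using step.hyps n0_pos by simp
  have "ln (real n / real (Suc n)) \<le> real n / real (Suc n) - 1" using n by (intro ln_le_minus_one) simp
  then have 1: "1 / real (Suc n) \<le> ln (real (Suc n)) - ln (real n)" using n by (simp add: ln_div field_simps)
  have "1 / Z n \<omega> \<le> 1 / (c * real (Suc n))"
    using Z_lower[of n \<omega>] c_pos Z_pos[of n \<omega>] by (intro divide_left_mono) auto
  also have "\<dots> = (1 / real (Suc n)) / c" by simp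
  also have "\<dots> \<le> (ln (real (Suc n)) - ln (real n)) / c" using 1 c_pos by (intro divide_right_mono) auto
  finally show ?case using step.IH h_Suc[OF step.hyps(1), of \<omega>] by (simp add: diff_divide_distrib)
qed

lemma h_at_top: "filterlim (\<lambda>n. h n \<omega>) at_top sequentially"
proof (rule filterlim_at_top_mono)
  have "filterlim (\<lambda>x::real. c * x) at_top at_top" using c_pos by real_asymp
  from filterlim_compose[OF this harmonic_tail_at_top[of n0]]
  show "filterlim (\<lambda>n. c * (\<Sum>k=n0..<n. 1 / real (Suc k))) at_top sequentially" .
  show "\<forall>\<^sub>F n in sequentially. c * (\<Sum>k=n0..<n. 1 / real (Suc k)) \<le> h n \<omega>"
  proof (intro always_eventually allI)
    fix n
    have "c * (1 / real (Suc k)) \<le> 1 / Z k \<omega>" for k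
      using Z_upper[of k \<omega>] Z_pos[of k \<omega>] c_pos by (simp add: field_simps del: of_nat_Suc)
    then show "c * (\<Sum>k=n0..<n. 1 / real (Suc k)) \<le> h n \<omega>"
      unfolding h_def sum_distrib_left by (intro sum_mono)
  qed
qed

text \<open>A single vertex at depth \<open>d\<close> contributes \<open>exp (d - S d)\<close> to
  \<open>\<phi> n 1\<close>. A parameter \<open>x > 0\<close> would bound depths by about
  \<open>exp x / x * h n\<close>; the value 1 minimises this and yields the constant
  \<open>exp 1\<close>.\<close>

lemma depth_bound:
  assumes C: "\<And>n. n \<ge> n0 \<Longrightarrow> \<phi> n 1 \<omega> \<le> C * exp (exp 1 * h n \<omega>)" and e: "0 < e"
  shows "\<exists>B. \<forall>n\<ge>n0. \<forall>v\<le>n. (1 - e) * real (vdepth v \<omega>) \<le> exp 1 * h n \<omega> + B"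
proof -
  obtain C' where C': "\<And>k. \<bar>S k\<bar> \<le> e * real k + C'" using sublinear_bound[OF S_lim e] by blast
  have "0 < C * exp (exp 1 * h n0 \<omega>)" using C[of n0] \<phi>_pos[of n0 1 \<omega>] by linarith
  then have Cpos: "C > 0" by (simp add: zero_less_mult_iff)
  have "(1 - e) * real (vdepth v \<omega>) \<le> exp 1 * h n \<omega> + (ln C + C')" if n: "n \<ge> n0" and v: "v \<le> n" for n v
  proof -
    have "rterm 1 (vdepth v \<omega>) \<le> \<phi> n 1 \<omega>" unfolding \<phi>_def
      by (rule member_le_sum[of v]) (use v rterm_pos in \<open>auto intro: less_imp_le\<close>)
    also have "\<dots> \<le> exp (ln C + exp 1 * h n \<omega>)" using C[OF n] Cpos by (simp add: exp_add)
    finally have "real (vdepth v \<omega>) - S (vdepth v \<omega>) \<le> ln C + exp 1 * h n \<omega>" by (simp add: rterm_def)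
    then show ?thesis using C'[of "vdepth v \<omega>"] by (simp add: algebra_simps)
  qed
  then show ?thesis by blast
qed

text \<open>Up to factors exponential in the maximal depth, \<open>\<phi> n x\<close> counts
  vertices. At parameter 0 and for depths of order \<open>ln n\<close>, these factors are small
  powers of \<open>n\<close>.\<close>

lemma \<phi>_bounds_of_depth:
  assumes S: "\<And>k. \<bar>S k\<bar> \<le> e * real k + C" and e: "e > 0" and D: "\<And>v. v \<le> n \<Longrightarrow> real (vdepth v \<omega>) \<le> D"
  shows "real (Suc n) * exp (- (e * D + C)) \<le> \<phi> n 0 \<omega>"
    and "0 \<le> x \<Longrightarrow> \<phi> n x \<omega> \<le> real (Suc n) * exp ((x + e) * D + C)"
proof -
  have ed: "e * real (vdepth v \<omega>) \<le> e * D" if "v \<le> n" for v using D[OF that] e by simp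
  have "(\<Sum>v\<le>n. exp (- (e * D + C))) \<le> \<phi> n 0 \<omega>" unfolding \<phi>_def
  proof (intro sum_mono)
    fix v assume "v \<in> {..n}"
    then show "exp (- (e * D + C)) \<le> rterm 0 (vdepth v \<omega>)"
      using ed[of v] S[of "vdepth v \<omega>"] by (simp add: rterm_def)
  qed
  then show "real (Suc n) * exp (- (e * D + C)) \<le> \<phi> n 0 \<omega>" by simp
  assume x: "0 \<le> x"
  have "\<phi> n x \<omega> \<le> (\<Sum>v\<le>n. exp ((x + e) * D + C))" unfolding \<phi>_def
  proof (intro sum_mono)
    fix v assume v: "v \<in> {..n}"
    have "x * real (vdepth v \<omega>) \<le> x * D" using D[of v] v x by (intro mult_left_mono) auto
    then show "rterm x (vdepth v \<omega>) \<le> exp ((x + e) * D + C)"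
      using ed[of v] S[of "vdepth v \<omega>"] v by (simp add: rterm_def algebra_simps)
  qed
  then show "\<phi> n x \<omega> \<le> real (Suc n) * exp ((x + e) * D + C)" by simp
qed

text \<open>Restarting at time \<open>m\<close>, the martingale at 0 loses half of its value \<open>\<phi> m 0 / q m 1\<close> with probability
  \<open>O(\<phi> m e / (\<phi> m 0)\<^sup>2)\<close>, which is at most \<open>O(m powr (-1/2))\<close> since depths are \<open>O(ln m)\<close> and \<open>S k = o(k)\<close>.\<close>

lemma AE_\<phi>_0_lower: "AE \<omega> in M. \<exists>b>0. \<forall>\<^sub>F n in sequentially. b * q n 1 \<omega> \<le> \<phi> n 0 \<omega>"
proof -
  \<comment> \<open>The bound \<open>1 / 4\<close> gives \<open>exp e < 2\<close>, the moment
    condition at 0 for \<open>p = 2\<close> and \<open>r = 1\<close>. The other one makes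
    \<open>4 * e\<close> times the depth constant \<open>2 * exp 1 / c\<close> at most
    \<open>1 / 4\<close>, so that the errors from \<open>S\<close> stay below
    \<open>sqrt N\<close>.\<close>
  define e where "e = min (1 / 4) (c / (32 * exp 1))"
  have e: "e > 0" "e \<le> 1 / 4" "e \<le> c / (32 * exp 1)" using c_pos by (auto simp: e_def)
  have "exp e \<le> exp (1 / 4)" using e by simp
  also have "\<dots> \<le> 1 + 1 / 4 + (1 / 4)\<^sup>2" by (rule exp_bound) auto
  also have "\<dots> < 2 * 1" by (simp add: power2_eq_square)
  finally have ye: "exp e < 2 * (1::real)" .
  obtain C' where C': "\<And>k. \<bar>S k\<bar> \<le> e * real k + C'" using sublinear_bound[OF S_lim e(1)] by blast
  obtain K where K: "K > 0" "\<And>y z k. 2 * Re z + (2 - 1) * e \<le> y \<Longrightarrow> norm (vterm z k) powr 2 \<le> K * rterm y k"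
    using vterm_powr_bound[of 2 e] e by auto
  define A where "A = (\<lambda>m \<omega>. \<phi> m e \<omega> * sqrt (real (Suc m)) \<le> (\<phi> m 0 \<omega>)\<^sup>2)"
  \<comment> \<open>The inverse square of the martingale at time \<open>m\<close>, which makes the
    oscillation a relative one. The indicator is known at time \<open>m\<close> and bounds
    \<open>G m * R\<close> by \<open>1 / sqrt (Suc m)\<close>; that \<open>A m\<close> holds for all
    large \<open>m\<close> is shown path by path below.\<close>
  define G where "G = (\<lambda>m \<omega>. of_bool (A m \<omega>) * (q m 1 \<omega> / \<phi> m 0 \<omega>)\<^sup>2)"
  \<comment> \<open>On a constant path the integral of the \<open>p\<close>-th power is just the
    squared deviation at the point 0.\<close>
  define \<zeta> where "\<zeta> = (\<lambda>t::real. 0::complex)"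
  have osc_eq: "osc 2 \<zeta> m n \<omega> = (\<phi> n 0 \<omega> / q n 1 \<omega> - \<phi> m 0 \<omega> / q m 1 \<omega>)\<^sup>2" for m n \<omega>
    using \<Phi>_of_real[of n 0 \<omega>] \<Phi>_of_real[of m 0 \<omega>] Q_of_real[of n 0 \<omega>] Q_of_real[of m 0 \<omega>]
    by (simp add: osc_def \<zeta>_def flip: of_real_divide of_real_diff)
  have adA: "adapted m (A m)" for m unfolding A_def
    by (rule adapted_compose2[OF adapted_\<phi>[OF order_refl] adapted_\<phi>[OF order_refl]])
  have adG: "adapted m (G m)" for m unfolding G_def
    by (rule adapted_compose2[OF adA adapted_compose2[OF adapted_q adapted_\<phi>]]) auto
  have GR: "G m \<omega> * R e 1 2 m \<omega> \<le> 1 / sqrt (real (Suc m))" for m \<omega>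
  proof (cases "A m \<omega>")
    case True
    have q: "q m 1 \<omega> > 0" and f: "\<phi> m 0 \<omega> > 0" by (auto simp: q_pos \<phi>_pos)
    have "G m \<omega> * R e 1 2 m \<omega> = \<phi> m e \<omega> / (\<phi> m 0 \<omega>)\<^sup>2"
      using True q by (simp add: G_def R_def power_divide)
    also have "\<dots> \<le> 1 / sqrt (real (Suc m))" using True f unfolding A_def by (simp add: field_simps)
    finally show ?thesis .
  qed (simp add: G_def)
  \<comment> \<open>The level is the square of \<open>1 / 2\<close>: if \<open>A m\<close> holds,
    then outside \<open>E m\<close> the martingale never loses half of its value at time
    \<open>m\<close>.\<close>
  define E where "E = (\<lambda>m. {\<omega> \<in> space M. \<exists>n\<ge>m. 1 / 4 \<le> G m \<omega> * osc 2 \<zeta> m n \<omega>})"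
  have E: "E m \<in> sets M" for m unfolding E_def
    by (intro adapted_seq_event adapted_compose2[OF adapted_mono[OF adG] adapted_osc])
  define D where "D = 6 * K * exp e / (2 * 1 - exp e)"
  have D: "D > 0" unfolding D_def using K ye by simp
  have le: "prob (E m) \<le> 4 * D * (1 / sqrt (real (Suc m)))" if m: "m \<ge> n0" for m
  proof -
    have "1 / 4 * prob (E m) \<le> D * expectation (\<lambda>\<omega>. G m \<omega> * R e 1 2 m \<omega>)"
      unfolding E_def D_def
      by (rule oscillation_probability) (use ye K e m adG in \<open>auto simp: \<zeta>_def G_def\<close>)
    also have "expectation (\<lambda>\<omega>. G m \<omega> * R e 1 2 m \<omega>) \<le> expectation (\<lambda>\<omega>. 1 / sqrt (real (Suc m)))"
      by (intro integral_mono GR integrable_adapted[OF adapted_compose2[OF adG adapted_R]])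
    also have "\<dots> = 1 / sqrt (real (Suc m))" by (simp add: prob_space)
    finally show ?thesis using D by (simp add: mult.commute)
  qed
  have "((\<lambda>x. 4 * D * (1 / sqrt x)) \<longlongrightarrow> 4 * D * 0) at_top" by (intro tendsto_intros) real_asymp
  from filterlim_compose[OF this filterlim_compose[OF filterlim_real_sequentially filterlim_Suc]]
  have lim: "(\<lambda>m. 4 * D * (1 / sqrt (real (Suc m)))) \<longlonglongrightarrow> 0" by simp
  have "(\<lambda>m. prob (E m)) \<longlonglongrightarrow> 0"
  proof (rule tendsto_sandwich[OF _ _ tendsto_const lim])
    show "\<forall>\<^sub>F m in sequentially. prob (E m) \<le> 4 * D * (1 / sqrt (real (Suc m)))"
      using eventually_ge_at_top[of n0] by eventually_elim (rule le)
  qed auto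
  from AE_ex_not_in[of E, OF E this]
  have "AE \<omega> in M. \<forall>N. \<exists>m\<ge>N. \<omega> \<notin> E m" unfolding AE_all_countable by blast
  with AE_\<phi>_bounded[of 1] AE_space show ?thesis
  proof eventually_elim
    case (elim \<omega>)
    obtain B where B: "\<And>n v. n \<ge> n0 \<Longrightarrow> v \<le> n \<Longrightarrow> (1 - 1 / 2) * real (vdepth v \<omega>) \<le> exp 1 * h n \<omega> + B"
      using depth_bound[of \<omega> _ "1 / 2"] elim(1) by (metis half_gt_zero_iff zero_less_one)
    have depth: "real (vdepth v \<omega>) \<le> 2 * exp 1 / c * ln (real (Suc n)) + 2 * B" if n: "n \<ge> n0" "v \<le> n" for n v
    proof -
      have "h n \<omega> \<le> ln (real n) / c" using h_le_ln n by simp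
      also have "\<dots> \<le> ln (real (Suc n)) / c" using n n0_pos c_pos by (intro divide_right_mono) auto
      finally have "exp 1 * h n \<omega> \<le> exp 1 * (ln (real (Suc n)) / c)" by (intro mult_left_mono) auto
      moreover have "2 * exp 1 / c * ln (real (Suc n)) = 2 * (exp 1 * (ln (real (Suc n)) / c))" by simp
      moreover have "x \<le> a + 2 * B" if "u \<le> t" "a = 2 * t" "(1 - 1 / 2) * x \<le> u + B" for x a u t :: real
        using that by simp
      ultimately show ?thesis using B[OF n] by blast
    qed
    have "filterlim (\<lambda>m. ln (real (Suc m)) / 4) at_top sequentially"
      by real_asymp
    then have "\<forall>\<^sub>F m in sequentially. 8 * e * B + 3 * C' \<le> ln (real (Suc m)) / 4" unfolding filterlim_at_top by blast
    then have "\<forall>\<^sub>F m in sequentially. A m \<omega>"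
      using eventually_ge_at_top[of n0]
    proof eventually_elim
      case (elim m)
      define N where "N = real (Suc m)"
      have N: "N \<ge> 1" by (simp add: N_def)
      define Dm where "Dm = 2 * exp 1 / c * ln N + 2 * B"
      have d: "\<And>v. v \<le> m \<Longrightarrow> real (vdepth v \<omega>) \<le> Dm" using depth[OF elim(2)] by (simp add: Dm_def N_def)
      have "4 * e * (2 * exp 1 / c) \<le> 4 * (c / (32 * exp 1)) * (2 * exp 1 / c)"
        using e c_pos by (intro mult_right_mono mult_left_mono) auto
      also have "\<dots> = 1 / 4" using c_pos by simp
      finally have "4 * e * (2 * exp 1 / c) * ln N \<le> 1 / 4 * ln N" using N by (intro mult_right_mono) auto
      moreover have "4 * e * Dm = 4 * e * (2 * exp 1 / c) * ln N + 8 * e * B"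
        by (simp add: Dm_def distrib_left)
      moreover have "x + 3 * C' \<le> l / 2" if "a \<le> 1 / 4 * l" "x = a + 8 * e * B" "8 * e * B + 3 * C' \<le> l / 4" for a x l
        using that by simp
      ultimately have "4 * e * Dm + 3 * C' \<le> ln N / 2"
        using elim(1)[folded N_def] by blast
      then have ex: "exp (4 * e * Dm + 3 * C') \<le> sqrt N"
      proof -
        have "exp (4 * e * Dm + 3 * C') \<le> exp (ln N / 2)" using \<open>4 * e * Dm + 3 * C' \<le> ln N / 2\<close> by simp
        also have "\<dots> = sqrt N" using N by (simp add: powr_def flip: powr_half_sqrt)
        finally show ?thesis .
      qed
      have b: "N * exp (- (e * Dm + C')) \<le> \<phi> m 0 \<omega>" "\<phi> m e \<omega> \<le> N * exp ((e + e) * Dm + C')"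
        unfolding N_def by (rule \<phi>_bounds_of_depth[OF C' e(1) d] less_imp_le[OF e(1)]; assumption?)+
      have "\<phi> m e \<omega> * sqrt N \<le> N * exp ((e + e) * Dm + C') * sqrt N"
        using b(2) N by (intro mult_right_mono) auto
      also have "\<dots> = N * sqrt N * exp (4 * e * Dm + 3 * C') * exp (- (2 * e * Dm + 2 * C'))"
        by (simp add: mult_ac flip: exp_add)
      also have "\<dots> \<le> N * sqrt N * sqrt N * exp (- (2 * e * Dm + 2 * C'))"
        using ex N by (intro mult_right_mono mult_left_mono) auto
      also have "\<dots> = (N * exp (- (e * Dm + C')))\<^sup>2"
        using N by (simp add: power_mult_distrib power2_eq_square mult_ac flip: exp_add)
      also have "\<dots> \<le> (\<phi> m 0 \<omega>)\<^sup>2" using b(1) N by (intro power_mono) auto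
      finally show ?case by (simp add: A_def N_def)
    qed
    then obtain N where N: "\<And>m. m \<ge> N \<Longrightarrow> A m \<omega>" unfolding eventually_sequentially by blast
    obtain m where m: "m \<ge> N" "\<omega> \<notin> E m" using elim by blast
    define Mm where "Mm = \<phi> m 0 \<omega> / q m 1 \<omega>"
    have Mm: "Mm > 0" by (simp add: Mm_def q_pos \<phi>_pos)
    have "Mm / 2 * q n 1 \<omega> \<le> \<phi> n 0 \<omega>" if n: "n \<ge> m" for n
    proof -
      have "\<not> 1 / 4 \<le> G m \<omega> * osc 2 \<zeta> m n \<omega>" using m(2) \<open>\<omega> \<in> space M\<close> n unfolding E_def by blast
      then have "G m \<omega> * osc 2 \<zeta> m n \<omega> < 1 / 4" by simp
      then have "(1 / Mm)\<^sup>2 * (\<phi> n 0 \<omega> / q n 1 \<omega> - Mm)\<^sup>2 < 1 / 4"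
        using N[OF m(1)] by (simp add: G_def osc_eq Mm_def)
      then have sq: "((\<phi> n 0 \<omega> / q n 1 \<omega> - Mm) / Mm)\<^sup>2 < (1 / 2)\<^sup>2"
        by (simp only: power_divide power_one times_divide_eq_left mult_1_left) simp
      have "\<bar>(\<phi> n 0 \<omega> / q n 1 \<omega> - Mm) / Mm\<bar> < 1 / 2"
      proof (rule power2_less_imp_less)
        show "\<bar>(\<phi> n 0 \<omega> / q n 1 \<omega> - Mm) / Mm\<bar>\<^sup>2 < (1 / 2)\<^sup>2" unfolding power2_abs by (rule sq)
      qed simp
      then have "\<bar>\<phi> n 0 \<omega> / q n 1 \<omega> - Mm\<bar> < Mm / 2" using Mm by (simp add: field_simps)
      then have "Mm / 2 \<le> \<phi> n 0 \<omega> / q n 1 \<omega>" by linarith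
      then show ?thesis using q_pos[of 1 n \<omega>] by (simp add: field_simps)
    qed
    then show ?case using Mm by (intro exI[of _ "Mm / 2"]) (auto intro: eventually_mono[OF eventually_ge_at_top[of m]])
  qed
qed

text \<open>From \<open>ln (1 + t) \<ge> t - t\<^sup>2\<close> at \<open>t = 1 / Z k\<close>; the
  squares are summable, with a bound independent of the outcome, because
  \<open>Z k \<ge> c * Suc k\<close>.\<close>

lemma exp_h_le_q: "\<exists>K>0. \<forall>n. K * exp (h n \<omega>) \<le> q n 1 \<omega>"
proof -
  have sm: "summable (\<lambda>k. 1 / (c * real (Suc k))\<^sup>2)"
  proof -
    have "summable (\<lambda>k. 1 / c\<^sup>2 * inverse ((real (Suc k))\<^sup>2))"
      by (intro summable_mult summable_Suc_iff[THEN iffD2] inverse_power_summable) auto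
    then show ?thesis by (simp add: power_mult_distrib field_simps del: of_nat_Suc)
  qed
  define s where "s = (\<Sum>k. 1 / (c * real (Suc k))\<^sup>2)"
  have "exp (- s) * exp (h n \<omega>) \<le> q n 1 \<omega>" for n
  proof -
    have "(\<Sum>k=n0..<n. (1 / Z k \<omega>)\<^sup>2) \<le> (\<Sum>k=n0..<n. 1 / (c * real (Suc k))\<^sup>2)"
    proof (intro sum_mono)
      fix k
      have "1 / Z k \<omega> \<le> 1 / (c * real (Suc k))"
        using Z_lower[of k \<omega>] c_pos Z_pos[of k \<omega>] by (intro divide_left_mono) auto
      then have "(1 / Z k \<omega>)\<^sup>2 \<le> (1 / (c * real (Suc k)))\<^sup>2" using Z_pos[of k \<omega>] by (intro power_mono) auto
      then show "(1 / Z k \<omega>)\<^sup>2 \<le> 1 / (c * real (Suc k))\<^sup>2" by (simp add: power_divide)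
    qed
    also have "\<dots> \<le> s" unfolding s_def by (intro sum_le_suminf sm) auto
    finally have s: "(\<Sum>k=n0..<n. (1 / Z k \<omega>)\<^sup>2) \<le> s" .
    have "exp (- s) * exp (h n \<omega>) = exp (h n \<omega> - s)" by (simp add: exp_diff exp_minus field_simps)
    also have "\<dots> \<le> exp (\<Sum>k=n0..<n. 1 / Z k \<omega> - (1 / Z k \<omega>)\<^sup>2)" using s by (simp add: h_def sum_subtractf)
    also have "\<dots> = (\<Prod>k=n0..<n. exp (1 / Z k \<omega> - (1 / Z k \<omega>)\<^sup>2))" by (simp add: exp_sum)
    also have "\<dots> \<le> q n 1 \<omega>" unfolding q_def
    proof (intro prod_mono conjI)
      fix k assume k: "k \<in> {n0..<n}"
      then have Z: "Z k \<omega> > 1" using Z_ge_1 by simp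
      have "1 / Z k \<omega> - (1 / Z k \<omega>)\<^sup>2 \<le> ln (1 + 1 / Z k \<omega>)"
        by (rule ln_one_plus_pos_lower_bound) (use Z in auto)
      then have "exp (1 / Z k \<omega> - (1 / Z k \<omega>)\<^sup>2) \<le> exp (ln (1 + 1 / Z k \<omega>))" by simp
      also have "\<dots> = 1 + 1 / Z k \<omega>" using Z by (intro exp_ln) (simp add: add_pos_pos)
      finally show "exp (1 / Z k \<omega> - (1 / Z k \<omega>)\<^sup>2) \<le> 1 + 1 / Z k \<omega>" .
    qed auto
    finally show ?thesis .
  qed
  then show ?thesis by (intro exI[of _ "exp (- s)"]) auto
qed

text \<open>With \<open>u = exp z / Z k\<close>, each factor \<open>(1 + u) * exp (- u)\<close> is a
  Weierstrass factor of order 1 at \<open>- u\<close>. It differs from 1 by a multiple of the square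
  of \<open>norm u\<close>, which on a bounded set is of order \<open>1 / k\<^sup>2\<close>.\<close>

lemma uniformly_convergent_Q_exp:
  assumes A: "compact A"
  shows "uniformly_convergent_on A (\<lambda>n z. Q n z \<omega> * exp (- exp z * h n \<omega>))"
proof -
  \<comment> \<open>Below \<open>n0\<close> the factors are set to 1, so that the product starts at
    0.\<close>
  define F where "F = (\<lambda>k (z::complex). if k < n0 then 1 else (1 + exp z / Z k \<omega>) * exp (- (exp z / Z k \<omega>)))"
  have eq: "Q n z \<omega> * exp (- exp z * h n \<omega>) = (\<Prod>k<n. F k z)" for n z
  proof -
    have "(\<Prod>k<n. F k z) = (\<Prod>k=n0..<n. F k z)"
      by (rule prod.mono_neutral_right) (auto simp: F_def)
    also have "\<dots> = (\<Prod>k=n0..<n. (1 + exp z / Z k \<omega>) * exp (- (exp z / Z k \<omega>)))"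
      by (intro prod.cong refl) (auto simp: F_def)
    also have "\<dots> = Q n z \<omega> * exp (- exp z * h n \<omega>)"
      by (simp add: prod.distrib Q_def h_def sum_distrib_left sum_negf flip: exp_sum)
    finally show ?thesis by simp
  qed
  obtain b where b: "\<And>z. z \<in> A \<Longrightarrow> Re z \<le> b"
    using compact_imp_bounded[OF A] unfolding bounded_iff by (meson complex_Re_le_cmod order_trans)
  have small: "norm (exp z / Z k \<omega>) \<le> exp b / c / real (Suc k)" if "z \<in> A" for z k
  proof -
    have "norm (exp z / Z k \<omega>) = exp (Re z) / Z k \<omega>" using Z_pos[of k \<omega>] by (simp add: norm_divide)
    also have "\<dots> \<le> exp b / (c * real (Suc k))"
      using b[OF that] Z_lower[of k \<omega>] Z_pos[of k \<omega>] c_pos by (intro frac_le) auto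
    finally show ?thesis by simp
  qed
  have "uniformly_convergent_on A (\<lambda>N z. \<Sum>k<N. norm (F k z - 1))"
  proof (rule Weierstrass_m_test'_ev)
    have "(\<lambda>k. exp b / c / real (Suc k)) \<longlonglongrightarrow> 0" by real_asymp
    then have "\<forall>\<^sub>F k in sequentially. exp b / c / real (Suc k) < 1 / 2" by (rule order_tendstoD) simp
    then show "\<forall>\<^sub>F k in sequentially. \<forall>z\<in>A. norm (norm (F k z - 1)) \<le> 3 * (exp b / c / real (Suc k))\<^sup>2"
    proof eventually_elim
      case (elim k)
      show ?case
      proof
        fix z assume z: "z \<in> A"
        define w where "w = - (exp z / Z k \<omega>)"
        have w: "norm w \<le> exp b / c / real (Suc k)" using small[OF z, of k] by (simp add: w_def)
        have "norm (weierstrass_factor 1 w - 1) \<le> 3 * norm w ^ Suc 1"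
          by (rule weierstrass_factor_bound) (use w elim in linarith)
        also have "\<dots> \<le> 3 * (exp b / c / real (Suc k)) ^ Suc 1" using w by (intro mult_left_mono power_mono) auto
        also have "weierstrass_factor 1 w = (1 + exp z / Z k \<omega>) * exp (- (exp z / Z k \<omega>))"
          by (simp add: weierstrass_factor_def w_def)
        finally show "norm (norm (F k z - 1)) \<le> 3 * (exp b / c / real (Suc k))\<^sup>2"
          by (simp add: F_def numeral_2_eq_2 del: of_nat_Suc)
      qed
    qed
    have "summable (\<lambda>k. 3 * (exp b / c)\<^sup>2 * inverse ((real (Suc k))\<^sup>2))"
      by (intro summable_mult summable_Suc_iff[THEN iffD2] inverse_power_summable) auto
    then show "summable (\<lambda>k. 3 * (exp b / c / real (Suc k))\<^sup>2)"
      by (simp add: power_divide field_simps del: of_nat_Suc)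
  qed
  then have "uniformly_convergent_on A (\<lambda>N z. \<Prod>k<N. F k z)"
  proof (intro uniformly_convergent_on_prod' A)
    fix k
    have "complex_of_real (Z k \<omega>) \<noteq> 0" using Z_pos[of k \<omega>] by simp
    then show "continuous_on A (F k)" unfolding F_def by (cases "k < n0") (auto intro!: continuous_intros)
  qed
  then show ?thesis unfolding eq .
qed

text \<open>Normalised by \<open>exp (exp z * h n)\<close> and not by \<open>Q\<close>, since this
  is the normaliser in the profile. Being defined by \<open>lim\<close>, it has some value
  everywhere; it is meaningful where convergence has been shown.\<close>

definition W :: "complex \<Rightarrow> 'a \<Rightarrow> complex" where
  "W z \<omega> = lim (\<lambda>n. \<Phi> n z \<omega> * exp (- exp z * h n \<omega>))"

lemma uniform_limit_W:
  assumes Q0: "\<And>z. z \<in> A \<Longrightarrow> Re (exp z) > 0" and A: "compact A"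
    and Cauchy: "uniformly_Cauchy_on A (\<lambda>n z. \<Phi> n z \<omega> / Q n z \<omega>)"
  shows "uniform_limit A (\<lambda>n z. \<Phi> n z \<omega> * exp (- exp z * h n \<omega>)) (\<lambda>z. W z \<omega>) sequentially"
proof -
  have Qn: "Q n z \<omega> \<noteq> 0" if "z \<in> A" for n z
    using norm_Q_ge[of "Re (exp z)" z n \<omega>] q_pos[of "Re (exp z)" n \<omega>] Q0[OF that] by auto
  obtain l1 where l1: "uniform_limit A (\<lambda>n z. \<Phi> n z \<omega> / Q n z \<omega>) l1 sequentially"
    using Cauchy_uniformly_convergent[OF Cauchy] unfolding uniformly_convergent_on_def by blast
  obtain l2 where l2: "uniform_limit A (\<lambda>n z. Q n z \<omega> * exp (- exp z * h n \<omega>)) l2 sequentially"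
    using uniformly_convergent_Q_exp[OF A] unfolding uniformly_convergent_on_def by blast
  have "continuous_on A l1"
    by (rule uniform_limit_theorem[OF _ l1]) (auto intro!: always_eventually continuous_intros continuous_\<Phi> continuous_Q simp: Qn)
  then have b1: "bounded (l1 ` A)" using A compact_continuous_image compact_imp_bounded by blast
  have "continuous_on A l2"
    by (rule uniform_limit_theorem[OF _ l2]) (auto intro!: always_eventually continuous_intros continuous_\<Phi> continuous_Q)
  then have b2: "bounded (l2 ` A)" using A compact_continuous_image compact_imp_bounded by blast
  have "uniform_limit A (\<lambda>n z. (\<Phi> n z \<omega> / Q n z \<omega>) * (Q n z \<omega> * exp (- exp z * h n \<omega>))) (\<lambda>z. l1 z * l2 z) sequentially"
    by (rule uniform_lim_mult[OF l1 l2 b1 b2])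
  then have lim: "uniform_limit A (\<lambda>n z. \<Phi> n z \<omega> * exp (- exp z * h n \<omega>)) (\<lambda>z. l1 z * l2 z) sequentially"
    by (rule uniform_limit_cong'[THEN iffD1, rotated -1]) (auto simp: Qn)
  have "W z \<omega> = l1 z * l2 z" if "z \<in> A" for z
    unfolding W_def by (rule limI) (rule tendsto_uniform_limitI[OF lim that])
  then show ?thesis using lim by (subst uniform_limit_cong'[of A _ _ "\<lambda>z. W z \<omega>"]) auto
qed

text \<open>The null set belonging to a disc depends on its centre. By Lindelof's theorem countably
  many of the open discs cover \<open>U\<close>, and monotonicity of \<open>P\<close> hands the
  property down to smaller discs around all other points.\<close>

lemma AE_locally:
  fixes P :: "complex set \<Rightarrow> 'a \<Rightarrow> bool"
  assumes ex: "\<And>z. z \<in> U \<Longrightarrow> \<exists>s>0. AE \<omega> in M. P (cball z s) \<omega>"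
    and mono: "\<And>A B \<omega>. A \<subseteq> B \<Longrightarrow> P B \<omega> \<Longrightarrow> P A \<omega>"
  shows "AE \<omega> in M. \<forall>z\<in>U. \<exists>s>0. P (cball z s) \<omega>"
proof -
  obtain s where s: "\<And>z. z \<in> U \<Longrightarrow> s z > 0 \<and> (AE \<omega> in M. P (cball z (s z)) \<omega>)" using ex by metis
  define F where "F = (\<lambda>z. ball z (s z)) ` U"
  obtain F' where F': "F' \<subseteq> F" "countable F'" "\<Union>F' = \<Union>F"
    using Lindelof[of F] unfolding F_def by auto
  obtain V where V: "countable V" "V \<subseteq> U" "F' = (\<lambda>z. ball z (s z)) ` V"
    using countable_subset_image[of F' "\<lambda>z. ball z (s z)" U] F' unfolding F_def by blast
  have "AE \<omega> in M. \<forall>z\<in>V. P (cball z (s z)) \<omega>"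
    using V s by (subst AE_ball_countable) auto
  then show ?thesis
  proof eventually_elim
    case (elim \<omega>)
    show ?case
    proof
      fix z assume z: "z \<in> U"
      then have "z \<in> \<Union>F" using s[OF z] unfolding F_def by force
      then have "z \<in> \<Union>((\<lambda>z. ball z (s z)) ` V)" using F'(3) V(3) by simp
      then obtain v where v: "v \<in> V" "z \<in> ball v (s v)" by blast
      then obtain d where "d > 0" "cball z d \<subseteq> ball v (s v)" using open_contains_cball open_ball by metis
      then show "\<exists>s>0. P (cball z s) \<omega>" using elim v mono ball_subset_cball by (metis subset_trans)
    qed
  qed
qed

lemma AE_uniform_limit_W:
  "AE \<omega> in M. \<forall>x<1. \<exists>s>0. uniform_limit (cball (complex_of_real x) s) (\<lambda>n z. \<Phi> n z \<omega> * exp (- exp z * h n \<omega>)) (\<lambda>z. W z \<omega>) sequentially"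
proof -
  have "AE \<omega> in M. \<forall>z\<in>complex_of_real ` {..<1}. \<exists>s>0.
     uniform_limit (cball z s) (\<lambda>n z. \<Phi> n z \<omega> * exp (- exp z * h n \<omega>)) (\<lambda>z. W z \<omega>) sequentially"
  proof (rule AE_locally)
    fix z assume "z \<in> complex_of_real ` {..<1}"
    then obtain x where x: "x < 1" "z = complex_of_real x" by auto
    obtain s where s: "s > 0" "\<forall>w\<in>cball z s. Re (exp w) > 0"
      "AE \<omega> in M. uniformly_Cauchy_on (cball z s) (\<lambda>n z. \<Phi> n z \<omega> / Q n z \<omega>)"
      using martingale_locally_uniformly_Cauchy[OF x(1)] unfolding x(2) by blast
    from s(3) have "AE \<omega> in M. uniform_limit (cball z s) (\<lambda>n z. \<Phi> n z \<omega> * exp (- exp z * h n \<omega>)) (\<lambda>z. W z \<omega>) sequentially"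
      by eventually_elim (rule uniform_limit_W, use s in auto)
    then show "\<exists>s>0. AE \<omega> in M. uniform_limit (cball z s) (\<lambda>n z. \<Phi> n z \<omega> * exp (- exp z * h n \<omega>)) (\<lambda>z. W z \<omega>) sequentially"
      using s(1) by blast
  qed (rule uniform_limit_on_subset)
  then show ?thesis by eventually_elim auto
qed

lemma AE_off_axis_bound:
  "AE \<omega> in M. \<forall>z. Re z < 1 \<and> Re (exp z) < exp (Re z) \<longrightarrow> (\<exists>s>0. \<exists>\<kappa> C. (\<forall>w\<in>cball z s. \<kappa> < exp (Re w)) \<and>
     (\<forall>\<^sub>F n in sequentially. \<forall>w\<in>cball z s. norm (\<Phi> n w \<omega>) \<le> C * exp (\<kappa> * h n \<omega>)))"
proof -
  define P where "P = (\<lambda>A \<omega>. \<exists>\<kappa> C. (\<forall>w\<in>A. \<kappa> < exp (Re w)) \<and>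
     (\<forall>\<^sub>F n in sequentially. \<forall>w\<in>A. norm (\<Phi> n w \<omega>) \<le> C * exp (\<kappa> * h n \<omega>)))"
  have "AE \<omega> in M. \<forall>z\<in>{z. Re z < 1 \<and> Re (exp z) < exp (Re z)}. \<exists>s>0. P (cball z s) \<omega>"
  proof (rule AE_locally)
    fix z assume "z \<in> {z. Re z < 1 \<and> Re (exp z) < exp (Re z)}"
    then obtain s \<kappa> where s: "s > 0" "\<forall>w\<in>cball z s. \<kappa> < exp (Re w)"
      "AE \<omega> in M. \<exists>C. \<forall>\<^sub>F n in sequentially. \<forall>w\<in>cball z s. norm (\<Phi> n w \<omega>) \<le> C * exp (\<kappa> * h n \<omega>)"
      using off_axis_bound[of z] by blast
    from s(3) have "AE \<omega> in M. P (cball z s) \<omega>" by eventually_elim (use s(2) in \<open>auto simp: P_def\<close>)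
    then show "\<exists>s>0. AE \<omega> in M. P (cball z s) \<omega>" using s(1) by blast
  next
    fix A B \<omega> assume AB: "A \<subseteq> B" and "P B \<omega>"
    then obtain \<kappa> C where "\<forall>w\<in>B. \<kappa> < exp (Re w)" "\<forall>\<^sub>F n in sequentially. \<forall>w\<in>B. norm (\<Phi> n w \<omega>) \<le> C * exp (\<kappa> * h n \<omega>)"
      unfolding P_def by blast
    moreover from this(2) have "\<forall>\<^sub>F n in sequentially. \<forall>w\<in>A. norm (\<Phi> n w \<omega>) \<le> C * exp (\<kappa> * h n \<omega>)"
      by eventually_elim (use AB in blast)
    ultimately show "P A \<omega>" using AB unfolding P_def by blast
  qed
  then show ?thesis by eventually_elim (auto simp: P_def)
qed

end

section \<open>Consequences of convergence on a fixed path\<close>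

lemma fourier_orthogonality:
  fixes j :: int
  shows "(LINT t|lborel. indicator {-pi..pi} t *\<^sub>R exp (\<i> * of_int j * complex_of_real t)) = (if j = 0 then 2 * pi else 0)"
proof (cases "j = 0")
  case True
  have "(LINT t|lborel. indicator {-pi..pi} t *\<^sub>R (1::complex)) = complex_of_real (2 * pi)"
    by (subst Bochner_Integration.integral_scaleR_left) (auto simp: scaleR_conv_of_real)
  then show ?thesis using True by simp
next
  case False
  define F where "F = (\<lambda>t::real. exp (\<i> * of_int j * complex_of_real t) / (\<i> * of_int j))"
  have j: "\<i> * of_int j \<noteq> (0::complex)" using False by simp
  have "(LINT t|lborel. indicator {-pi..pi} t *\<^sub>R exp (\<i> * of_int j * complex_of_real t)) = F pi - F (-pi)"
  proof (rule integral_FTC_Icc)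
    fix t :: real
    show "(F has_vector_derivative exp (\<i> * of_int j * complex_of_real t)) (at t within {-pi..pi})"
      unfolding F_def
      by (rule has_vector_derivative_real_field[THEN has_vector_derivative_at_within])
        (use j in \<open>auto intro!: derivative_eq_intros\<close>)
  qed (auto intro!: continuous_intros)
  also have "exp (\<i> * of_int j * complex_of_real pi) = exp (\<i> * of_int j * complex_of_real (- pi)) * exp ((2 * of_int j * pi) * \<i>)"
    unfolding exp_add[symmetric] by (rule arg_cong[where f = exp]) (simp add: algebra_simps)
  then have "F pi - F (-pi) = 0" using exp_integer_2pi[of "of_int j"] by (simp add: F_def)
  finally show ?thesis using False by simp
qed

text \<open>By Lindelof's theorem countably many of the open sets that meet \<open>A\<close> in a
  single point already cover \<open>A\<close>.\<close>

lemma countable_isolated_points: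
  assumes "\<And>z. z \<in> A \<Longrightarrow> isolated_point z A"
  shows "countable A"
proof -
  define F where "F = {I. open I \<and> (\<exists>z. I \<inter> A = {z})}"
  obtain F' where F': "F' \<subseteq> F" "countable F'" "\<Union>F' = \<Union>F"
    using Lindelof[of F] unfolding F_def by auto
  have "A \<subseteq> \<Union>F"
  proof
    fix z assume "z \<in> A"
    then obtain e where e: "{z - e<..<z + e} \<inter> A = {z}" using assms unfolding isolated_point_def by blast
    then have "{z - e<..<z + e} \<in> F" unfolding F_def by auto
    moreover have "z \<in> {z - e<..<z + e}" using e by blast
    ultimately show "z \<in> \<Union>F" by blast
  qed
  then have "A = (\<Union>I\<in>F'. I \<inter> A)" using F'(3) by blast
  moreover have "countable (\<Union>I\<in>F'. I \<inter> A)"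
  proof (rule countable_UN[OF F'(2)])
    fix I assume "I \<in> F'"
    then obtain z where "I \<inter> A = {z}" using F'(1) unfolding F_def by blast
    then show "countable (I \<inter> A)" by simp
  qed
  ultimately show ?thesis by simp
qed

context bounded_rrt
begin

definition level :: "nat \<Rightarrow> nat \<Rightarrow> 'a \<Rightarrow> nat" where
  "level n k \<omega> = card {v. v \<le> n \<and> vdepth v \<omega> = k}"

text \<open>Along a vertical line \<open>\<Phi> n\<close> is a trigonometric polynomial; its
  coefficient at frequency \<open>k\<close> collects the vertices at depth \<open>k\<close>.\<close>

lemma level_fourier:
  "(LINT t|lborel. indicator {-pi..pi} t *\<^sub>R (\<Phi> n (Complex x t) \<omega> * exp (- \<i> * (t * real k))))
    = of_real (2 * pi * real (level n k \<omega>) * exp (x * k - S k))"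
proof -
  have e: "indicator {-pi..pi} t *\<^sub>R (\<Phi> n (Complex x t) \<omega> * exp (- \<i> * (t * real k))) =
    (\<Sum>v\<le>n. complex_of_real (exp (x * real (vdepth v \<omega>) - S (vdepth v \<omega>))) *
      (indicator {-pi..pi} t *\<^sub>R exp (\<i> * of_int (int (vdepth v \<omega>) - int k) * complex_of_real t)))" for t
  proof -
    have "vterm (Complex x t) d * exp (- \<i> * (t * real k)) =
      complex_of_real (exp (x * real d - S d)) * exp (\<i> * of_int (int d - int k) * complex_of_real t)" for d
      unfolding vterm_def exp_of_real[symmetric] exp_add[symmetric]
      by (rule arg_cong[where f = exp]) (simp add: Complex_eq algebra_simps)
    then show ?thesis by (simp add: \<Phi>_def sum_distrib_right scaleR_sum_right mult_scaleR_right)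
  qed
  have int: "integrable lborel (\<lambda>t. complex_of_real (exp (x * real (vdepth v \<omega>) - S (vdepth v \<omega>))) *
      (indicator {-pi..pi} t *\<^sub>R exp (\<i> * of_int (int (vdepth v \<omega>) - int k) * complex_of_real t)))" for v
  proof (intro integrable_mult_right)
    have "continuous_on {-pi..pi} (\<lambda>t. exp (\<i> * of_int (int (vdepth v \<omega>) - int k) * complex_of_real t))"
      by (intro continuous_intros)
    then show "integrable lborel (\<lambda>t. indicator {-pi..pi} t *\<^sub>R exp (\<i> * of_int (int (vdepth v \<omega>) - int k) * complex_of_real t))"
      by (intro borel_integrable_compact) auto
  qed
  have "(LINT t|lborel. indicator {-pi..pi} t *\<^sub>R (\<Phi> n (Complex x t) \<omega> * exp (- \<i> * (t * real k)))) =
    (\<Sum>v\<le>n. complex_of_real (exp (x * real (vdepth v \<omega>) - S (vdepth v \<omega>))) *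
      (if int (vdepth v \<omega>) - int k = 0 then 2 * pi else 0))"
    unfolding e using int
    by (subst Bochner_Integration.integral_sum) (simp_all only: integral_mult_right_zero fourier_orthogonality)
  also have "\<dots> = (\<Sum>v\<le>n. if vdepth v \<omega> = k then of_real (2 * pi * exp (x * k - S k)) else 0)"
    by (intro sum.cong refl) auto
  also have "\<dots> = (\<Sum>v\<in>{v. v \<le> n \<and> vdepth v \<omega> = k}. of_real (2 * pi * exp (x * k - S k)))"
    by (rule sum.mono_neutral_cong_right) auto
  also have "\<dots> = of_real (2 * pi * real (level n k \<omega>) * exp (x * k - S k))"
    by (simp add: level_def)
  finally show ?thesis .
qed

text \<open>The values of \<open>W\<close> on the real axis, as real numbers. As a limit of
  functions with finitely many values, \<open>w x\<close> is measurable for each \<open>x\<close>,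
  with no exceptional set.\<close>

definition w :: "real \<Rightarrow> 'a \<Rightarrow> real" where
  "w x \<omega> = lim (\<lambda>n. \<phi> n x \<omega> * exp (- exp x * h n \<omega>))"

lemma borel_measurable_w: "w x \<in> borel_measurable M"
proof -
  have "(\<lambda>\<omega>. \<phi> n x \<omega> * exp (- exp x * h n \<omega>)) \<in> borel_measurable M" for n
    by (intro borel_measurable_simple_function simple_function_adapted[of n] adapted_compose2[OF adapted_\<phi> adapted_h]) auto
  then show ?thesis unfolding w_def by (rule borel_measurable_lim_metric)
qed

text \<open>The almost sure properties from which everything else follows path by path.\<close>

definition good :: "'a \<Rightarrow> bool" where
  "good \<omega> \<longleftrightarrow>
    (\<forall>x<1. \<exists>s>0. uniform_limit (cball (complex_of_real x) s) (\<lambda>n z. \<Phi> n z \<omega> * exp (- exp z * h n \<omega>)) (\<lambda>z. W z \<omega>) sequentially) \<and>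
    (\<forall>z. Re z < 1 \<and> Re (exp z) < exp (Re z) \<longrightarrow> (\<exists>s>0. \<exists>\<kappa> C. (\<forall>w\<in>cball z s. \<kappa> < exp (Re w)) \<and>
       (\<forall>\<^sub>F n in sequentially. \<forall>w\<in>cball z s. norm (\<Phi> n w \<omega>) \<le> C * exp (\<kappa> * h n \<omega>)))) \<and>
    (\<exists>b>0. \<forall>\<^sub>F n in sequentially. b * q n 1 \<omega> \<le> \<phi> n 0 \<omega>) \<and>
    (\<exists>C. \<forall>n\<ge>n0. \<phi> n 1 \<omega> \<le> C * exp (exp 1 * h n \<omega>))"

lemma AE_good: "AE \<omega> in M. good \<omega>"
  using AE_uniform_limit_W AE_off_axis_bound AE_\<phi>_0_lower AE_\<phi>_bounded[of 1]
  unfolding good_def by eventually_elim blast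

lemma h_nonneg: "h n \<omega> \<ge> 0"
  unfolding h_def by (intro sum_nonneg) (simp add: Z_pos less_imp_le)

lemma tendsto_w:
  assumes "good \<omega>" "x < 1"
  shows "(\<lambda>n. \<phi> n x \<omega> * exp (- exp x * h n \<omega>)) \<longlonglongrightarrow> w x \<omega>" and "W (of_real x) \<omega> = of_real (w x \<omega>)"
    and "w x \<omega> \<ge> 0"
proof -
  obtain s where s: "s > 0" "uniform_limit (cball (complex_of_real x) s) (\<lambda>n z. \<Phi> n z \<omega> * exp (- exp z * h n \<omega>)) (\<lambda>z. W z \<omega>) sequentially"
    using assms unfolding good_def by blast
  have "(\<lambda>n. \<Phi> n (of_real x) \<omega> * exp (- exp (complex_of_real x) * complex_of_real (h n \<omega>))) \<longlonglongrightarrow> W (of_real x) \<omega>"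
    by (rule tendsto_uniform_limitI[OF s(2)]) (use s(1) in simp)
  moreover have "\<Phi> n (of_real x) \<omega> * exp (- exp (complex_of_real x) * complex_of_real (h n \<omega>)) = of_real (\<phi> n x \<omega> * exp (- exp x * h n \<omega>))" for n
    by (simp add: \<Phi>_of_real exp_of_real[symmetric])
  ultimately have lim: "(\<lambda>n. complex_of_real (\<phi> n x \<omega> * exp (- exp x * h n \<omega>))) \<longlonglongrightarrow> W (of_real x) \<omega>" by simp
  have limr: "(\<lambda>n. \<phi> n x \<omega> * exp (- exp x * h n \<omega>)) \<longlonglongrightarrow> Re (W (of_real x) \<omega>)"
    using tendsto_Re[OF lim] by simp
  then have w: "w x \<omega> = Re (W (of_real x) \<omega>)" unfolding w_def by (rule limI)
  show "(\<lambda>n. \<phi> n x \<omega> * exp (- exp x * h n \<omega>)) \<longlonglongrightarrow> w x \<omega>" using limr w by simp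
  have "Im (W (of_real x) \<omega>) = 0" using LIMSEQ_unique[OF tendsto_Im[OF lim]] by simp
  then show "W (of_real x) \<omega> = of_real (w x \<omega>)" by (simp add: w complex_eq_iff)
  show "w x \<omega> \<ge> 0" unfolding w by (rule LIMSEQ_le_const[OF limr]) (auto intro!: exI mult_nonneg_nonneg less_imp_le[OF \<phi>_pos])
qed

lemma w_0_pos:
  assumes "good \<omega>" shows "w 0 \<omega> > 0"
proof -
  obtain b where b: "b > 0" "\<forall>\<^sub>F n in sequentially. b * q n 1 \<omega> \<le> \<phi> n 0 \<omega>" using assms unfolding good_def by blast
  obtain K where K: "K > 0" "\<And>n. K * exp (h n \<omega>) \<le> q n 1 \<omega>" using exp_h_le_q by blast
  have "b * K \<le> w 0 \<omega>"
  proof (rule tendsto_lowerbound[OF tendsto_w(1)[OF assms, of 0]])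
    show "\<forall>\<^sub>F n in sequentially. b * K \<le> \<phi> n 0 \<omega> * exp (- exp 0 * h n \<omega>)"
      using b(2)
    proof eventually_elim
      case (elim n)
      have "b * (K * exp (h n \<omega>)) \<le> \<phi> n 0 \<omega>" using elim mult_left_mono[OF K(2)[of n], of b] b(1) by linarith
      then have "b * (K * exp (h n \<omega>)) * exp (- h n \<omega>) \<le> \<phi> n 0 \<omega> * exp (- h n \<omega>)" by (intro mult_right_mono) auto
      then show ?case by (simp add: mult.assoc flip: exp_add)
    qed
  qed auto
  then show ?thesis using mult_pos_pos[OF b(1) K(1)] by linarith
qed

text \<open>The union of the discs of convergence. It is connected because every disc meets the ray
  on which the centres lie; this is what the identity theorem requires to carry the non-vanishing at
  0 to all other points.\<close>

lemma holomorphic_W_nbhd: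
  assumes g: "good \<omega>"
  obtains U where "open U" "connected U" "\<And>x. x < 1 \<Longrightarrow> complex_of_real x \<in> U" "(\<lambda>z. W z \<omega>) holomorphic_on U"
proof -
  have "\<forall>x. \<exists>s. x < 1 \<longrightarrow> s > 0 \<and> uniform_limit (cball (complex_of_real x) s) (\<lambda>n z. \<Phi> n z \<omega> * exp (- exp z * h n \<omega>)) (\<lambda>z. W z \<omega>) sequentially"
    using g unfolding good_def by blast
  from choice[OF this] obtain s where s': "\<forall>x. x < 1 \<longrightarrow> s x > 0 \<and> uniform_limit (cball (complex_of_real x) (s x)) (\<lambda>n z. \<Phi> n z \<omega> * exp (- exp z * h n \<omega>)) (\<lambda>z. W z \<omega>) sequentially" ..
  have s: "s x > 0 \<and> uniform_limit (cball (complex_of_real x) (s x)) (\<lambda>n z. \<Phi> n z \<omega> * exp (- exp z * h n \<omega>)) (\<lambda>z. W z \<omega>) sequentially"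
    if "x < 1" for x using s' that by blast
  define U where "U = (\<Union>x\<in>{..<1}. ball (complex_of_real x) (s x))"
  define L where "L = complex_of_real ` {..<1}"
  have xU: "complex_of_real x \<in> U" if "x < 1" for x using s[OF that] that unfolding U_def by force
  have LU: "L \<subseteq> U" using xU by (auto simp: L_def)
  have connL: "connected L" unfolding L_def by (intro connected_continuous_image continuous_intros) (simp add: convex_connected)
  have "U = \<Union>((\<lambda>x. L \<union> ball (complex_of_real x) (s x)) ` {..<1})" using LU unfolding U_def by auto
  moreover have "connected (\<Union>((\<lambda>x. L \<union> ball (complex_of_real x) (s x)) ` {..<1}))"
  proof (rule connected_Union)
    show "connected C" if C: "C \<in> (\<lambda>x. L \<union> ball (complex_of_real x) (s x)) ` {..<1}" for C
    proof -
      from C obtain x where x: "x < 1" "C = L \<union> ball (complex_of_real x) (s x)" by auto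
      have "complex_of_real x \<in> L \<inter> ball (complex_of_real x) (s x)" using x s[OF x(1)] by (auto simp: L_def)
      then show ?thesis unfolding x(2) by (intro connected_Un connL connected_ball) auto
    qed
    have "complex_of_real 0 \<in> \<Inter>((\<lambda>x. L \<union> ball (complex_of_real x) (s x)) ` {..<1})" by (auto simp: L_def)
    then show "\<Inter>((\<lambda>x. L \<union> ball (complex_of_real x) (s x)) ` {..<1}) \<noteq> {}" by blast
  qed
  ultimately have "connected U" by simp
  moreover have "open U" unfolding U_def by auto
  moreover have "(\<lambda>z. W z \<omega>) holomorphic_on U"
  proof (rule holomorphic_uniform_sequence[OF \<open>open U\<close>])
    show "(\<lambda>z. \<Phi> n z \<omega> * exp (- exp z * h n \<omega>)) holomorphic_on U" for n
      by (intro holomorphic_intros holomorphic_\<Phi>)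
    fix z assume "z \<in> U"
    then obtain x where x: "x < 1" "z \<in> ball (complex_of_real x) (s x)" unfolding U_def by auto
    then obtain d where d: "d > 0" "cball z d \<subseteq> ball (complex_of_real x) (s x)" using open_contains_cball open_ball by metis
    have "uniform_limit (cball z d) (\<lambda>n z. \<Phi> n z \<omega> * exp (- exp z * h n \<omega>)) (\<lambda>z. W z \<omega>) sequentially"
      using s[OF x(1)] d(2) ball_subset_cball by (meson uniform_limit_on_subset subset_trans)
    moreover have "cball z d \<subseteq> U" using d(2) x(1) unfolding U_def by auto
    ultimately show "\<exists>d>0. cball z d \<subseteq> U \<and> uniform_limit (cball z d) (\<lambda>n z. \<Phi> n z \<omega> * exp (- exp z * h n \<omega>)) (\<lambda>z. W z \<omega>) sequentially"
      using d(1) by blast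
  qed
  ultimately show ?thesis using that xU by blast
qed

lemma continuous_w:
  assumes g: "good \<omega>" and A: "A \<subseteq> {..<1}"
  shows "continuous_on A (\<lambda>x. w x \<omega>)"
proof -
  obtain U where U: "\<And>x. x < 1 \<Longrightarrow> complex_of_real x \<in> U" "(\<lambda>z. W z \<omega>) holomorphic_on U"
    by (rule holomorphic_W_nbhd[OF g]) blast
  have "continuous_on A (\<lambda>x. Re (W (complex_of_real x) \<omega>))"
    by (intro continuous_intros continuous_on_compose2[OF holomorphic_on_imp_continuous_on[OF U(2)]]) (use U(1) A in auto)
  moreover have "Re (W (complex_of_real x) \<omega>) = w x \<omega>" if "x \<in> A" for x
    using tendsto_w(2)[OF g, of x] A that by auto
  ultimately show ?thesis by (simp cong: continuous_on_cong)
qed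

lemma zeros_isolated:
  assumes g: "good \<omega>"
  defines "A \<equiv> {x. x < 1 \<and> w x \<omega> = 0}"
  shows "\<And>z. z \<in> A \<Longrightarrow> isolated_point z A"
proof -
  obtain U where U: "open U" "connected U" "\<And>x. x < 1 \<Longrightarrow> complex_of_real x \<in> U" "(\<lambda>z. W z \<omega>) holomorphic_on U"
    by (rule holomorphic_W_nbhd[OF g]) blast
  have W0: "W (complex_of_real 0) \<omega> \<noteq> 0" using tendsto_w(2)[OF g, of 0] w_0_pos[OF g] by simp
  have iso: "\<exists>r>0. \<forall>x. x < 1 \<and> \<bar>x - z\<bar> < r \<and> x \<noteq> z \<longrightarrow> w x \<omega> \<noteq> 0" if "z \<in> A" for z
  proof -
    have z: "z < 1" "W (complex_of_real z) \<omega> = 0" using that tendsto_w(2)[OF g, of z] by (auto simp: A_def)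
    obtain r where r: "0 < r" "\<And>y. y \<in> ball (complex_of_real z) r - {complex_of_real z} \<Longrightarrow> W y \<omega> \<noteq> 0"
      using isolated_zeros[OF U(4,1,2) U(3)[OF z(1)] z(2) U(3)[of 0] W0] by (metis zero_less_one)
    have "w x \<omega> \<noteq> 0" if x: "x < 1" "\<bar>x - z\<bar> < r" "x \<noteq> z" for x
    proof -
      have "dist (complex_of_real z) (complex_of_real x) < r" using x by (simp add: dist_of_real dist_real_def)
      then have "W (complex_of_real x) \<omega> \<noteq> 0" using x by (intro r(2)) auto
      then show ?thesis using tendsto_w(2)[OF g x(1)] by auto
    qed
    then show ?thesis using r(1) by blast
  qed
  show "isolated_point z A" if z: "z \<in> A" for z
  proof -
    obtain r where r: "r > 0" "\<And>x. x < 1 \<and> \<bar>x - z\<bar> < r \<and> x \<noteq> z \<Longrightarrow> w x \<omega> \<noteq> 0" using iso[OF z] by blast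
    have "x = z" if "x \<in> A" "z - r < x" "x < z + r" for x
    proof (rule ccontr)
      assume "x \<noteq> z"
      moreover have "\<bar>x - z\<bar> < r" using that by linarith
      ultimately show False using r(2)[of x] that(1) by (auto simp: A_def)
    qed
    then have "{z - r<..<z + r} \<inter> A = {z}" using z r(1) by auto
    then show ?thesis unfolding isolated_point_def using r(1) by blast
  qed
qed

end

section \<open>From the limit function to the profile and the depth, path by path\<close>

context bounded_rrt
begin

lemma uniform_limit_W_compact:
  assumes g: "good \<omega>" and K: "compact K" "K \<subseteq> {..<1}"
  shows "\<exists>\<delta>>0. uniform_limit {z. Re z \<in> K \<and> \<bar>Im z\<bar> \<le> \<delta>} (\<lambda>n z. \<Phi> n z \<omega> * exp (- exp z * h n \<omega>)) (\<lambda>z. W z \<omega>) sequentially"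
proof -
  have "\<forall>x. \<exists>s. x < 1 \<longrightarrow> s > 0 \<and> uniform_limit (cball (complex_of_real x) s) (\<lambda>n z. \<Phi> n z \<omega> * exp (- exp z * h n \<omega>)) (\<lambda>z. W z \<omega>) sequentially"
    using g unfolding good_def by blast
  from choice[OF this] obtain s where s: "\<forall>x. x < 1 \<longrightarrow> s x > 0 \<and> uniform_limit (cball (complex_of_real x) (s x)) (\<lambda>n z. \<Phi> n z \<omega> * exp (- exp z * h n \<omega>)) (\<lambda>z. W z \<omega>) sequentially" ..
  \<comment> \<open>Half radii leave room: if the real part is within \<open>s x / 2\<close> of
    \<open>x\<close> and the imaginary part is at most \<open>s x / 2\<close>, the point lies in the
    full disc.\<close>
  have "K \<subseteq> (\<Union>x\<in>K. ball x (s x / 2))" using s K(2) by force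
  then obtain X where X: "X \<subseteq> K" "finite X" "K \<subseteq> (\<Union>x\<in>X. ball x (s x / 2))"
    using compactE_image[OF K(1), of K "\<lambda>x. ball x (s x / 2)"] by auto
  define \<delta> where "\<delta> = Min (insert 1 ((\<lambda>x. s x / 2) ` X))"
  have \<delta>: "\<delta> > 0" unfolding \<delta>_def using X s K(2) by auto
  have \<delta>X: "\<delta> \<le> s x / 2" if "x \<in> X" for x
    unfolding \<delta>_def by (rule Min_le) (use X(2) that in auto)
  have "uniform_limit (\<Union>x\<in>X. cball (complex_of_real x) (s x)) (\<lambda>n z. \<Phi> n z \<omega> * exp (- exp z * h n \<omega>)) (\<lambda>z. W z \<omega>) sequentially"
    using s X K(2) by (intro uniform_limit_on_UNION) auto
  moreover have "{z. Re z \<in> K \<and> \<bar>Im z\<bar> \<le> \<delta>} \<subseteq> (\<Union>x\<in>X. cball (complex_of_real x) (s x))"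
  proof
    fix z assume "z \<in> {z. Re z \<in> K \<and> \<bar>Im z\<bar> \<le> \<delta>}"
    then have z: "Re z \<in> K" "\<bar>Im z\<bar> \<le> \<delta>" by auto
    then obtain x where x: "x \<in> X" "Re z \<in> ball x (s x / 2)" using X(3) by blast
    have "norm (z - complex_of_real x) \<le> \<bar>Re (z - complex_of_real x)\<bar> + \<bar>Im (z - complex_of_real x)\<bar>" by (rule cmod_le)
    also have "\<dots> \<le> s x / 2 + s x / 2" using x(2) z(2) \<delta>X[OF x(1)] by (intro add_mono) (auto simp: dist_real_def abs_minus_commute)
    finally show "z \<in> (\<Union>x\<in>X. cball (complex_of_real x) (s x))" using x(1) by (auto simp: dist_norm norm_minus_commute)
  qed
  ultimately show ?thesis using \<delta> uniform_limit_on_subset by blast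
qed

text \<open>For \<open>\<delta> \<le> \<bar>\<theta>\<bar> \<le> pi\<close> the cosine is strictly
  below 1, so these points form a compact set on which the local bounds apply. Finitely many discs
  make the gap in the rate uniform.\<close>

lemma off_axis_bound_compact:
  assumes g: "good \<omega>" and K: "compact K" "K \<subseteq> {..<1}" and \<delta>: "\<delta> > 0"
  shows "\<exists>C \<eta>. \<eta> > 0 \<and> (\<forall>\<^sub>F n in sequentially. \<forall>x\<in>K. \<forall>\<theta>. \<delta> \<le> \<bar>\<theta>\<bar> \<and> \<bar>\<theta>\<bar> \<le> pi \<longrightarrow>
    norm (\<Phi> n (Complex x \<theta>) \<omega>) \<le> C * exp ((exp x - \<eta>) * h n \<omega>))"
proof -
  define D where "D = {z. Re z \<in> K \<and> \<delta> \<le> \<bar>Im z\<bar> \<and> \<bar>Im z\<bar> \<le> pi}"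
  have Dim: "D = (\<lambda>(x, y). Complex x y) ` (K \<times> ({-pi..pi} \<inter> {y. \<delta> \<le> \<bar>y\<bar>}))"
    unfolding D_def by (force simp: image_def abs_le_iff intro: complex_eqI)
  have cl: "closed {y::real. \<delta> \<le> \<bar>y\<bar>}" by (intro closed_Collect_le continuous_intros)
  have compD: "compact D" unfolding Dim case_prod_beta Complex_eq
    by (intro compact_continuous_image continuous_intros compact_Times K(1) compact_Int_closed cl) auto
  have Dz: "Re z < 1 \<and> Re (exp z) < exp (Re z)" if "z \<in> D" for z
  proof -
    have "cos (Im z) < cos 0"
    proof -
      have "cos \<bar>Im z\<bar> < cos 0" using that \<delta> by (intro cos_monotone_0_pi) (auto simp: D_def)
      then show ?thesis by simp
    qed
    then show ?thesis using that K(2) by (auto simp: D_def Re_exp)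
  qed
  define P where "P = (\<lambda>z s \<kappa> C. s > 0 \<and> (\<forall>w\<in>cball z s. \<kappa> < exp (Re w)) \<and>
       (\<forall>\<^sub>F n in sequentially. \<forall>w\<in>cball z s. norm (\<Phi> n w \<omega>) \<le> C * exp (\<kappa> * h n \<omega>)))"
  have "\<forall>z. \<exists>s. z \<in> D \<longrightarrow> (\<exists>\<kappa> C. P z s \<kappa> C)" using g Dz unfolding good_def P_def by meson
  from choice[OF this] obtain s where s: "\<forall>z. z \<in> D \<longrightarrow> (\<exists>\<kappa> C. P z (s z) \<kappa> C)" ..
  then have "\<forall>z. \<exists>\<kappa>. z \<in> D \<longrightarrow> (\<exists>C. P z (s z) \<kappa> C)" by meson
  from choice[OF this] obtain \<kappa> where \<kappa>: "\<forall>z. z \<in> D \<longrightarrow> (\<exists>C. P z (s z) (\<kappa> z) C)" ..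
  then have "\<forall>z. \<exists>C. z \<in> D \<longrightarrow> P z (s z) (\<kappa> z) C" by meson
  from choice[OF this] obtain C where C: "\<forall>z. z \<in> D \<longrightarrow> P z (s z) (\<kappa> z) (C z)" ..
  have "D \<subseteq> (\<Union>z\<in>D. ball z (s z))" using C unfolding P_def by force
  then obtain X where X: "X \<subseteq> D" "finite X" "D \<subseteq> (\<Union>z\<in>X. ball z (s z))"
    using compactE_image[OF compD, of D "\<lambda>z. ball z (s z)"] by auto
  \<comment> \<open>The gap at the leftmost point of each disc. That point belongs to the closed
    disc, so the gap is positive, and \<open>exp (Re w)\<close> is nowhere smaller on the
    disc.\<close>
  define \<eta> where "\<eta> = Min (insert 1 ((\<lambda>z. exp (Re z - s z) - \<kappa> z) ` X))"
  have gap: "exp (Re z - s z) - \<kappa> z > 0" if "z \<in> X" for z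
  proof -
    have "z - complex_of_real (s z) \<in> cball z (s z)" using C X(1) that by (auto simp: P_def dist_norm)
    then have "\<kappa> z < exp (Re (z - complex_of_real (s z)))" using C X(1) that unfolding P_def by blast
    then show ?thesis by simp
  qed
  have \<eta>: "\<eta> > 0" unfolding \<eta>_def using X(2) gap by auto
  have \<eta>X: "\<eta> \<le> exp (Re z - s z) - \<kappa> z" if "z \<in> X" for z
    unfolding \<eta>_def by (rule Min_le) (use X(2) that in auto)
  define B where "B = (\<Sum>z\<in>X. \<bar>C z\<bar>)"
  have B: "C z \<le> B" if "z \<in> X" for z
    using member_le_sum[of z X "\<lambda>z. \<bar>C z\<bar>"] that X(2) unfolding B_def by fastforce
  have "\<forall>\<^sub>F n in sequentially. \<forall>z\<in>X. \<forall>w\<in>cball z (s z). norm (\<Phi> n w \<omega>) \<le> C z * exp (\<kappa> z * h n \<omega>)"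
    using C X by (intro eventually_ball_finite) (auto simp: P_def)
  then have "\<forall>\<^sub>F n in sequentially. \<forall>x\<in>K. \<forall>\<theta>. \<delta> \<le> \<bar>\<theta>\<bar> \<and> \<bar>\<theta>\<bar> \<le> pi \<longrightarrow>
    norm (\<Phi> n (Complex x \<theta>) \<omega>) \<le> B * exp ((exp x - \<eta>) * h n \<omega>)"
  proof eventually_elim
    case (elim n)
    show ?case
    proof (intro ballI allI impI)
      fix x \<theta> assume x: "x \<in> K" and \<theta>: "\<delta> \<le> \<bar>\<theta>\<bar> \<and> \<bar>\<theta>\<bar> \<le> pi"
      have "Complex x \<theta> \<in> D" using x \<theta> by (simp add: D_def)
      then obtain z where z: "z \<in> X" "Complex x \<theta> \<in> ball z (s z)" using X(3) by blast
      have "Re z - x \<le> norm (z - Complex x \<theta>)" using complex_Re_le_cmod[of "z - Complex x \<theta>"] by simp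
      then have "exp (Re z - s z) \<le> exp x" using z(2) by (simp add: dist_norm)
      then have "\<kappa> z \<le> exp x - \<eta>" using \<eta>X[OF z(1)] by linarith
      then have e: "exp (\<kappa> z * h n \<omega>) \<le> exp ((exp x - \<eta>) * h n \<omega>)" using h_nonneg[of n \<omega>] by (simp add: mult_right_mono)
      have "norm (\<Phi> n (Complex x \<theta>) \<omega>) \<le> C z * exp (\<kappa> z * h n \<omega>)" using elim z by auto
      also have "\<dots> \<le> B * exp (\<kappa> z * h n \<omega>)" using B[OF z(1)] by (intro mult_right_mono) auto
      also have "\<dots> \<le> B * exp ((exp x - \<eta>) * h n \<omega>)" using e unfolding B_def by (intro mult_left_mono sum_nonneg) auto
      finally show "norm (\<Phi> n (Complex x \<theta>) \<omega>) \<le> B * exp ((exp x - \<eta>) * h n \<omega>)" .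
    qed
  qed
  then show ?thesis using \<eta> by blast
qed

text \<open>The common source of both profile statements: the first takes the single line over 0 and
  all \<open>k\<close>, the second follows for each \<open>z\<close> the line over \<open>z\<close>
  at the level nearest to its centre.\<close>

lemma profile_asymptotics:
  fixes K :: "real set"
  assumes g: "good \<omega>" and K: "compact K" "K \<noteq> {}" "K \<subseteq> {..<1}" and \<epsilon>: "\<epsilon> > 0"
  shows "\<forall>\<^sub>F n in sequentially. \<forall>x\<in>K. \<forall>k::nat.
    \<bar>sqrt (h n \<omega>) * exp (- exp x * h n \<omega>) * (2 * pi * real (level n k \<omega>) * exp (x * k - S k))
      - w x \<omega> * (sqrt (2 * pi / exp x) * exp (- (k - exp x * h n \<omega>)\<^sup>2 / (2 * exp x * h n \<omega>)))\<bar> \<le> \<epsilon>"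
proof -
  obtain \<delta> where \<delta>: "\<delta> > 0" and unif: "uniform_limit {z. Re z \<in> K \<and> \<bar>Im z\<bar> \<le> \<delta>} (\<lambda>n z. \<Phi> n z \<omega> * exp (- exp z * h n \<omega>)) (\<lambda>z. W z \<omega>) sequentially"
    using uniform_limit_W_compact[OF g K(1,3)] by blast
  have cont: "continuous_on {z. Re z \<in> K \<and> \<bar>Im z\<bar> \<le> \<delta>} (\<lambda>z. W z \<omega>)"
    by (rule uniform_limit_theorem[OF _ unif]) (auto intro!: always_eventually continuous_intros continuous_\<Phi>)
  from fourier_laplace_approximation[OF h_at_top[of \<omega>] K(1,2) continuous_\<Phi>[of UNIV _ \<omega>] \<delta> cont unif off_axis_bound_compact[OF g K(1,3)] \<epsilon>]
  show ?thesis
  proof (rule eventually_mono)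
    fix n
    assume *: "\<forall>x\<in>K. \<forall>k. norm (complex_of_real (sqrt (h n \<omega>) * exp (- exp x * h n \<omega>)) *
        (LINT \<theta>|lborel. indicator {-pi..pi} \<theta> *\<^sub>R (\<Phi> n (Complex x \<theta>) \<omega> * exp (- \<i> * (\<theta> * real k))))
      - W x \<omega> * complex_of_real (sqrt (2 * pi / exp x) * exp (- (k - exp x * h n \<omega>)\<^sup>2 / (2 * exp x * h n \<omega>)))) \<le> \<epsilon>"
    show "\<forall>x\<in>K. \<forall>k::nat.
      \<bar>sqrt (h n \<omega>) * exp (- exp x * h n \<omega>) * (2 * pi * real (level n k \<omega>) * exp (x * k - S k))
      - w x \<omega> * (sqrt (2 * pi / exp x) * exp (- (k - exp x * h n \<omega>)\<^sup>2 / (2 * exp x * h n \<omega>)))\<bar> \<le> \<epsilon>"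
    proof (intro ballI allI)
      fix x and k :: nat assume x: "x \<in> K"
      then have Wx: "W (complex_of_real x) \<omega> = complex_of_real (w x \<omega>)" using tendsto_w(2)[OF g] K(3) by auto
      from *[rule_format, OF x, of k, unfolded level_fourier Wx of_real_mult[symmetric] of_real_diff[symmetric] norm_of_real]
      show "\<bar>sqrt (h n \<omega>) * exp (- exp x * h n \<omega>) * (2 * pi * real (level n k \<omega>) * exp (x * k - S k))
      - w x \<omega> * (sqrt (2 * pi / exp x) * exp (- (k - exp x * h n \<omega>)\<^sup>2 / (2 * exp x * h n \<omega>)))\<bar> \<le> \<epsilon>" .
    qed
  qed
qed

lemma eventually_h_ge: "\<forall>\<^sub>F n in sequentially. h n \<omega> \<ge> b"
  using h_at_top[of \<omega>] unfolding filterlim_at_top by blast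

lemma gaussian_profile:
  assumes g: "good \<omega>" and \<epsilon>: "\<epsilon> > 0"
  shows "\<forall>\<^sub>F n in sequentially. \<forall>k.
       \<bar>real (level n k \<omega>) - w 0 \<omega> * exp (h n \<omega>) / sqrt (2 * pi * h n \<omega>) *
            exp (S k - 1 / 2 * ((real k - h n \<omega>) / sqrt (h n \<omega>))\<^sup>2)\<bar>
         \<le> exp (S k) * (\<epsilon> * (exp (h n \<omega>) / sqrt (h n \<omega>)))"
  using profile_asymptotics[OF g, of "{0}" \<epsilon>, simplified, OF \<epsilon>] eventually_h_ge[of 1 \<omega>]
proof eventually_elim
  case (elim n)
  show ?case
  proof
    fix k
    define H where "H = h n \<omega>"
    have H: "H \<ge> 1" using elim(2) by (simp add: H_def)
    define G where "G = exp (- ((real k - H)\<^sup>2 / (2 * H)))"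
    \<comment> \<open>Undoes the normalisation of the Fourier coefficient, so that
      \<open>c1 * a\<close> is the level size.\<close>
    define c1 where "c1 = exp (S k) * (exp H / sqrt H) / (2 * pi)"
    have c1: "c1 > 0" using H by (simp add: c1_def)
    define a where "a = sqrt H * exp (- H) * (2 * pi * real (level n k \<omega>) * exp (- S k))"
    have ab: "\<bar>a - w 0 \<omega> * (sqrt (2 * pi) * G)\<bar> \<le> \<epsilon>"
      using elim(1)[rule_format, of k] by (simp add: a_def G_def H_def real_sqrt_mult mult_ac)
    have a1: "c1 * a = real (level n k \<omega>)"
      using H by (simp add: c1_def a_def exp_minus field_simps)
    have "sqrt (2 * pi) * sqrt (2 * pi) = 2 * pi" by simp
    then have s2: "sqrt (2 * pi) / (2 * pi) = 1 / sqrt (2 * pi)" by (simp add: field_simps)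
    have "c1 * (w 0 \<omega> * (sqrt (2 * pi) * G)) = w 0 \<omega> * exp H / sqrt H * (sqrt (2 * pi) / (2 * pi)) * (exp (S k) * G)"
      by (simp add: c1_def)
    also have "\<dots> = w 0 \<omega> * exp H / sqrt (2 * pi * H) * (exp (S k) * G)"
      unfolding s2 by (simp add: real_sqrt_mult)
    also have "exp (S k) * G = exp (S k - 1 / 2 * ((real k - H) / sqrt H)\<^sup>2)"
      using H by (simp add: G_def power_divide flip: exp_add)
    finally have b1: "c1 * (w 0 \<omega> * (sqrt (2 * pi) * G)) =
      w 0 \<omega> * exp H / sqrt (2 * pi * H) * exp (S k - 1 / 2 * ((real k - H) / sqrt H)\<^sup>2)" .
    have "\<bar>c1 * a - c1 * (w 0 \<omega> * (sqrt (2 * pi) * G))\<bar> = c1 * \<bar>a - w 0 \<omega> * (sqrt (2 * pi) * G)\<bar>"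
      using c1 by (simp add: abs_mult flip: right_diff_distrib)
    also have "\<dots> \<le> c1 * \<epsilon>" using ab c1 by (intro mult_left_mono) auto
    also have "\<dots> = exp (S k) * (\<epsilon> * (exp H / sqrt H)) / (2 * pi)" by (simp add: c1_def)
    also have "\<dots> \<le> exp (S k) * (\<epsilon> * (exp H / sqrt H)) / 1"
      using \<epsilon> H pi_gt3 by (intro divide_left_mono) auto
    finally show "\<bar>real (level n k \<omega>) - w 0 \<omega> * exp (h n \<omega>) / sqrt (2 * pi * h n \<omega>) *
            exp (S k - 1 / 2 * ((real k - h n \<omega>) / sqrt (h n \<omega>))\<^sup>2)\<bar>
         \<le> exp (S k) * (\<epsilon> * (exp (h n \<omega>) / sqrt (h n \<omega>)))"
      unfolding a1 b1 by (simp add: H_def)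
  qed
qed

text \<open>A saddle point argument: the line over \<open>z\<close> is the one whose Gaussian is
  centred at \<open>exp z * h n\<close>. There the main term is bounded away from 0, so an additive
  error becomes a bounded one in the exponent.\<close>

lemma large_deviation_profile:
  fixes K :: "real set"
  assumes g: "good \<omega>" and K: "compact K" "K \<subseteq> {..<1}" and nz: "\<And>x. x \<in> K \<Longrightarrow> w x \<omega> \<noteq> 0"
  shows "\<exists>C. \<forall>\<^sub>F n in sequentially. \<forall>z\<in>K. \<exists>r. \<bar>r\<bar> \<le> C \<and>
     real (level n (nat \<lfloor>exp z * h n \<omega>\<rfloor>) \<omega>) =
       exp (S (nat \<lfloor>exp z * h n \<omega>\<rfloor>) + (1 - z) * exp z * h n \<omega> - 1 / 2 * ln (h n \<omega>) + r)"
proof (cases "K = {}")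
  case False
  have contw: "continuous_on K (\<lambda>x. w x \<omega>)" by (rule continuous_w[OF g K(2)])
  obtain xb where xb: "xb \<in> K" "\<And>x. x \<in> K \<Longrightarrow> w xb \<omega> \<le> w x \<omega>"
    using continuous_attains_inf[OF K(1) False contw] by blast
  obtain xB where xB: "xB \<in> K" "\<And>x. x \<in> K \<Longrightarrow> w x \<omega> \<le> w xB \<omega>"
    using continuous_attains_sup[OF K(1) False contw] by blast
  obtain x0 where x0: "x0 \<in> K" "\<And>x. x \<in> K \<Longrightarrow> x0 \<le> x"
    using compact_attains_inf[OF K(1) False] by blast
  define b where "b = w xb \<omega>"
  have b: "b > 0" using nz[OF xb(1)] tendsto_w(3)[OF g, of xb] xb(1) K(2) by (auto simp: b_def)
  \<comment> \<open>The main term will be at least \<open>b / 2\<close>, so the error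
    \<open>b / 4\<close> leaves the lower bound \<open>b / 4\<close>; \<open>B\<close> is the
    corresponding upper bound.\<close>
  have b4: "b / 4 > 0" using b by simp
  define B where "B = w xB \<omega> * sqrt (2 * pi / exp x0) + b / 4"
  define C where "C = \<bar>ln (b / 4)\<bar> + \<bar>ln B\<bar> + ln (2 * pi) + (\<bar>x0\<bar> + 1)"
  have "\<forall>\<^sub>F n in sequentially. \<forall>z\<in>K. \<exists>r. \<bar>r\<bar> \<le> C \<and>
     real (level n (nat \<lfloor>exp z * h n \<omega>\<rfloor>) \<omega>) =
       exp (S (nat \<lfloor>exp z * h n \<omega>\<rfloor>) + (1 - z) * exp z * h n \<omega> - 1 / 2 * ln (h n \<omega>) + r)"
    using profile_asymptotics[OF g K(1) False K(2) b4] eventually_h_ge[of "max 1 (1 / exp x0)" \<omega>]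
  proof (eventually_elim)
    case (elim n)
    have pa: "\<forall>x\<in>K. \<forall>k::nat.
    \<bar>sqrt (h n \<omega>) * exp (- exp x * h n \<omega>) * (2 * pi * real (level n k \<omega>) * exp (x * k - S k))
      - w x \<omega> * (sqrt (2 * pi / exp x) * exp (- (k - exp x * h n \<omega>)\<^sup>2 / (2 * exp x * h n \<omega>)))\<bar> \<le> b / 4"
      using elim by blast
    show ?case
    proof
      fix z assume z: "z \<in> K"
      define H where "H = h n \<omega>"
      have H: "H \<ge> 1" "H \<ge> 1 / exp x0" using elim by (auto simp: H_def)
      define l where "l = exp z * H"
      define k where "k = nat \<lfloor>l\<rfloor>"
      have z1: "z < 1" "x0 \<le> z" using z K(2) x0 by auto
      have "1 \<le> exp x0 * H" using H(2) by (simp add: field_simps)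
      also have "\<dots> \<le> l" unfolding l_def using z1 H by (intro mult_right_mono) auto
      finally have l: "l \<ge> 1" .
      have k: "\<bar>real k - l\<bar> \<le> 1" using l unfolding k_def by linarith
      \<comment> \<open>Rounding moves \<open>k\<close> by at most 1 from the centre, hence
        \<open>E\<close> lies between \<open>1 / 2\<close> and 1.\<close>
      define E where "E = exp (- (real k - l)\<^sup>2 / (2 * l))"
      have "(real k - l)\<^sup>2 \<le> 1" using k by (simp add: abs_square_le_1)
      then have "- (real k - l)\<^sup>2 / (2 * l) \<ge> - (1 / 2)" using l by (simp add: field_simps)
      then have "E \<ge> exp (- (1 / 2))" unfolding E_def exp_le_cancel_iff .
      moreover have "exp (- (1 / 2)) \<ge> 1 + - (1 / 2 :: real)" by (rule exp_ge_add_one_self)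
      ultimately have "E \<ge> 1 / 2" by linarith
      moreover have "E \<le> 1" "E > 0" using l by (auto simp: E_def)
      ultimately have E: "E \<ge> 1 / 2" "E \<le> 1" "E > 0" by blast+
      define s where "s = sqrt (2 * pi / exp z)"
      have "exp z \<le> exp (1::real)" using z1 by simp
      also have "\<dots> \<le> 2 * pi" using exp_le pi_gt3 by linarith
      finally have s: "s \<ge> 1" unfolding s_def by (simp add: field_simps)
      have s': "s \<le> sqrt (2 * pi / exp x0)" unfolding s_def using z1 by (intro real_sqrt_le_mono divide_left_mono) auto
      define a where "a = sqrt H * exp (- l) * (2 * pi * real (level n k \<omega>) * exp (z * k - S k))"
      have ab: "\<bar>a - w z \<omega> * (s * E)\<bar> \<le> b / 4"
        using pa[rule_format, OF z, of k] by (simp add: a_def l_def H_def s_def E_def mult.assoc)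
      have "b * (1 * (1 / 2)) \<le> w z \<omega> * (s * E)"
        using xb(2)[OF z] E s b by (intro mult_mono) (auto simp: b_def)
      then have alow: "a \<ge> b / 4" using ab by linarith
      have "w z \<omega> * (s * E) \<le> w xB \<omega> * (sqrt (2 * pi / exp x0) * 1)"
        using xB(2)[OF z] E s s' b xb(2)[OF xB(1)] by (intro mult_mono) (auto simp: b_def)
      then have aup: "a \<le> B" unfolding B_def using ab by linarith
      have a: "a > 0" using alow b by linarith
      have "ln (b / 4) \<le> ln a" "ln a \<le> ln B" using alow aup a b by auto
      then have lna: "\<bar>ln a\<bar> \<le> \<bar>ln (b / 4)\<bar> + \<bar>ln B\<bar>" by linarith
      \<comment> \<open>The bounded rest: the logarithm of the normalised level size, the constant
        \<open>2 * pi\<close>, and the effect of the rounding on \<open>exp (z * k)\<close>.\<close>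
      define r where "r = ln a - ln (2 * pi) + z * (l - real k)"
      have "\<bar>z\<bar> \<le> \<bar>x0\<bar> + 1" using z1 by linarith
      then have "\<bar>z * (l - real k)\<bar> \<le> (\<bar>x0\<bar> + 1) * 1"
        unfolding abs_mult using k by (intro mult_mono) (auto simp: abs_minus_commute)
      moreover have "ln (2 * pi) \<ge> 0" using pi_gt3 by (intro ln_ge_zero) linarith
      moreover have "\<bar>s1 - t + u\<bar> \<le> s2 + s3 + t + v" if "\<bar>u\<bar> \<le> v * 1" "0 \<le> t" "\<bar>s1\<bar> \<le> s2 + s3" for s1 s2 s3 t u v :: real
        using that by simp
      ultimately have r: "\<bar>r\<bar> \<le> C" unfolding r_def C_def using lna by blast
      have "real (level n k \<omega>) = a / (2 * pi) * exp (S k - z * k) * exp l / sqrt H"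
        using H unfolding a_def by (simp add: exp_minus exp_diff field_simps)
      also have "\<dots> = exp (ln a - ln (2 * pi)) * exp (S k - z * k) * exp l * exp (- (1 / 2 * ln H))"
      proof -
        have "sqrt H = exp (1 / 2 * ln H)" using H by (simp add: powr_def flip: powr_half_sqrt)
        moreover have "a / (2 * pi) = exp (ln a - ln (2 * pi))" using a by (simp add: exp_diff)
        ultimately show ?thesis by (simp add: exp_minus field_simps)
      qed
      also have "\<dots> = exp (S k + (1 - z) * exp z * H - 1 / 2 * ln H + r)"
        unfolding exp_add[symmetric] by (rule arg_cong[where f = exp]) (simp add: r_def l_def algebra_simps)
      finally have "real (level n k \<omega>) = exp (S k + (1 - z) * exp z * H - 1 / 2 * ln H + r)" .
      then show "\<exists>r. \<bar>r\<bar> \<le> C \<and> real (level n (nat \<lfloor>exp z * h n \<omega>\<rfloor>) \<omega>) =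
       exp (S (nat \<lfloor>exp z * h n \<omega>\<rfloor>) + (1 - z) * exp z * h n \<omega> - 1 / 2 * ln (h n \<omega>) + r)"
        using r unfolding k_def l_def H_def by blast
    qed
  qed
  then show ?thesis by blast
qed auto

text \<open>Two evaluations of \<open>\<phi> n 0\<close> are compared. It is asymptotic to
  \<open>w 0\<close> times \<open>exp (h n)\<close> with a positive \<open>w 0\<close>, and it
  equals \<open>n\<close> up to a factor \<open>exp (e * D + C)\<close>, where the depth bound
  \<open>D\<close> is of order \<open>h n\<close> and \<open>e\<close> is arbitrary.\<close>

lemma ln_div_h_tendsto:
  assumes g: "good \<omega>"
  shows "(\<lambda>n. ln (real n) / h n \<omega>) \<longlonglongrightarrow> 1"
proof (rule LIMSEQ_I)
  fix r :: real assume r: "r > 0"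
  \<comment> \<open>Depths are at most \<open>2 * exp 1 * h n\<close> up to a constant, so the error
    from \<open>S\<close> is at most \<open>r / 4 * h n\<close> up to a constant.\<close>
  define e where "e = min (1 / 2) (r / (8 * exp 1))"
  have e: "e > 0" "e * exp 1 * 2 \<le> r / 4"
  proof -
    show "e > 0" using r by (simp add: e_def)
    have "e * (exp 1 * 2) \<le> r / (8 * exp 1) * (exp 1 * 2)" by (intro mult_right_mono) (auto simp: e_def)
    then show "e * exp 1 * 2 \<le> r / 4" by simp
  qed
  obtain C where C: "\<And>k. \<bar>S k\<bar> \<le> e * real k + C" using sublinear_bound[OF S_lim e(1)] by blast
  obtain B where B: "\<And>n v. n \<ge> n0 \<Longrightarrow> v \<le> n \<Longrightarrow> (1 - 1 / 2) * real (vdepth v \<omega>) \<le> exp 1 * h n \<omega> + B"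
  proof -
    obtain C' where "\<And>n. n \<ge> n0 \<Longrightarrow> \<phi> n 1 \<omega> \<le> C' * exp (exp 1 * h n \<omega>)" using g unfolding good_def by blast
    from depth_bound[OF this, of "1 / 2"] show ?thesis using that by auto
  qed
  define w0 where "w0 = w 0 \<omega>"
  have w0: "w0 > 0" using w_0_pos[OF g] by (simp add: w0_def)
  have lim: "(\<lambda>n. \<phi> n 0 \<omega> * exp (- exp 0 * h n \<omega>)) \<longlonglongrightarrow> w0" unfolding w0_def using tendsto_w(1)[OF g, of 0] by simp
  have w0h: "w0 / 2 < w0" "w0 < w0 + 1" using w0 by auto
  define c1 where "c1 = 2 * e * B + C + \<bar>ln (w0 + 1)\<bar> + \<bar>ln (w0 / 2)\<bar> + 1"
  have "\<forall>\<^sub>F n in sequentially. norm (ln (real n) / h n \<omega> - 1) < r"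
    using order_tendstoD(1)[OF lim w0h(1)] order_tendstoD(2)[OF lim w0h(2)] eventually_ge_at_top[of n0]
      eventually_h_ge[of "max 1 (4 * c1 / r)" \<omega>]
  proof (eventually_elim)
    case (elim n)
    define H where "H = h n \<omega>"
    have H: "H \<ge> 1" "H \<ge> 4 * c1 / r" using elim by (auto simp: H_def)
    define D where "D = 2 * exp 1 * H + 2 * B"
    have d: "real (vdepth v \<omega>) \<le> D" if "v \<le> n" for v using B[OF _ that] elim by (simp add: D_def H_def)
    have lo: "real (Suc n) * exp (- (e * D + C)) \<le> \<phi> n 0 \<omega>" by (rule \<phi>_bounds_of_depth(1)[OF C e(1) d])
    have up: "\<phi> n 0 \<omega> \<le> real (Suc n) * exp ((0 + e) * D + C)" by (rule \<phi>_bounds_of_depth(2)[OF C e(1) d]) auto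
    have p1: "w0 / 2 < \<phi> n 0 \<omega> * exp (- H)" and p2: "\<phi> n 0 \<omega> * exp (- H) < w0 + 1" using elim w0 by (auto simp: H_def)
    have \<phi>1: "exp (ln (w0 / 2) + H) < \<phi> n 0 \<omega>" using p1 w0 by (simp add: exp_add exp_minus field_simps)
    have \<phi>2: "\<phi> n 0 \<omega> < exp (ln (w0 + 1) + H)" using p2 w0 by (simp add: exp_add exp_minus field_simps)
    have "exp (ln (real (Suc n)) - (e * D + C)) < exp (ln (w0 + 1) + H)"
      using lo \<phi>2 by (simp add: exp_diff exp_minus divide_inverse exp_add)
    then have u1: "ln (real (Suc n)) < ln (w0 + 1) + H + (e * D + C)" by simp
    have "exp (ln (w0 / 2) + H) < exp (ln (real (Suc n)) + (e * D + C))" using up \<phi>1 by (simp add: exp_add)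
    then have u2: "ln (w0 / 2) + H < ln (real (Suc n)) + (e * D + C)" by simp
    have npos: "real n > 0" using elim n0_pos by simp
    have "ln (real (Suc n) / real n) \<le> real (Suc n) / real n - 1" using npos by (intro ln_le_minus_one) simp
    also have "\<dots> \<le> 1" using npos by (simp add: field_simps)
    finally have u3: "ln (real (Suc n)) \<le> ln (real n) + 1" using npos by (simp add: ln_div)
    have u4: "ln (real n) \<le> ln (real (Suc n))" using npos by simp
    have "e * D + C = e * exp 1 * 2 * H + 2 * e * B + C" by (simp add: D_def algebra_simps)
    also have "\<dots> \<le> r / 4 * H + 2 * e * B + C" using e(2) H(1) by (intro add_right_mono mult_right_mono) auto
    finally have eD: "e * D + C \<le> r / 4 * H + 2 * e * B + C" .
    have "\<bar>ln (real n) - H\<bar> \<le> r / 4 * H + c1" unfolding c1_def using u1 u2 u3 u4 eD by linarith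
    also have "c1 \<le> r / 4 * H" using H(2) r by (simp add: field_simps)
    also have "r / 4 * H + r / 4 * H < r * H" using r H(1) by simp
    finally have "\<bar>ln (real n) - H\<bar> < r * H" by simp
    moreover have "ln (real n) / H - 1 = (ln (real n) - H) / H" using H(1) by (simp add: diff_divide_distrib)
    ultimately show ?case using H(1) by (simp add: abs_divide divide_less_eq flip: H_def)
  qed
  then show "\<exists>N. \<forall>n\<ge>N. norm (ln (real n) / h n \<omega> - 1) < r" unfolding eventually_sequentially .
qed

text \<open>The upper bound is \<open>depth_bound\<close>. For the lower one, a parameter
  \<open>x\<close> close to 1 with \<open>w x \<omega> \<noteq> 0\<close> makes the level at
  \<open>exp x * h n\<close> non-empty.\<close>

lemma max_depth_div_h_tendsto:
  assumes g: "good \<omega>"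
  shows "(\<lambda>n. real (Max ((\<lambda>v. vdepth v \<omega>) ` {..n})) / h n \<omega>) \<longlonglongrightarrow> exp 1"
proof (rule LIMSEQ_I)
  fix r' :: real assume r': "r' > 0"
  define r where "r = min r' 1"
  have r: "r > 0" "r \<le> 1" "r \<le> r'" using r' by (auto simp: r_def)
  \<comment> \<open>Small enough for \<open>exp 1 + r / 4 \<le> (1 - e) * (exp 1 + r)\<close>, which
    removes the factor \<open>1 - e\<close> of the depth bound.\<close>
  define e where "e = r / (4 * (exp 1 + 1))"
  have e1: "exp 1 + 1 > (0::real)" by (simp add: add_pos_pos)
  have "r \<le> exp 1 + 1" using r(2) exp_gt_zero[of "1::real"] by linarith
  then have e: "e > 0" "e \<le> 1 / 4" using r(1) e1 by (auto simp: e_def pos_divide_le_eq)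
  obtain B where B: "\<And>n v. n \<ge> n0 \<Longrightarrow> v \<le> n \<Longrightarrow> (1 - e) * real (vdepth v \<omega>) \<le> exp 1 * h n \<omega> + B"
  proof -
    obtain C' where "\<And>n. n \<ge> n0 \<Longrightarrow> \<phi> n 1 \<omega> \<le> C' * exp (exp 1 * h n \<omega>)" using g unfolding good_def by blast
    from depth_bound[OF this e(1)] show ?thesis using that by auto
  qed
  have "exp 1 - r / 2 > 0" using r exp_ge_add_one_self[of "1::real"] by linarith
  then have lnlt: "ln (exp 1 - r / 2) < 1" using r(1) by (metis diff_less_eq less_add_same_cancel1 half_gt_zero ln_exp ln_less_cancel_iff exp_gt_zero)
  \<comment> \<open>The zeros are countable, so they cannot fill an interval; this is how a zero of
    \<open>w\<close> at a particular point near 1 is avoided.\<close>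
  have "\<not> {ln (exp 1 - r / 2)<..<1} \<subseteq> {x. x < 1 \<and> w x \<omega> = 0}"
    using countable_isolated_points[OF zeros_isolated[OF g]] uncountable_open_interval[of "ln (exp 1 - r / 2)" 1] lnlt countable_subset by blast
  then obtain x where "x \<in> {ln (exp 1 - r / 2)<..<1}" "x \<notin> {x. x < 1 \<and> w x \<omega> = 0}" by blast
  then have x: "ln (exp 1 - r / 2) < x" "x < 1" "w x \<omega> \<noteq> 0" by simp_all
  have ex: "exp 1 - r / 2 < exp x" using x(1) \<open>exp 1 - r / 2 > 0\<close> by (metis exp_less_mono exp_ln)
  obtain C where C: "\<forall>\<^sub>F n in sequentially. \<forall>z\<in>{x}. \<exists>r. \<bar>r\<bar> \<le> C \<and>
     real (level n (nat \<lfloor>exp z * h n \<omega>\<rfloor>) \<omega>) =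
       exp (S (nat \<lfloor>exp z * h n \<omega>\<rfloor>) + (1 - z) * exp z * h n \<omega> - 1 / 2 * ln (h n \<omega>) + r)"
    using large_deviation_profile[OF g, of "{x}"] x by auto
  have "\<forall>\<^sub>F n in sequentially. norm (real (Max ((\<lambda>v. vdepth v \<omega>) ` {..n})) / h n \<omega> - exp 1) < r'"
    using C eventually_ge_at_top[of n0] eventually_h_ge[of "max 1 (max (4 / r) (4 * (\<bar>B\<bar> + 1) / r))" \<omega>]
  proof eventually_elim
    case (elim n)
    define H where "H = h n \<omega>"
    have H: "H \<ge> 1" "H \<ge> 4 / r" "H \<ge> 4 * (\<bar>B\<bar> + 1) / r" using elim by (auto simp: H_def)
    define D where "D = Max ((\<lambda>v. vdepth v \<omega>) ` {..n})"
    have "D \<in> (\<lambda>v. vdepth v \<omega>) ` {..n}" unfolding D_def by (rule Max_in) auto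
    then obtain v where v: "v \<le> n" "D = vdepth v \<omega>" by blast
    from elim(1) obtain \<rho> where "real (level n (nat \<lfloor>exp x * h n \<omega>\<rfloor>) \<omega>) =
        exp (S (nat \<lfloor>exp x * h n \<omega>\<rfloor>) + (1 - x) * exp x * h n \<omega> - 1 / 2 * ln (h n \<omega>) + \<rho>)" by blast
    then have "real (level n (nat \<lfloor>exp x * H\<rfloor>) \<omega>) > 0" unfolding H_def by (simp only: exp_gt_zero)
    then have "{v. v \<le> n \<and> vdepth v \<omega> = nat \<lfloor>exp x * H\<rfloor>} \<noteq> {}" unfolding level_def by (metis card.empty of_nat_0 less_irrefl)
    then obtain u where u: "u \<le> n" "vdepth u \<omega> = nat \<lfloor>exp x * H\<rfloor>" by blast
    have "vdepth u \<omega> \<le> D" unfolding D_def using u(1) by (intro Max_ge) auto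
    then have "exp x * H - 1 \<le> real D" unfolding u(2) by linarith
    moreover have "(exp 1 - r / 2) * H \<le> exp x * H" using ex H(1) by (intro mult_right_mono) auto
    moreover have "1 \<le> r / 4 * H" using H(2) r by (simp add: field_simps)
    moreover have "0 < r / 4 * H" using H(1) r by simp
    ultimately have low: "exp 1 * H - r * H < real D" by (simp add: algebra_simps)
    have "(1 - e) * real D \<le> exp 1 * H + B" using B[OF elim(2) v(1)] v(2) by (simp add: H_def)
    moreover have "\<bar>B\<bar> + 1 \<le> r / 4 * H" using H(3) r by (simp add: field_simps)
    ultimately have "(1 - e) * real D < (exp 1 + r / 4) * H" by (simp add: algebra_simps)
    also have "\<dots> \<le> (1 - e) * ((exp 1 + r) * H)"
    proof -
      have "e * (exp 1 + r) \<le> e * (exp 1 + 1)" using e r by (intro mult_left_mono) auto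
      also have "\<dots> = r / 4"
      proof -
        have "r / (4 * a) * a = r / 4" if "a > 0" for a :: real using that by simp
        then show ?thesis unfolding e_def using e1 by blast
      qed
      finally have "exp 1 + r / 4 \<le> (1 - e) * (exp 1 + r)" using r by (simp add: algebra_simps)
      then show ?thesis using H(1) by (simp add: mult.assoc[symmetric] mult_right_mono)
    qed
    finally have up: "real D < (exp 1 + r) * H" using e by simp
    have "\<bar>real D - exp 1 * H\<bar> < r * H" using low up by (simp add: algebra_simps abs_less_iff)
    also have "\<dots> \<le> r' * H" using r H(1) by (intro mult_right_mono) auto
    finally have "\<bar>real D - exp 1 * H\<bar> < r' * H" .
    moreover have "real D / H - exp 1 = (real D - exp 1 * H) / H" using H(1) by (simp add: diff_divide_distrib)
    ultimately show ?case using H(1) by (simp add: abs_divide divide_less_eq flip: H_def D_def)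
  qed
  then show "\<exists>N. \<forall>n\<ge>N. norm (real (Max ((\<lambda>v. vdepth v \<omega>) ` {..n})) / h n \<omega> - exp 1) < r'" unfolding eventually_sequentially .
qed

text \<open>Cutting \<open>K\<close> at \<open>1 - 1 / Suc j\<close> gives compact pieces on which
  \<open>w\<close> is continuous. On such a piece \<open>w\<close> has no zero if and only if it is
  at least some \<open>1 / Suc i\<close> on a countable dense subset, and this is a condition on
  countably many random variables.\<close>

lemma zero_set_avoids_measurable:
  assumes G: "G \<in> sets M" "\<And>\<omega>. \<omega> \<in> G \<Longrightarrow> good \<omega>" and K: "compact K"
  shows "{\<omega> \<in> G. \<forall>x\<in>K. x < 1 \<longrightarrow> w x \<omega> \<noteq> 0} \<in> sets M"
proof -
  define Kj where "Kj = (\<lambda>j::nat. K \<inter> {..1 - 1 / real (Suc j)})"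
  have compKj: "compact (Kj j)" and Kj1: "Kj j \<subseteq> {..<1}" for j
  proof -
    show "compact (Kj j)" unfolding Kj_def by (intro compact_Int_closed K) auto
    have "1 / real (Suc j) > 0" by simp
    then show "Kj j \<subseteq> {..<1}" unfolding Kj_def by (auto intro: le_less_trans)
  qed
  have "\<exists>T. countable T \<and> T \<subseteq> Kj j \<and> Kj j \<subseteq> closure T" for j using separable[of "Kj j"] by metis
  then obtain D where D: "\<And>j. countable (D j)" "\<And>j. D j \<subseteq> Kj j" "\<And>j. Kj j \<subseteq> closure (D j)" by metis
  have eq: "{\<omega> \<in> G. \<forall>x\<in>K. x < 1 \<longrightarrow> w x \<omega> \<noteq> 0} = G \<inter> (\<Inter>j. \<Union>i::nat. {\<omega> \<in> space M. \<forall>x\<in>D j. 1 / real (Suc i) \<le> w x \<omega>})"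
  proof (intro equalityI subsetI)
    fix \<omega> assume "\<omega> \<in> {\<omega> \<in> G. \<forall>x\<in>K. x < 1 \<longrightarrow> w x \<omega> \<noteq> 0}"
    then have \<omega>: "\<omega> \<in> G" "\<And>x. x \<in> K \<Longrightarrow> x < 1 \<Longrightarrow> w x \<omega> \<noteq> 0" by auto
    have g: "good \<omega>" by (rule G(2)[OF \<omega>(1)])
    have "\<exists>i::nat. \<forall>x\<in>D j. 1 / real (Suc i) \<le> w x \<omega>" for j
    proof (cases "Kj j = {}")
      case False
      obtain x0 where x0: "x0 \<in> Kj j" "\<And>x. x \<in> Kj j \<Longrightarrow> w x0 \<omega> \<le> w x \<omega>"
        using continuous_attains_inf[OF compKj False continuous_w[OF g Kj1]] by blast
      have "x0 < 1" "x0 \<in> K" using x0(1) Kj1 by (auto simp: Kj_def)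
      then have "w x0 \<omega> > 0" using \<omega>(2) tendsto_w(3)[OF g] by (metis less_eq_real_def)
      then obtain i :: nat where "inverse (real (Suc i)) < w x0 \<omega>" using reals_Archimedean by blast
      then have "1 / real (Suc i) < w x0 \<omega>" by (simp add: inverse_eq_divide)
      then show ?thesis using x0(2) D(2) by (meson less_imp_le order_trans subsetD)
    qed (use D(2) in auto)
    then show "\<omega> \<in> G \<inter> (\<Inter>j. \<Union>i::nat. {\<omega> \<in> space M. \<forall>x\<in>D j. 1 / real (Suc i) \<le> w x \<omega>})"
      using \<omega>(1) sets.sets_into_space[OF G(1)] by blast
  next
    fix \<omega> assume "\<omega> \<in> G \<inter> (\<Inter>j. \<Union>i::nat. {\<omega> \<in> space M. \<forall>x\<in>D j. 1 / real (Suc i) \<le> w x \<omega>})"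
    then have \<omega>: "\<omega> \<in> G" "\<And>j. \<exists>i::nat. \<forall>x\<in>D j. 1 / real (Suc i) \<le> w x \<omega>" by auto
    have g: "good \<omega>" by (rule G(2)[OF \<omega>(1)])
    have "w x \<omega> \<noteq> 0" if x: "x \<in> K" "x < 1" for x
    proof -
      obtain j :: nat where "inverse (real (Suc j)) < 1 - x" using x(2) reals_Archimedean[of "1 - x"] by auto
      then have xj: "x \<in> Kj j" using x(1) by (simp add: Kj_def inverse_eq_divide)
      obtain i :: nat where i: "\<forall>x\<in>D j. 1 / real (Suc i) \<le> w x \<omega>" using \<omega>(2) by blast
      have "closed {y \<in> Kj j. 1 / real (Suc i) \<le> w y \<omega>}"
        by (intro continuous_on_closed_Collect_le continuous_on_const continuous_w[OF g Kj1] compact_imp_closed[OF compKj])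
      moreover have "D j \<subseteq> {y \<in> Kj j. 1 / real (Suc i) \<le> w y \<omega>}" using i D(2) by blast
      ultimately have "closure (D j) \<subseteq> {y \<in> Kj j. 1 / real (Suc i) \<le> w y \<omega>}" by (rule closure_minimal[rotated])
      then have "1 / real (Suc i) \<le> w x \<omega>" using D(3) xj by blast
      moreover have "1 / real (Suc i) > 0" by simp
      ultimately show ?thesis by linarith
    qed
    then show "\<omega> \<in> {\<omega> \<in> G. \<forall>x\<in>K. x < 1 \<longrightarrow> w x \<omega> \<noteq> 0}" using \<omega>(1) by blast
  qed
  have "{\<omega> \<in> space M. \<forall>x\<in>D j. 1 / real (Suc i) \<le> w x \<omega>} \<in> sets M" for i j
  proof (cases "D j = {}")
    case False
    have "{\<omega> \<in> space M. \<forall>x\<in>D j. 1 / real (Suc i) \<le> w x \<omega>} = (\<Inter>x\<in>D j. {\<omega> \<in> space M. 1 / real (Suc i) \<le> w x \<omega>})"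
      using False by auto
    also have "\<dots> \<in> sets M"
      by (intro sets.countable_INT' D(1) False image_subsetI borel_measurable_le borel_measurable_const borel_measurable_w)
    finally show ?thesis .
  qed simp
  then show ?thesis unfolding eq using G(1) by (intro sets.Int sets.countable_INT' sets.countable_UN) auto
qed

end

section \<open>The theorem, assembled on a measurable event of full probability\<close>

theorem theorem1p1:
  fixes M :: "'a measure" and f :: "nat \<Rightarrow> real" and c :: real
    and T :: "nat \<Rightarrow> 'a \<Rightarrow> nat rooted_tree" and X :: "nat \<Rightarrow> 'a \<Rightarrow> nat"
  defines "S \<equiv> log_weight_sum f"
    and "L \<equiv> \<lambda>\<omega> n k. real (level_size (T n \<omega>) k)"
    and "h \<equiv> \<lambda>\<omega> n. intrinsic_time f c (\<lambda>i. T i \<omega>) n"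
  assumes rrt: "depth_weighted_rrt M f T X"
    and c_pos: "c > 0"
    and f_bounds: "\<And>n. c \<le> f n \<and> f n \<le> 1 / c"
    and S_lim: "(\<lambda>n. S n / real n) \<longlonglongrightarrow> 0"
  shows "\<exists>(W :: 'a \<Rightarrow> real) (\<Z> :: 'a \<Rightarrow> real set).
    W \<in> borel_measurable M \<and> (\<forall>\<omega>\<in>space M. W \<omega> > 0) \<and>
    random_set M \<Z> \<and>
    (\<forall>\<omega>\<in>space M. \<Z> \<omega> \<subseteq> {..<1} - {0} \<and> countable (\<Z> \<omega>) \<and>
       (\<forall>z\<in>\<Z> \<omega>. isolated_point z (\<Z> \<omega>))) \<and>
    (AE \<omega> in M. \<forall>\<epsilon>>0. \<forall>\<^sub>F n in sequentially. \<forall>k.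
       \<bar>L \<omega> n k - W \<omega> * exp (h \<omega> n) / sqrt (2 * pi * h \<omega> n) *
            exp (S k - 1 / 2 * ((real k - h \<omega> n) / sqrt (h \<omega> n))\<^sup>2)\<bar>
         \<le> exp (S k) * (\<epsilon> * (exp (h \<omega> n) / sqrt (h \<omega> n)))) \<and>
    (\<forall>K. compact K \<and> K \<subseteq> {..<1} \<longrightarrow>
       (AE \<omega> in M. K \<inter> \<Z> \<omega> = {} \<longrightarrow>
          (\<exists>C. \<forall>\<^sub>F n in sequentially. \<forall>z\<in>K. \<exists>r. \<bar>r\<bar> \<le> C \<and>
             L \<omega> n (nat \<lfloor>exp z * h \<omega> n\<rfloor>) =
               exp (S (nat \<lfloor>exp z * h \<omega> n\<rfloor>) + (1 - z) * exp z * h \<omega> n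
                    - 1 / 2 * ln (h \<omega> n) + r)))) \<and>
    (AE \<omega> in M. (\<lambda>n. h \<omega> n / ln (real n)) \<longlonglongrightarrow> 1 \<and>
       (\<lambda>n. real (tree_depth (T n \<omega>)) / ln (real n)) \<longlonglongrightarrow> exp 1)"
proof -
  interpret b: bounded_rrt M f T X c
    by (rule bounded_rrt.intro[OF rrt bounded_rrt_axioms.intro[OF c_pos f_bounds S_lim[unfolded S_def]]])
  have heq: "h \<omega> n = b.h n \<omega>" if "\<omega> \<in> space M" for \<omega> n
    using that by (simp add: h_def intrinsic_time_def b.h_def b.Z_def b.total_weight_T)
  have Leq: "L \<omega> n k = real (b.level n k \<omega>)" if "\<omega> \<in> space M" for \<omega> n k
    using that by (simp add: L_def b.level_def b.level_size_T)
  obtain N where N: "{\<omega> \<in> space M. \<not> b.good \<omega>} \<subseteq> N" "emeasure M N = 0" "N \<in> sets M"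
    by (rule AE_E[OF b.AE_good])
  have null: "N \<in> null_sets M" using N(2,3) by (rule null_setsI)
  \<comment> \<open>A measurable event of probability 1 inside \<open>good\<close>. Off
    \<open>G\<close> the values 1 and the empty set are taken, so that positivity and the claims on
    the random set hold for every outcome.\<close>
  define G where "G = space M - N"
  have G: "G \<in> sets M" "\<And>\<omega>. \<omega> \<in> G \<Longrightarrow> b.good \<omega>" "G \<subseteq> space M" using N by (auto simp: G_def)
  have AEG: "AE \<omega> in M. \<omega> \<in> G" using AE_not_in[OF null] AE_space by eventually_elim (simp add: G_def)
  define W where "W = (\<lambda>\<omega>. if \<omega> \<in> G then b.w 0 \<omega> else 1)"
  define \<Z> where "\<Z> = (\<lambda>\<omega>. if \<omega> \<in> G then {x. x < 1 \<and> b.w x \<omega> = 0} else {})"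
  show ?thesis
  proof (intro exI[of _ W] exI[of _ \<Z>] conjI ballI allI impI)
    show "W \<in> borel_measurable M" unfolding W_def
      by (intro measurable_If_set b.borel_measurable_w) (use G in auto)
    show "W \<omega> > 0" for \<omega> using b.w_0_pos[of \<omega>] G(2) by (simp add: W_def)
    show "random_set M \<Z>" unfolding random_set_def
    proof (intro allI impI)
      fix K :: "real set" assume K: "compact K"
      have "{\<omega> \<in> space M. K \<inter> \<Z> \<omega> = {}} = (space M - G) \<union> {\<omega> \<in> G. \<forall>x\<in>K. x < 1 \<longrightarrow> b.w x \<omega> \<noteq> 0}"
        using G(3) by (auto simp: \<Z>_def)
      also have "\<dots> \<in> sets M" using b.zero_set_avoids_measurable[OF G(1,2) K] G(1) by auto
      finally show "{\<omega> \<in> space M. K \<inter> \<Z> \<omega> = {}} \<in> sets M" .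
    qed
    fix \<omega>
    show "\<Z> \<omega> \<subseteq> {..<1} - {0}" using b.w_0_pos[of \<omega>] G(2) by (auto simp: \<Z>_def)
    have iso: "isolated_point z (\<Z> \<omega>)" if "z \<in> \<Z> \<omega>" for z
      using b.zeros_isolated[of \<omega> z] G(2) that by (auto simp: \<Z>_def split: if_splits)
    show "isolated_point z (\<Z> \<omega>)" if "z \<in> \<Z> \<omega>" for z by (rule iso[OF that])
    show "countable (\<Z> \<omega>)" by (rule countable_isolated_points[OF iso])
  next
    show "AE \<omega> in M. \<forall>\<epsilon>>0. \<forall>\<^sub>F n in sequentially. \<forall>k.
       \<bar>L \<omega> n k - W \<omega> * exp (h \<omega> n) / sqrt (2 * pi * h \<omega> n) *
            exp (S k - 1 / 2 * ((real k - h \<omega> n) / sqrt (h \<omega> n))\<^sup>2)\<bar>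
         \<le> exp (S k) * (\<epsilon> * (exp (h \<omega> n) / sqrt (h \<omega> n)))"
      using AEG
    proof eventually_elim
      case (elim \<omega>)
      then have \<omega>: "\<omega> \<in> space M" using G(3) by blast
      show ?case using b.gaussian_profile[OF G(2)[OF elim]] elim by (simp add: heq[OF \<omega>] Leq[OF \<omega>] W_def S_def)
    qed
  next
    fix K :: "real set" assume K: "compact K \<and> K \<subseteq> {..<1}"
    show "AE \<omega> in M. K \<inter> \<Z> \<omega> = {} \<longrightarrow>
          (\<exists>C. \<forall>\<^sub>F n in sequentially. \<forall>z\<in>K. \<exists>r. \<bar>r\<bar> \<le> C \<and>
             L \<omega> n (nat \<lfloor>exp z * h \<omega> n\<rfloor>) =
               exp (S (nat \<lfloor>exp z * h \<omega> n\<rfloor>) + (1 - z) * exp z * h \<omega> n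
                    - 1 / 2 * ln (h \<omega> n) + r))"
      using AEG
    proof eventually_elim
      case (elim \<omega>)
      then have \<omega>: "\<omega> \<in> space M" using G(3) by blast
      show ?case
      proof
        assume "K \<inter> \<Z> \<omega> = {}"
        then have "b.w x \<omega> \<noteq> 0" if "x \<in> K" for x using that elim K by (auto simp: \<Z>_def)
        from b.large_deviation_profile[OF G(2)[OF elim] _ _ this] K
        show "\<exists>C. \<forall>\<^sub>F n in sequentially. \<forall>z\<in>K. \<exists>r. \<bar>r\<bar> \<le> C \<and>
             L \<omega> n (nat \<lfloor>exp z * h \<omega> n\<rfloor>) =
               exp (S (nat \<lfloor>exp z * h \<omega> n\<rfloor>) + (1 - z) * exp z * h \<omega> n
                    - 1 / 2 * ln (h \<omega> n) + r)"
          by (simp add: heq[OF \<omega>] Leq[OF \<omega>] S_def)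
      qed
    qed
  next
    show "AE \<omega> in M. (\<lambda>n. h \<omega> n / ln (real n)) \<longlonglongrightarrow> 1 \<and>
       (\<lambda>n. real (tree_depth (T n \<omega>)) / ln (real n)) \<longlonglongrightarrow> exp 1"
      using AEG
    proof eventually_elim
      case (elim \<omega>)
      then have \<omega>: "\<omega> \<in> space M" using G(3) by blast
      have g: "b.good \<omega>" by (rule G(2)[OF elim])
      have "(\<lambda>n. inverse (ln (real n) / b.h n \<omega>)) \<longlonglongrightarrow> inverse 1"
        by (intro tendsto_inverse b.ln_div_h_tendsto g) simp
      then have 1: "(\<lambda>n. b.h n \<omega> / ln (real n)) \<longlonglongrightarrow> 1" by simp
      have "(\<lambda>n. real (Max ((\<lambda>v. b.vdepth v \<omega>) ` {..n})) / b.h n \<omega> * (b.h n \<omega> / ln (real n))) \<longlonglongrightarrow> exp 1 * 1"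
        by (intro tendsto_mult b.max_depth_div_h_tendsto g 1)
      moreover have "\<forall>\<^sub>F n in sequentially. real (Max ((\<lambda>v. b.vdepth v \<omega>) ` {..n})) / b.h n \<omega> * (b.h n \<omega> / ln (real n)) =
         real (tree_depth (T n \<omega>)) / ln (real n)"
        using b.eventually_h_ge[of 1 \<omega>] by eventually_elim (simp add: b.tree_depth_T[OF \<omega>])
      ultimately have "(\<lambda>n. real (tree_depth (T n \<omega>)) / ln (real n)) \<longlonglongrightarrow> exp 1 * 1"
        by (rule Lim_transform_eventually)
      then show ?case using 1 by (simp add: heq[OF \<omega>])
    qed
  qed
qed

end
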